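(* Let $n, N$ be natural numbers with $n \le N \le 2n$, and let $A$ be an $N\times n$ matrix whose entries are i.i.d. centered subgaussian random variables of variance $1$. Set $m = N - n + 1$. Then there exist $C > 0$ and $c \in (0,1)$, depending only on the distribution of the entries, such that for every $\varepsilon > 0$, $$\mathbb{P}\big(\exists x \in S^{n-1} : \|Ax\|_1 < \varepsilon m\big) \le \Big(\frac{CN}{m}\,\varepsilon\Big)^m + c^n.$$
   Context: A real random variable $\xi$ is subgaussian if there exist constants $C, v > 0$ such that $\mathbb{P}(|\xi| > t) \le C e^{-v t^2}$ for all $t > 0$; centered means $\mathbb{E}\xi=0$. $\|y\|_1 = \sum_j |y_j|$. *)

theory Defs
  imports "HOL-Probability.Probability"
begin

definition subgaussian_dist :: "real measure \<Rightarrow> bool" where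
  "subgaussian_dist M \<longleftrightarrow>
     (\<exists>C v. C > 0 \<and> v > 0 \<and>
        (\<forall>t>0. measure M {x \<in> space M. \<bar>x\<bar> > t} \<le> C * exp (- v * t\<^sup>2)))"

end

theory Submission
  imports Defs "HOL-Real_Asymp.Real_Asymp"
begin

text \<open>The maximum of the Euclidean norm over the convex set of all \<open>x\<close> with \<open>l1\<close> norm of \<open>A x\<close> at most 1 is
  attained where \<open>A x\<close> has at least \<open>n - 1\<close> vanishing coordinates. So if some unit vector has a small
  image, then for some set \<open>I\<close> of \<open>n - 1\<close> rows every unit vector \<open>x\<close> in the kernel of \<open>A\<^sub>I\<close> has a small
  image under the remaining \<open>m\<close> rows, which are independent of \<open>A\<^sub>I\<close>. If \<open>x\<close> has no rational structure,
  each of these rows has a small product with \<open>x\<close> with probability \<open>O(\<epsilon>)\<close>, and the union bound over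
  \<open>I\<close> costs \<open>(e N / m)^m\<close>. That kernels of \<open>(n - 1) \<times> n\<close> matrices contain no structured vector,
  up to probability \<open>c^n\<close>, follows from the Littlewood-Offord theory of Rudelson and Vershynin:
  vectors of small least common denominator lie near few multiples of integer points, fewer than
  the small ball estimate at the scale of the net can compensate. When \<open>m\<close> is proportional to \<open>n\<close> the union
  bound is too expensive, but a single net of constant scale suffices.\<close>

section \<open>Extremal vectors\<close>

text \<open>With \<open>N\<close> near \<open>n\<close>, a net of the sphere at scale \<epsilon> has
  about (C/\<epsilon>)^n points and each fails with probability about (C \<epsilon>)^N; the union
  bound leaves \<epsilon>^(m-1) times a factor exponential in \<open>n\<close>, so one power of
  \<epsilon> and the constant are lost. Passing to kernel vectors removes \<epsilon> from the nets:
  they only exclude structured kernel vectors, and \<epsilon> enters through the \<open>m\<close>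
  fresh rows alone. The event in the union bound asserts that all unit vectors of the kernel have a
  small image; so after conditioning any one of them may be tested, and no measurable choice of a
  kernel vector is made. The small ball estimates use Gaussian weights, whose Fourier representation
  is again Gaussian, so that all exchanges of integrals concern bounded functions. Finally, the
  exponential term must also dominate the probability that a small square matrix is singular;
  therefore finitely many sizes are treated separately, through two distinct points of the support
  of the law.\<close>

definition mv :: "nat \<Rightarrow> (nat \<times> nat \<Rightarrow> real) \<Rightarrow> (nat \<Rightarrow> real) \<Rightarrow> nat \<Rightarrow> real" where
  "mv n A x i = (\<Sum>j<n. A (i, j) * x j)"

text \<open>The row set is a parameter because the same expression is needed for all rows, for the
  rows conditioned on and for the remaining ones. Vectors are total functions of which only the
  coordinates below \<open>n\<close> matter.\<close>

definition l1 :: "nat set \<Rightarrow> nat \<Rightarrow> (nat \<times> nat \<Rightarrow> real) \<Rightarrow> (nat \<Rightarrow> real) \<Rightarrow> real" where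
  "l1 R n A x = (\<Sum>i\<in>R. \<bar>mv n A x i\<bar>)"

definition sph :: "nat \<Rightarrow> (nat \<Rightarrow> real) \<Rightarrow> bool" where
  "sph n x \<longleftrightarrow> (\<Sum>j<n. (x j)\<^sup>2) = 1"

lemma mv_add: "mv n A (\<lambda>j. x j + y j) i = mv n A x i + mv n A y i"
  by (simp add: mv_def ring_distribs sum.distrib)

lemma mv_scale: "mv n A (\<lambda>j. c * x j) i = c * mv n A x i"
  by (simp add: mv_def sum_distrib_left mult_ac)

lemma mv_cong: "(\<And>j. j < n \<Longrightarrow> x j = y j) \<Longrightarrow> mv n A x i = mv n A y i"
  by (simp add: mv_def)

lemma mv_diff: "mv n A (\<lambda>j. x j - y j) i = mv n A x i - mv n A y i"
  by (simp add: mv_def right_diff_distrib sum_subtractf)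

lemma mv_sum: "mv n A (\<lambda>j. \<Sum>k\<in>K. c k * y k j) i = (\<Sum>k\<in>K. c k * mv n A (y k) i)"
  unfolding mv_def sum_distrib_left
  by (subst sum.swap) (simp add: mult_ac)

lemma l1_nonneg: "0 \<le> l1 R n A x"
  by (simp add: l1_def sum_nonneg)

lemma l1_scale: "l1 R n A (\<lambda>j. c * x j) = \<bar>c\<bar> * l1 R n A x"
  by (simp add: l1_def mv_scale abs_mult sum_distrib_left)

lemma l1_triangle: "l1 R n A (\<lambda>j. x j + y j) \<le> l1 R n A x + l1 R n A y"
  by (auto simp: l1_def mv_add sum.distrib[symmetric] intro!: sum_mono abs_triangle_ineq)

text \<open>Gaussian elimination, by induction on the set of equations: an equation with a nonzero
  coefficient removes one unknown. Coefficients and unknowns are arbitrary in the induction since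
  both change in the step.\<close>

lemma homogeneous_system:
  fixes a :: "'i \<Rightarrow> 'j \<Rightarrow> real"
  assumes "finite R" "finite J" "card R < card J"
  shows "\<exists>x. (\<exists>j\<in>J. x j \<noteq> 0) \<and> (\<forall>i\<in>R. (\<Sum>j\<in>J. a i j * x j) = 0)"
  using assms
proof (induction R arbitrary: J a rule: finite_induct)
  case empty
  then have "J \<noteq> {}" by auto
  then obtain j where "j \<in> J" by auto
  then show ?case by (intro exI[of _ "\<lambda>_. 1"]) auto
next
  case (insert r R)
  show ?case
  proof (cases "\<forall>j\<in>J. a r j = 0")
    case True
    have "\<exists>x. (\<exists>j\<in>J. x j \<noteq> 0) \<and> (\<forall>i\<in>R. (\<Sum>j\<in>J. a i j * x j) = 0)"
      using insert.prems insert.hyps by (intro insert.IH) auto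
    then show ?thesis using True by auto
  next
    case False
    then obtain k where k: "k \<in> J" "a r k \<noteq> 0" by auto
    define J' where "J' = J - {k}"
    have J': "finite J'" "k \<notin> J'" "J = insert k J'" using k insert.prems by (auto simp: J'_def)
    \<comment> \<open>Row \<open>i\<close> minus the multiple of row \<open>r\<close> that cancels
      the unknown \<open>k\<close>.\<close>
    define a' where "a' i j = a i j - a i k * a r j / a r k" for i j
    have "card R < card J'" using insert J' by auto
    then obtain x where x: "\<exists>j\<in>J'. x j \<noteq> 0" "\<forall>i\<in>R. (\<Sum>j\<in>J'. a' i j * x j) = 0"
      using insert.IH[OF J'(1), of a'] by auto
    define w where "w = (\<Sum>j\<in>J'. a r j * x j)"
    define y where "y = x(k := - w / a r k)"
    have S: "(\<Sum>j\<in>J. a i j * y j) = (\<Sum>j\<in>J'. a i j * x j) - a i k * w / a r k" for i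
    proof -
      have "(\<Sum>j\<in>J'. a i j * y j) = (\<Sum>j\<in>J'. a i j * x j)"
        using J' by (intro sum.cong) (auto simp: y_def)
      then show ?thesis using J' by (simp add: y_def)
    qed
    have "(\<Sum>j\<in>J. a i j * y j) = 0" if "i \<in> R" for i
    proof -
      have "0 = (\<Sum>j\<in>J'. a' i j * x j)" using x that by auto
      also have "\<dots> = (\<Sum>j\<in>J'. a i j * x j - a i k / a r k * (a r j * x j))"
        by (simp add: a'_def left_diff_distrib mult.assoc)
      also have "\<dots> = (\<Sum>j\<in>J'. a i j * x j) - a i k / a r k * w"
        by (simp only: sum_subtractf sum_distrib_left[symmetric] w_def)
      finally show ?thesis using S by simp
    qed
    moreover have "(\<Sum>j\<in>J. a r j * y j) = 0" using S[of r] k by (simp add: w_def)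
    moreover have "\<exists>j\<in>J. y j \<noteq> 0" using x J' by (auto simp: y_def)
    ultimately show ?thesis by (intro exI[of _ y]) auto
  qed
qed

lemma sph_normalize:
  assumes "\<exists>j<n. x j \<noteq> 0"
  shows "0 < L2_set x {..<n}" "sph n (\<lambda>j. inverse (L2_set x {..<n}) * x j)"
proof -
  from assms obtain j where j: "j < n" "x j \<noteq> 0" by auto
  have "0 < (\<Sum>j<n. (x j)\<^sup>2)"
    using j by (intro sum_pos2[of _ j]) auto
  then show p: "0 < L2_set x {..<n}" by (simp add: L2_set_def)
  have "(\<Sum>j<n. (inverse (L2_set x {..<n}) * x j)\<^sup>2) = (inverse (L2_set x {..<n}))\<^sup>2 * (\<Sum>j<n. (x j)\<^sup>2)"
    by (simp add: power_mult_distrib sum_distrib_left)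
  also have "(\<Sum>j<n. (x j)\<^sup>2) = (L2_set x {..<n})\<^sup>2"
    by (simp add: L2_set_def sum_nonneg)
  finally show "sph n (\<lambda>j. inverse (L2_set x {..<n}) * x j)"
    using p by (simp add: sph_def power2_eq_square field_simps)
qed

text \<open>Provides the vector on which the event about all kernel vectors is tested after
  conditioning; with empty \<open>I\<close> it shows that the sphere is nonempty.\<close>

lemma kernel_sph:
  assumes "finite I" "card I < n"
  shows "\<exists>x. sph n x \<and> (\<forall>i\<in>I. mv n A x i = 0)"
proof -
  obtain x where x: "\<exists>j<n. x j \<noteq> 0" "\<forall>i\<in>I. (\<Sum>j<n. A (i, j) * x j) = 0"
    using homogeneous_system[of I "{..<n}" "\<lambda>i j. A (i, j)"] assms by auto
  then show ?thesis using sph_normalize[OF x(1)]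
    by (intro exI[of _ "\<lambda>j. inverse (L2_set x {..<n}) * x j"]) (auto simp: mv_scale, auto simp: mv_def)
qed

text \<open>A subset of \<open>Z\<close> of minimal size with the same kernel works. By minimality
  every row \<open>i\<close> of it has a dual vector, killed by the other rows but not by
  \<open>i\<close>. These vectors together with \<open>x\<close> are linearly independent, so there
  are at most \<open>n\<close> of them.\<close>

lemma row_basis:
  assumes "finite Z" "sph n x" "\<forall>i\<in>Z. mv n A x i = 0"
  shows "\<exists>I\<subseteq>Z. card I < n \<and> (\<forall>y. (\<forall>i\<in>I. mv n A y i = 0) \<longrightarrow> (\<forall>i\<in>Z. mv n A y i = 0))"
proof -
  define Q where "Q I \<longleftrightarrow> I \<subseteq> Z \<and> (\<forall>y. (\<forall>i\<in>I. mv n A y i = 0) \<longrightarrow> (\<forall>i\<in>Z. mv n A y i = 0))" for I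
  have "Q Z" by (auto simp: Q_def)
  then obtain I where I: "Q I" and min: "\<And>J. Q J \<Longrightarrow> card I \<le> card J"
    using ex_has_least_nat[of Q Z card] by auto
  have finI: "finite I" using I assms finite_subset by (auto simp: Q_def)
  have "card I < n"
  proof (rule ccontr)
    assume ge: "\<not> card I < n"
    have "\<exists>y. (\<forall>k\<in>I - {i}. mv n A y k = 0) \<and> mv n A y i \<noteq> 0" if "i \<in> I" for i
    proof -
      have "card (I - {i}) < card I" using finI that by (intro card_Diff1_less) auto
      then have "\<not> Q (I - {i})" using min by (metis not_le)
      then obtain y where y: "\<forall>k\<in>I - {i}. mv n A y k = 0" "\<not> (\<forall>i\<in>Z. mv n A y i = 0)"
        using I by (auto simp: Q_def)
      then have "mv n A y i \<noteq> 0" using I that by (auto simp: Q_def)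
      then show ?thesis using y by auto
    qed
    then obtain Y where Y: "\<And>i k. i \<in> I \<Longrightarrow> k \<in> I - {i} \<Longrightarrow> mv n A (Y i) k = 0"
      "\<And>i. i \<in> I \<Longrightarrow> mv n A (Y i) i \<noteq> 0" by metis
    \<comment> \<open>\<open>None\<close> stands for the vector \<open>x\<close> of the common
      kernel, \<open>Some i\<close> for the dual vector of row \<open>i\<close>.\<close>
    define y where "y o' = (case o' of None \<Rightarrow> x | Some i \<Rightarrow> Y i)" for o'
    define J where "J = insert None (Some ` I)"
    have J: "finite J" "card J = Suc (card I)"
      using finI by (auto simp: J_def card_insert_if card_image)
    obtain c where c: "\<exists>k\<in>J. c k \<noteq> 0" "\<forall>j\<in>{..<n}. (\<Sum>k\<in>J. y k j * c k) = 0"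
      using homogeneous_system[of "{..<n}" J "\<lambda>j k. y k j"] J ge by auto
    have z: "(\<Sum>k\<in>J. c k * mv n A (y k) i) = 0" for i
    proof -
      have "(\<Sum>k\<in>J. c k * mv n A (y k) i) = mv n A (\<lambda>j. \<Sum>k\<in>J. c k * y k j) i" by (simp add: mv_sum)
      also have "\<dots> = mv n A (\<lambda>j. 0) i" using c(2) by (intro mv_cong) (auto simp: mult_ac)
      finally show ?thesis by (simp add: mv_def)
    qed
    \<comment> \<open>Applying row \<open>i\<close> to the dependence kills every term but that of
      \<open>Y i\<close>. Once these coefficients vanish, the dependence reduces to a multiple of
      \<open>x\<close>.\<close>
    have ci: "c (Some i) = 0" if i: "i \<in> I" for i
    proof -
      have "0 = (\<Sum>k\<in>J. c k * mv n A (y k) i)" using z by simp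
      also have "\<dots> = (\<Sum>k\<in>{Some i}. c k * mv n A (y k) i)"
      proof (rule sum.mono_neutral_right)
        show "\<forall>k\<in>J - {Some i}. c k * mv n A (y k) i = 0"
        proof
          fix k assume k: "k \<in> J - {Some i}"
          show "c k * mv n A (y k) i = 0"
          proof (cases k)
            case None
            have "i \<in> Z" using i I by (auto simp: Q_def)
            then show ?thesis using None assms(3) by (auto simp: y_def)
          next
            case (Some l)
            then have "l \<in> I" "i \<in> I - {l}" using k i by (auto simp: J_def)
            then show ?thesis using Some Y(1)[of l i] by (auto simp: y_def)
          qed
        qed
      qed (use J i in \<open>auto simp: J_def\<close>)
      finally show ?thesis using Y(2)[OF i] by (simp add: y_def)
    qed
    have "x j * c None = 0" if "j < n" for j
    proof -
      have "(\<Sum>k\<in>J. y k j * c k) = (\<Sum>k\<in>{None}. y k j * c k)"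
        using J ci by (intro sum.mono_neutral_right) (auto simp: J_def)
      then show ?thesis using c(2) that by (auto simp: y_def)
    qed
    moreover have "c None \<noteq> 0" using c(1) ci by (auto simp: J_def)
    ultimately have "\<forall>j<n. x j = 0" by auto
    then show False using assms(2) by (simp add: sph_def)
  qed
  then show ?thesis using I by (auto simp: Q_def)
qed

text \<open>Until some nonzero coordinate of \<open>u + s * v\<close> first reaches zero the signs
  are constant, so the sum of absolute values is affine in \<open>s\<close> there; the last
  hypothesis says that its slope is not positive. The second hypothesis keeps the vanishing
  coordinates at zero.\<close>

lemma sliding:
  fixes u v :: "nat \<Rightarrow> real"
  assumes "finite R" "\<And>i. i \<in> R \<Longrightarrow> u i = 0 \<Longrightarrow> v i = 0" "k \<in> R" "v k \<noteq> 0"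
    and "(\<Sum>i\<in>R. sgn (u i) * v i) \<le> 0"
  shows "\<exists>s. (\<Sum>i\<in>R. \<bar>u i + s * v i\<bar>) \<le> (\<Sum>i\<in>R. \<bar>u i\<bar>) \<and> (\<exists>i\<in>R. u i \<noteq> 0 \<and> u i + s * v i = 0)"
proof -
  define S where "S = {- u i / v i | i. i \<in> R \<and> u i * v i < 0}"
  have "finite S" using assms(1) by (auto simp: S_def)
  \<comment> \<open>Without a crossing time no coordinate would move towards zero, and the slope
    would be the positive sum of the \<open>\<bar>v i\<bar>\<close>.\<close>
  have "S \<noteq> {}"
  proof
    assume "S = {}"
    then have "u i * v i \<ge> 0" if "i \<in> R" for i using that by (force simp: S_def)
    then have "sgn (u i) * v i = \<bar>v i\<bar>" if "i \<in> R" for i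
      using that assms(2)[OF that] zero_le_mult_iff[of "u i" "v i"] by (cases "u i > 0"; cases "u i = 0") auto
    then have "(\<Sum>i\<in>R. \<bar>v i\<bar>) \<le> 0" using assms(5) by simp
    moreover have "(\<Sum>i\<in>R. \<bar>v i\<bar>) > 0"
      using assms by (intro sum_pos2[of _ k]) auto
    ultimately show False by simp
  qed
  define s where "s = Min S"
  have "s \<in> S" using \<open>finite S\<close> \<open>S \<noteq> {}\<close> by (simp add: s_def)
  then obtain l where l: "l \<in> R" "u l * v l < 0" "s = - u l / v l" by (auto simp: S_def)
  have "s > 0" using l by (auto simp: mult_less_0_iff field_simps)
  have le: "\<bar>u i + s * v i\<bar> = \<bar>u i\<bar> + s * (sgn (u i) * v i)" if i: "i \<in> R" for i
  proof (cases "u i * v i < 0")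
    case True
    then have "s \<le> - u i / v i" using i \<open>finite S\<close> unfolding s_def by (intro Min_le) (auto simp: S_def)
    then show ?thesis using True by (auto simp: mult_less_0_iff field_simps sgn_if)
  next
    case False
    then have "u i * v i \<ge> 0" by simp
    consider "u i = 0" | "u i > 0" "v i \<ge> 0" | "u i < 0" "v i \<le> 0"
      using \<open>u i * v i \<ge> 0\<close> by (metis linorder_cases linorder_not_le mult_neg_pos mult_pos_neg)
    then show ?thesis
    proof cases
      case 1
      then show ?thesis using assms(2)[OF i] by simp
    next
      case 2
      then have "0 \<le> s * v i" using \<open>s > 0\<close> by simp
      then show ?thesis using 2 by simp
    next
      case 3
      then have "s * v i \<le> 0" using \<open>s > 0\<close> by (simp add: mult_nonneg_nonpos)
      then show ?thesis using 3 by simp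
    qed
  qed
  have "(\<Sum>i\<in>R. \<bar>u i + s * v i\<bar>) = (\<Sum>i\<in>R. \<bar>u i\<bar>) + s * (\<Sum>i\<in>R. sgn (u i) * v i)"
    using le by (simp add: sum.distrib sum_distrib_left)
  also have "\<dots> \<le> (\<Sum>i\<in>R. \<bar>u i\<bar>)" using assms(5) \<open>s > 0\<close> by (simp add: mult_nonneg_nonpos)
  finally have "(\<Sum>i\<in>R. \<bar>u i + s * v i\<bar>) \<le> (\<Sum>i\<in>R. \<bar>u i\<bar>)" .
  moreover have "u l \<noteq> 0 \<and> u l + s * v l = 0" using l by auto
  ultimately show ?thesis using l(1) by blast
qed

text \<open>A unit vector with small \<open>l1\<close> image and the largest number of vanishing coordinates has, on
  the kernel of the corresponding rows, the largest image up to sign: otherwise one can move inside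
  that kernel, orthogonally to the vector, without increasing the (locally affine) \<open>l1\<close> norm,
  until one more coordinate vanishes.\<close>

lemma extremal_rows:
  assumes "1 \<le> n" "n \<le> Suc N" "sph n x0" "l1 {..<N} n A x0 < \<tau>"
  shows "\<exists>I\<subseteq>{..<N}. card I = n - 1 \<and>
    (\<forall>y. sph n y \<longrightarrow> (\<forall>i\<in>I. mv n A y i = 0) \<longrightarrow> l1 {..<N} n A y < \<tau>)"
proof -
  define Z where "Z x = {i. i < N \<and> mv n A x i = 0}" for x
  define P where "P x \<longleftrightarrow> sph n x \<and> l1 {..<N} n A x < \<tau>" for x
  have "P x0" using assms by (simp add: P_def)
  moreover have "card (Z x) < Suc N" for x
  proof -
    have "card (Z x) \<le> card {..<N}" by (intro card_mono) (auto simp: Z_def)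
    then show ?thesis by simp
  qed
  \<comment> \<open>Extremality is imposed on the number of vanishing coordinates, which is bounded
    by \<open>N\<close>, so a maximiser exists without compactness.\<close>
  ultimately obtain x where x: "P x" "\<And>y. P y \<Longrightarrow> card (Z y) \<le> card (Z x)"
    using ex_has_greatest_nat[of P x0 "\<lambda>x. card (Z x)" "Suc N"] by auto
  have sx: "sph n x" and lx: "l1 {..<N} n A x < \<tau>" using x by (auto simp: P_def)
  have finZ: "finite (Z y)" for y by (auto simp: Z_def)
  have noneg: False if ort: "(\<Sum>j<n. x j * z j) = 0" and ker: "\<forall>i\<in>Z x. mv n A z i = 0"
    and k: "k < N" "mv n A z k \<noteq> 0" and neg: "(\<Sum>i<N. sgn (mv n A x i) * mv n A z i) \<le> 0" for z k
  proof -
    obtain s i where s: "(\<Sum>i<N. \<bar>mv n A x i + s * mv n A z i\<bar>) \<le> (\<Sum>i<N. \<bar>mv n A x i\<bar>)"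
      "i < N" "mv n A x i \<noteq> 0" "mv n A x i + s * mv n A z i = 0"
      using sliding[of "{..<N}" "mv n A x" "mv n A z" k] ker k neg by (auto simp: Z_def)
    define w where "w j = x j + s * z j" for j
    have mw: "mv n A w i = mv n A x i + s * mv n A z i" for i
      unfolding w_def by (simp add: mv_add mv_scale)
    \<comment> \<open>Orthogonality makes the norm of \<open>w\<close> at least 1, so normalising
      can only decrease the l1 norm of the image.\<close>
    have nw: "(\<Sum>j<n. (w j)\<^sup>2) = 1 + s\<^sup>2 * (\<Sum>j<n. (z j)\<^sup>2)"
    proof -
      have "(\<Sum>j<n. (w j)\<^sup>2) = (\<Sum>j<n. (x j)\<^sup>2) + 2 * s * (\<Sum>j<n. x j * z j) + s\<^sup>2 * (\<Sum>j<n. (z j)\<^sup>2)"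
        by (simp add: w_def power2_eq_square algebra_simps sum.distrib sum_distrib_left)
      then show ?thesis using sx ort by (simp add: sph_def)
    qed
    define r where "r = L2_set w {..<n}"
    have r: "r \<ge> 1" using nw by (simp add: r_def L2_set_def sum_nonneg)
    have "\<exists>j<n. w j \<noteq> 0"
    proof (rule ccontr)
      assume "\<not> ?thesis"
      then have "(\<Sum>j<n. (w j)\<^sup>2) = 0" by simp
      then show False using nw sum_nonneg[of "{..<n}" "\<lambda>j. (z j)\<^sup>2"]
        by (smt (verit) mult_nonneg_nonneg zero_le_power2)
    qed
    define x' where "x' j = inverse r * w j" for j
    have "sph n x'" using sph_normalize(2)[OF \<open>\<exists>j<n. w j \<noteq> 0\<close>] unfolding x'_def r_def .
    moreover have "l1 {..<N} n A x' \<le> l1 {..<N} n A x"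
    proof -
      have "l1 {..<N} n A x' = inverse r * l1 {..<N} n A w" using r unfolding x'_def by (simp add: l1_scale)
      also have "\<dots> \<le> 1 * l1 {..<N} n A w" using r l1_nonneg by (intro mult_right_mono) (auto simp: field_simps)
      also have "\<dots> \<le> l1 {..<N} n A x" using s(1) by (simp add: l1_def mw)
      finally show ?thesis .
    qed
    ultimately have "P x'" using lx by (auto simp: P_def)
    have "insert i (Z x) \<subseteq> Z x'"
      using s ker unfolding x'_def by (auto simp: Z_def mv_scale mw)
    then have "card (insert i (Z x)) \<le> card (Z x')" using finZ by (intro card_mono)
    moreover have "i \<notin> Z x" using s by (auto simp: Z_def)
    ultimately show False using x(2)[OF \<open>P x'\<close>] finZ[of x] by simp
  qed
  have zero: "mv n A z k = 0" if ort: "(\<Sum>j<n. x j * z j) = 0" and ker: "\<forall>i\<in>Z x. mv n A z i = 0"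
    and k: "k < N" for z k
  proof (rule ccontr)
    assume nz: "mv n A z k \<noteq> 0"
    define z' where "z' j = -1 * z j" for j
    have m: "mv n A z' i = - mv n A z i" for i unfolding z'_def by (subst mv_scale) simp
    show False
    proof (cases "(\<Sum>i<N. sgn (mv n A x i) * mv n A z i) \<le> 0")
      case True
      then show False using noneg[OF ort ker k nz] by simp
    next
      case False
      have "(\<Sum>j<n. x j * z' j) = 0" using ort by (simp add: z'_def sum_negf)
      then show False using noneg[of z' k] False ker k nz by (simp add: m sum_negf)
    qed
  qed
  have small: "l1 {..<N} n A y < \<tau>" if y: "sph n y" "\<forall>i\<in>Z x. mv n A y i = 0" for y
  proof -
    \<comment> \<open>\<open>c\<close> is the component of \<open>y\<close> along \<open>x\<close>.
      The rest \<open>z\<close> is orthogonal to \<open>x\<close> and killed by the rows in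
      \<open>Z x\<close>, hence by all rows; so the image of \<open>y\<close> is \<open>c\<close>
      times that of \<open>x\<close>, with \<open>\<bar>c\<bar> \<le> 1\<close>.\<close>
    define c where "c = (\<Sum>j<n. x j * y j)"
    define z where "z j = y j - c * x j" for j
    have s1: "(\<Sum>j<n. (x j)\<^sup>2) = 1" "(\<Sum>j<n. (y j)\<^sup>2) = 1" using sx y by (auto simp: sph_def)
    have "(\<Sum>j<n. x j * z j) = (\<Sum>j<n. x j * y j - c * (x j)\<^sup>2)"
      by (simp add: z_def power2_eq_square algebra_simps)
    also have "\<dots> = c - c * (\<Sum>j<n. (x j)\<^sup>2)"
      by (simp only: sum_subtractf sum_distrib_left[symmetric] c_def[symmetric])
    finally have "(\<Sum>j<n. x j * z j) = c - c * (\<Sum>j<n. (x j)\<^sup>2)" .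
    then have o: "(\<Sum>j<n. x j * z j) = 0" using s1 by simp
    have mz: "mv n A z i = mv n A y i - c * mv n A x i" for i
      unfolding z_def by (simp add: mv_diff mv_scale)
    have "mv n A z k = 0" if "k < N" for k
      using zero[OF o _ that] y by (auto simp: mz Z_def)
    then have "mv n A y k = c * mv n A x k" if "k < N" for k using that by (simp add: mz)
    then have "l1 {..<N} n A y = \<bar>c\<bar> * l1 {..<N} n A x"
      by (simp add: l1_def abs_mult sum_distrib_left)
    moreover have "\<bar>c\<bar> \<le> 1"
    proof -
      have "0 \<le> (\<Sum>j<n. (z j)\<^sup>2)" by (simp add: sum_nonneg)
      also have "(\<Sum>j<n. (z j)\<^sup>2) = (\<Sum>j<n. (y j)\<^sup>2) - 2 * c * (\<Sum>j<n. x j * y j) + c\<^sup>2 * (\<Sum>j<n. (x j)\<^sup>2)"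
        by (simp add: z_def power2_eq_square algebra_simps sum.distrib sum_subtractf sum_distrib_left)
      also have "\<dots> = 1 - c\<^sup>2" using s1 by (simp add: c_def[symmetric] power2_eq_square)
      finally show ?thesis by (simp add: abs_square_le_1)
    qed
    ultimately show ?thesis
      using lx mult_left_le_one_le[OF l1_nonneg[of "{..<N}" n A x], of "\<bar>c\<bar>"] by simp
  qed
  obtain I where I: "I \<subseteq> Z x" "card I < n" "\<And>y. (\<forall>i\<in>I. mv n A y i = 0) \<Longrightarrow> (\<forall>i\<in>Z x. mv n A y i = 0)"
  proof -
    have ex: "\<exists>I\<subseteq>Z x. card I < n \<and> (\<forall>y. (\<forall>i\<in>I. mv n A y i = 0) \<longrightarrow> (\<forall>i\<in>Z x. mv n A y i = 0))"
      by (rule row_basis[OF finZ sx]) (auto simp: Z_def)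
    show ?thesis
      using ex by (elim exE conjE) (rule that, blast+)
  qed
  \<comment> \<open>The basis may have fewer than \<open>n - 1\<close> rows. Adding rows only
    shrinks the kernel, and the fixed size lets the union bound count with one binomial
    coefficient.\<close>
  obtain I' where I': "I \<subseteq> I'" "I' \<subseteq> {..<N}" "card I' = n - 1"
  proof -
    have "\<exists>B. I \<subseteq> B \<and> B \<subseteq> {..<N} \<and> card B = n - 1"
      using I assms by (intro exists_subset_between) (auto simp: Z_def)
    then show ?thesis using that by auto
  qed
  show ?thesis using I' I(3) small by (intro exI[of _ I'] conjI allI impI; (assumption | rule small | (metis subsetD)))
qed

section \<open>Gaussian smoothing of characteristic functions\<close>

lemma sin_ge_third:
  fixes x :: real
  assumes "0 \<le> x" "x \<le> 2"
  shows "x / 3 \<le> sin x"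
proof -
  have cos_ge: "1 - y\<^sup>2 / 2 \<le> cos y" for y :: real
  proof -
    have "\<bar>sin (y / 2)\<bar> \<le> \<bar>y / 2\<bar>" by (rule abs_sin_x_le_abs_x)
    then have "(sin (y / 2))\<^sup>2 \<le> (y / 2)\<^sup>2" by (simp only: abs_le_square_iff)
    then show ?thesis using cos_double_sin[of "y / 2"] by (simp add: power2_eq_square)
  qed
  have "(\<lambda>y. sin y - y + y ^ 3 / 6) 0 \<le> (\<lambda>y. sin y - y + y ^ 3 / 6) x"
  proof (rule DERIV_nonneg_imp_nondecreasing[of 0 x])
    show "0 \<le> x" by fact
    fix y :: real
    have "((\<lambda>y. sin y - y + y ^ 3 / 6) has_real_derivative cos y - 1 + y\<^sup>2 / 2) (at y)"
      by (auto intro!: derivative_eq_intros)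
    then show "\<exists>d. ((\<lambda>y. sin y - y + y ^ 3 / 6) has_real_derivative d) (at y) \<and> 0 \<le> d"
      using cos_ge[of y] by (intro exI[of _ "cos y - 1 + y\<^sup>2 / 2"]) auto
  qed
  then have "x - x ^ 3 / 6 \<le> sin x" by simp
  moreover have "x ^ 3 \<le> 4 * x"
  proof -
    have "x * x \<le> 2 * 2" using assms by (intro mult_mono) auto
    then have "x * (x * x) \<le> x * 4" using assms by (intro mult_left_mono) auto
    then show ?thesis by (simp add: power3_eq_cube)
  qed
  ultimately show ?thesis by simp
qed

lemma one_minus_cos_ge:
  fixes w :: real
  assumes "\<bar>w\<bar> \<le> pi"
  shows "w\<^sup>2 / 18 \<le> 1 - cos w"
proof -
  have "\<bar>w\<bar> / 2 / 3 \<le> sin (\<bar>w\<bar> / 2)"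
    using assms pi_half_less_two by (intro sin_ge_third) auto
  then have "(\<bar>w\<bar> / 6)\<^sup>2 \<le> (sin (\<bar>w\<bar> / 2))\<^sup>2"
    by (intro power_mono) auto
  moreover have "cos w = 1 - 2 * (sin (\<bar>w\<bar> / 2))\<^sup>2"
    using cos_double_sin[of "\<bar>w\<bar> / 2"] by simp
  ultimately show ?thesis by (simp add: power2_eq_square)
qed

text \<open>Turns cosine integrals into distances to the integers: after removing the period the
  angle lies in [-pi, pi], and \<open>pi \<ge> 3\<close> leaves room in the constant.\<close>

lemma one_minus_cos_ge_round:
  fixes v :: real
  shows "(v - of_int (round v))\<^sup>2 / 2 \<le> 1 - cos (2 * pi * v)"
proof -
  define r where "r = v - of_int (round v)"
  have "\<bar>r\<bar> \<le> 1 / 2" using of_int_round_abs_le[of v] by (simp add: r_def abs_minus_commute)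
  then have "\<bar>2 * pi * r\<bar> \<le> pi" by (simp add: abs_mult)
  then have "(2 * pi * r)\<^sup>2 / 18 \<le> 1 - cos (2 * pi * r)" by (rule one_minus_cos_ge)
  moreover have "cos (2 * pi * v) = cos (2 * pi * r)"
    using cos_int_2pin cos_diff[of "2 * pi * v" "2 * pi * of_int (round v)"] sin_int_2pin
    by (simp add: r_def right_diff_distrib)
  moreover have "r\<^sup>2 / 2 \<le> (2 * pi * r)\<^sup>2 / 18"
  proof -
    have "3 * 3 \<le> pi * pi" using pi_gt3 by (intro mult_mono) auto
    then have "9 * r\<^sup>2 \<le> pi\<^sup>2 * r\<^sup>2" by (intro mult_right_mono) (auto simp: power2_eq_square)
    then have "9 * r\<^sup>2 \<le> 4 * (pi\<^sup>2 * r\<^sup>2)" using zero_le_power2[of r] by linarith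
    then show ?thesis by (simp add: power_mult_distrib mult.commute)
  qed
  ultimately show ?thesis by (simp add: r_def)
qed

section \<open>Symmetrised entries and characteristic functions of sums\<close>

locale real_law = prob_space M for M :: "real measure" +
  assumes sets_M [measurable_cong]: "sets M = sets borel"
begin

lemma space_M [simp]: "space M = UNIV"
  using sets_eq_imp_space_eq[OF sets_M] by simp

abbreviation P :: "'k set \<Rightarrow> ('k \<Rightarrow> real) measure" where
  "P K \<equiv> PiM K (\<lambda>_. M)"

abbreviation PR :: "nat set \<Rightarrow> nat \<Rightarrow> (nat \<times> nat \<Rightarrow> real) measure" where
  "PR R n \<equiv> P (R \<times> {..<n})"

lemma prob_space_P: "prob_space (P K)"
  by (intro prob_space_PiM) (rule prob_space_axioms)

lemma product_P: "product_prob_space (\<lambda>_. M)"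
  by unfold_locales

text \<open>Symmetrising makes the squared modulus of the characteristic function of
  \<open>M\<close> a real cosine integral.\<close>

definition sym :: "real measure" where
  "sym = distr (M \<Otimes>\<^sub>M M) borel (\<lambda>(x, y). x - y)"

lemma sets_sym [measurable_cong]: "sets sym = sets borel"
  by (simp add: sym_def)

lemma space_sym [simp]: "space sym = UNIV"
  by (simp add: sym_def)

lemma pair_M: "pair_prob_space M M"
  by unfold_locales

lemma prob_space_sym: "prob_space sym"
proof -
  interpret p: pair_prob_space M M by (rule pair_M)
  show ?thesis unfolding sym_def by (rule p.prob_space_distr) measurable
qed

lemma integrable_bounded:
  fixes f :: "'b \<Rightarrow> 'c::{banach, second_countable_topology}"
  assumes "prob_space Q" "f \<in> borel_measurable Q" "\<And>x. norm (f x) \<le> B"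
  shows "integrable Q f"
proof -
  interpret Q: prob_space Q by fact
  show ?thesis using assms(2,3) by (intro Q.integrable_const_bound[of _ B]) auto
qed

lemma cmod_char_square: "(cmod (\<integral>x. iexp (u * x) \<partial>M))\<^sup>2 = (\<integral>z. cos (u * z) \<partial>sym)"
proof -
  interpret p: pair_prob_space M M by (rule pair_M)
  have i: "integrable M (\<lambda>x. cos (u * x))" "integrable M (\<lambda>x. sin (u * x))"
    by (auto intro!: integrable_bounded[OF prob_space_axioms, of _ 1])
  have ie: "integrable M (\<lambda>x. iexp (u * x))"
    by (rule integrable_bounded[OF prob_space_axioms, of _ 1]) auto
  have re: "Re (\<integral>x. iexp (u * x) \<partial>M) = (\<integral>x. cos (u * x) \<partial>M)"
    by (subst integral_Re[symmetric, OF ie]) (simp add: Re_exp)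
  have im: "Im (\<integral>x. iexp (u * x) \<partial>M) = (\<integral>x. sin (u * x) \<partial>M)"
    by (subst integral_Im[symmetric, OF ie]) (simp add: Im_exp)
  have "(\<integral>z. cos (u * z) \<partial>sym) = (\<integral>xy. cos (u * (fst xy - snd xy)) \<partial>(M \<Otimes>\<^sub>M M))"
    unfolding sym_def by (subst integral_distr) (auto simp: case_prod_beta)
  also have "\<dots> = (\<integral>x. (\<integral>y. cos (u * (x - y)) \<partial>M) \<partial>M)"
    using integrable_bounded[OF p.prob_space_axioms, of "\<lambda>xy. cos (u * (fst xy - snd xy))" 1]
    by (subst p.integral_fst'[symmetric]) auto
  also have "\<dots> = (\<integral>x. cos (u * x) * (\<integral>y. cos (u * y) \<partial>M) + sin (u * x) * (\<integral>y. sin (u * y) \<partial>M) \<partial>M)"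
    using i by (simp add: right_diff_distrib cos_diff)
  also have "\<dots> = (\<integral>y. cos (u * y) \<partial>M)\<^sup>2 + (\<integral>y. sin (u * y) \<partial>M)\<^sup>2"
    using i by (simp add: power2_eq_square)
  finally show ?thesis unfolding cmod_power2 re im by simp
qed

lemma cmod_char_le: "cmod (\<integral>x. iexp (u * x) \<partial>M) \<le> exp (- (\<integral>z. 1 - cos (u * z) \<partial>sym) / 2)"
proof -
  interpret s: prob_space sym by (rule prob_space_sym)
  define H where "H = (\<integral>z. 1 - cos (u * z) \<partial>sym)"
  have "integrable sym (\<lambda>z. cos (u * z))"
    by (rule integrable_bounded[OF prob_space_sym, of _ 1]) auto
  then have "(cmod (\<integral>x. iexp (u * x) \<partial>M))\<^sup>2 = 1 - H"
    unfolding cmod_char_square H_def by (simp add: s.prob_space[simplified])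
  also have "\<dots> \<le> exp (- H)" using exp_ge_add_one_self[of "- H"] by simp
  also have "\<dots> = (exp (- H / 2))\<^sup>2" by (simp add: power2_eq_square mult_exp_exp)
  finally show ?thesis unfolding H_def by (rule power2_le_imp_le) simp
qed

text \<open>Independence factorises the characteristic function. The exponents then add up under a
  single integral over \<open>sym\<close>, which leaves one variable \<open>z\<close> common to all
  coordinates.\<close>

lemma integral_cos_le:
  assumes K: "finite K"
  shows "(\<integral>a. cos (\<theta> * (\<Sum>k\<in>K. a k * w k)) \<partial>P K) \<le> exp (- (\<integral>z. (\<Sum>k\<in>K. 1 - cos (\<theta> * w k * z)) \<partial>sym) / 2)"
proof -
  interpret pp: product_prob_space "\<lambda>_. M" K by (rule product_P)
  have ie: "integrable M (\<lambda>x. iexp (c * x))" for c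
    by (rule integrable_bounded[OF prob_space_axioms, of _ 1]) auto
  have iP: "integrable (P K) (\<lambda>a. iexp (\<theta> * (\<Sum>k\<in>K. a k * w k)))"
    by (rule integrable_bounded[OF prob_space_P, where B=1]) auto
  have iexp_eq: "iexp (\<theta> * (\<Sum>k\<in>K. a k * w k)) = (\<Prod>k\<in>K. iexp (\<theta> * w k * a k))" for a
    by (subst exp_sum[symmetric, OF K]) (simp add: sum_distrib_left mult_ac)
  have "(\<integral>a. cos (\<theta> * (\<Sum>k\<in>K. a k * w k)) \<partial>P K) = Re (\<integral>a. iexp (\<theta> * (\<Sum>k\<in>K. a k * w k)) \<partial>P K)"
    by (subst integral_Re[symmetric, OF iP]) (simp add: Re_exp)
  also have "\<dots> \<le> cmod (\<integral>a. iexp (\<theta> * (\<Sum>k\<in>K. a k * w k)) \<partial>P K)" by (rule complex_Re_le_cmod)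
  also have "(\<integral>a. iexp (\<theta> * (\<Sum>k\<in>K. a k * w k)) \<partial>P K) = (\<Prod>k\<in>K. \<integral>x. iexp (\<theta> * w k * x) \<partial>M)"
    unfolding iexp_eq by (rule pp.product_integral_prod[OF K ie])
  also have "cmod \<dots> \<le> (\<Prod>k\<in>K. exp (- (\<integral>z. 1 - cos (\<theta> * w k * z) \<partial>sym) / 2))"
    unfolding prod_norm[symmetric] by (intro prod_mono conjI norm_ge_zero cmod_char_le)
  also have "\<dots> = exp (- (\<Sum>k\<in>K. \<integral>z. 1 - cos (\<theta> * w k * z) \<partial>sym) / 2)"
    by (subst exp_sum[symmetric, OF K]) (simp add: sum_negf sum_divide_distrib)
  also have "(\<Sum>k\<in>K. \<integral>z. 1 - cos (\<theta> * w k * z) \<partial>sym) = (\<integral>z. (\<Sum>k\<in>K. 1 - cos (\<theta> * w k * z)) \<partial>sym)"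
  proof (intro Bochner_Integration.integral_sum[symmetric] integrable_bounded[OF prob_space_sym, where B=2])
    show "norm (1 - cos y) \<le> 2" for y :: real
      using cos_ge_minus_one[of y] cos_le_one[of y] by simp
  qed measurable
  finally show ?thesis .
qed

text \<open>Jensen's inequality for \<open>sym\<close> conditioned on \<open>S\<close>. Restricting
  the integral in the exponent to \<open>S\<close> costs the factor \<open>p\<close>, which
  therefore appears in the new exponent and as the normalisation.\<close>

lemma exp_integral_le:
  assumes q: "q \<in> borel_measurable borel" "\<And>z. 0 \<le> q z" "\<And>z. q z \<le> c"
    and S: "S \<in> sets borel" and p: "p = measure sym S" "0 < p"
  shows "exp (- (\<integral>z. q z \<partial>sym) / 2) \<le> (\<integral>z. indicator S z * exp (- (p / 2) * q z) \<partial>sym) / p"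
proof -
  interpret s: prob_space sym by (rule prob_space_sym)
  have [measurable]: "S \<in> sets borel" "q \<in> borel_measurable borel" by fact+
  have c: "c \<ge> 0" using q(2,3)[of 0] by simp
  define I where "I = (\<integral>z. indicator S z * q z \<partial>sym)"
  define m where "m = I / p"
  have int1: "integrable sym q"
    by (rule integrable_bounded[OF prob_space_sym, of _ c]) (use q in auto)
  have int2: "integrable sym (\<lambda>z. indicator S z * q z)"
    by (rule integrable_bounded[OF prob_space_sym, of _ c]) (use q c in \<open>auto simp: indicator_def\<close>)
  have int3: "integrable sym (\<lambda>z. indicator S z * exp (- (p / 2) * q z))"
    by (rule integrable_bounded[OF prob_space_sym, of _ 1]) (use q p in \<open>auto simp: indicator_def\<close>)
  have int4: "integrable sym (indicator S :: real \<Rightarrow> real)"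
    by (rule integrable_bounded[OF prob_space_sym, of _ 1]) (auto simp: indicator_def)
  have "I \<le> (\<integral>z. q z \<partial>sym)"
    unfolding I_def using int1 int2 by (intro integral_mono) (auto simp: indicator_def q)
  then have "exp (- (\<integral>z. q z \<partial>sym) / 2) \<le> exp (- (p / 2) * m)"
    using p by (simp add: m_def)
  \<comment> \<open>The integrand is the tangent of the exponential at the conditional mean
    \<open>m\<close>; its integral over \<open>S\<close> is exactly
    \<open>p * exp (- (p / 2) * m)\<close>.\<close>
  also have "\<dots> = (\<integral>z. exp (- (p / 2) * m) * (1 + (p / 2) * m) * indicator S z
                     - exp (- (p / 2) * m) * (p / 2) * (indicator S z * q z) \<partial>sym) / p"
    using int2 int4 p by (simp add: I_def[symmetric]) (simp add: m_def field_simps)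
  also have "\<dots> \<le> (\<integral>z. indicator S z * exp (- (p / 2) * q z) \<partial>sym) / p"
  proof (intro divide_right_mono integral_mono)
    fix z
    have "exp (- (p / 2) * m) * (1 + (p / 2 * m - p / 2 * q z)) \<le> exp (- (p / 2) * m) * exp (p / 2 * m - p / 2 * q z)"
      by (intro mult_left_mono exp_ge_add_one_self) auto
    also have "\<dots> = exp (- (p / 2) * q z)" by (simp add: mult_exp_exp)
    finally show "exp (- (p / 2) * m) * (1 + p / 2 * m) * indicator S z
        - exp (- (p / 2) * m) * (p / 2) * (indicator S z * q z) \<le> indicator S z * exp (- (p / 2) * q z)"
      by (auto simp: indicator_def algebra_simps)
  qed (use int2 int3 int4 p in auto)
  finally show ?thesis .
qed

section \<open>Gaussian smoothing\<close>

abbreviation gauss :: "real measure" where "gauss \<equiv> std_normal_distribution"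

lemma prob_space_gauss: "prob_space gauss"
  by (rule prob_space_normal_density) simp

lemma integral_cos_gauss: "(\<integral>g. cos (g * y) \<partial>gauss) = exp (- y\<^sup>2 / 2)"
proof -
  have ie: "integrable gauss (\<lambda>g. iexp (y * g))"
    by (rule integrable_bounded[OF prob_space_gauss, of _ 1]) auto
  have "(\<integral>g. iexp (y * g) \<partial>gauss) = complex_of_real (exp (- y\<^sup>2 / 2))"
    using char_std_normal_distribution by (simp add: char_def fun_eq_iff)
  then have "Re (\<integral>g. iexp (y * g) \<partial>gauss) = exp (- y\<^sup>2 / 2)" by simp
  then show ?thesis
    by (subst (asm) integral_Re[symmetric, OF ie]) (simp add: Re_exp mult.commute)
qed

text \<open>Plays the role of Esseen's inequality. The Gaussian weight is the average of
  \<open>cos (g * y / t)\<close> over a Gaussian \<open>g\<close>, so for each \<open>g\<close> a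
  cosine integral over the entries is left. After \<open>exp_integral_le\<close> and a second
  exchange of integrals only the worst \<open>z\<close> between \<open>b\<close> and
  \<open>B\<close> matters; negative \<open>z\<close> reduce to positive ones since cosine is
  even.\<close>

lemma smoothing:
  assumes K: "finite K" and t: "t > 0" and p: "p = measure sym {z. b \<le> \<bar>z\<bar> \<and> \<bar>z\<bar> \<le> B}" "0 < p"
    and q: "\<And>z. b \<le> z \<Longrightarrow> z \<le> B \<Longrightarrow>
      (\<integral>g. exp (- (p / 2) * (\<Sum>k\<in>K. 1 - cos (g * w k * z / t))) \<partial>gauss) \<le> q"
  shows "(\<integral>a. exp (- (\<Sum>k\<in>K. a k * w k)\<^sup>2 / (2 * t\<^sup>2)) \<partial>P K) \<le> q"
proof -
  define S where "S = {z :: real. b \<le> \<bar>z\<bar> \<and> \<bar>z\<bar> \<le> B}"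
  have S[measurable]: "S \<in> sets borel" by (auto simp: S_def)
  define F where "F g z = (\<Sum>k\<in>K. 1 - cos (g * w k * z / t))" for g z
  have F0: "0 \<le> F g z" for g z unfolding F_def by (intro sum_nonneg) simp
  have F2: "F g z \<le> 2 * card K" for g z
  proof -
    have "F g z \<le> (\<Sum>k\<in>K. 2)" unfolding F_def
      by (intro sum_mono) (smt (verit) cos_ge_minus_one)
    then show ?thesis by simp
  qed
  have F_m[measurable]: "F g \<in> borel_measurable borel" for g unfolding F_def by measurable
  have F_m2[measurable]: "(\<lambda>(g, z). F g z) \<in> borel_measurable (borel \<Otimes>\<^sub>M borel)"
    unfolding F_def by measurable
  interpret PK: prob_space "P K" by (rule prob_space_P)
  interpret G: prob_space gauss by (rule prob_space_gauss)
  interpret s: prob_space sym by (rule prob_space_sym)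
  interpret PG: pair_prob_space "P K" gauss by unfold_locales
  interpret SG: pair_prob_space sym gauss by unfold_locales
  define E where "E g z = indicator S z * exp (- (p / 2) * F g z)" for g z
  have E_m[measurable]: "(\<lambda>(z, g). E g z) \<in> borel_measurable (sym \<Otimes>\<^sub>M gauss)"
    unfolding E_def F_def by measurable
  have E_b: "\<bar>E g z\<bar> \<le> 1" for g z using F0 p by (auto simp: E_def indicator_def)
  have intE: "integrable (sym \<Otimes>\<^sub>M gauss) (\<lambda>(z, g). E g z)"
    by (rule integrable_bounded[OF SG.prob_space_axioms, of _ 1]) (auto simp: E_b)
  have "(\<integral>a. exp (- (\<Sum>k\<in>K. a k * w k)\<^sup>2 / (2 * t\<^sup>2)) \<partial>P K) =
      (\<integral>a. (\<integral>g. cos (g * ((\<Sum>k\<in>K. a k * w k) / t)) \<partial>gauss) \<partial>P K)"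
    by (subst integral_cos_gauss) (simp add: power_divide mult.commute)
  also have "\<dots> = (\<integral>g. (\<integral>a. cos (g * ((\<Sum>k\<in>K. a k * w k) / t)) \<partial>P K) \<partial>gauss)"
    by (rule PG.Fubini_integral[symmetric], rule integrable_bounded[OF PG.prob_space_axioms, of _ 1]) auto
  also have "\<dots> \<le> (\<integral>g. (\<integral>z. E g z \<partial>sym) / p \<partial>gauss)"
  proof (rule integral_mono)
    show "integrable gauss (\<lambda>g. \<integral>a. cos (g * ((\<Sum>k\<in>K. a k * w k) / t)) \<partial>P K)"
    proof (rule integrable_bounded[OF prob_space_gauss, of _ 1])
      fix g
      have "\<bar>\<integral>a. cos (g * ((\<Sum>k\<in>K. a k * w k) / t)) \<partial>P K\<bar> \<le> (\<integral>a. \<bar>cos (g * ((\<Sum>k\<in>K. a k * w k) / t))\<bar> \<partial>P K)"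
        by (rule integral_abs_bound)
      also have "\<dots> \<le> 1"
        by (intro PK.integral_le_const integrable_bounded[OF prob_space_P, where B=1]) auto
      finally show "norm (\<integral>a. cos (g * ((\<Sum>k\<in>K. a k * w k) / t)) \<partial>P K) \<le> 1" by simp
    qed measurable
    show "integrable gauss (\<lambda>g. (\<integral>z. E g z \<partial>sym) / p)"
      using SG.integrable_snd[OF intE] by simp
    fix g
    have "(\<integral>a. cos (g * ((\<Sum>k\<in>K. a k * w k) / t)) \<partial>P K) = (\<integral>a. cos (g / t * (\<Sum>k\<in>K. a k * w k)) \<partial>P K)" by simp
    also have "\<dots> \<le> exp (- (\<integral>z. F g z \<partial>sym) / 2)"
      using integral_cos_le[OF K, of "g / t" w] by (simp add: F_def)
    also have "\<dots> \<le> (\<integral>z. E g z \<partial>sym) / p" unfolding E_def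
      by (rule exp_integral_le[of _ "2 * card K"]) (use p F0 F2 in \<open>auto simp: S_def\<close>)
    finally show "(\<integral>a. cos (g * ((\<Sum>k\<in>K. a k * w k) / t)) \<partial>P K) \<le> (\<integral>z. E g z \<partial>sym) / p" .
  qed
  also have "\<dots> = (\<integral>z. (\<integral>g. E g z \<partial>gauss) \<partial>sym) / p"
    using SG.Fubini_integral[OF intE] by simp
  also have "(\<integral>z. (\<integral>g. E g z \<partial>gauss) \<partial>sym) \<le> (\<integral>z. q * indicator S z \<partial>sym)"
  proof (rule integral_mono)
    show "integrable sym (\<lambda>z. \<integral>g. E g z \<partial>gauss)" using SG.integrable_fst[OF intE] by simp
    show "integrable sym (\<lambda>z. q * indicator S z)"
      by (rule integrable_bounded[OF prob_space_sym, of _ "\<bar>q\<bar>"]) (auto simp: indicator_def)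
    fix z
    show "(\<integral>g. E g z \<partial>gauss) \<le> q * indicator S z"
    proof (cases "z \<in> S")
      case True
      have "F g \<bar>z\<bar> = F g z" for g
      proof (cases "z \<ge> 0")
        case False
        then have "F g \<bar>z\<bar> = (\<Sum>k\<in>K. 1 - cos (- (g * w k * z / t)))" by (simp add: F_def)
        then show ?thesis unfolding cos_minus F_def .
      qed simp
      then show ?thesis using q[of "\<bar>z\<bar>"] True by (simp add: E_def S_def F_def)
    qed (simp add: E_def)
  qed
  also have "(\<integral>z. q * indicator S z \<partial>sym) = q * p" using p by (simp add: S_def)
  finally show ?thesis using p by (simp add: divide_right_mono)
qed

end

section \<open>Small ball estimates and least common denominators\<close>

lemma integral_exp_square_gauss:
  assumes "0 < 1 + 2 * \<kappa>"
  shows "integrable std_normal_distribution (\<lambda>g. exp (- \<kappa> * g\<^sup>2))"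
    "(\<integral>g. exp (- \<kappa> * g\<^sup>2) \<partial>std_normal_distribution) = 1 / sqrt (1 + 2 * \<kappa>)"
proof -
  define \<sigma> where "\<sigma> = 1 / sqrt (1 + 2 * \<kappa>)"
  have \<sigma>: "\<sigma> > 0" "\<sigma>\<^sup>2 = 1 / (1 + 2 * \<kappa>)" using assms by (auto simp: \<sigma>_def power_divide)
  have eq: "std_normal_density g * exp (- \<kappa> * g\<^sup>2) = \<sigma> * normal_density 0 \<sigma> g" for g
  proof -
    have "exp (- g\<^sup>2 / 2) * exp (- \<kappa> * g\<^sup>2) = exp (- (g - 0)\<^sup>2 / (2 * \<sigma>\<^sup>2))"
      using assms by (simp add: \<sigma> mult_exp_exp field_simps)
    then show ?thesis using \<sigma>(1)
      by (simp add: normal_density_def real_sqrt_mult)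
  qed
  have i: "integrable lborel (\<lambda>g. std_normal_density g * exp (- \<kappa> * g\<^sup>2))"
    unfolding eq using \<sigma> by simp
  then show "integrable std_normal_distribution (\<lambda>g. exp (- \<kappa> * g\<^sup>2))"
    by (subst integrable_density) auto
  show "(\<integral>g. exp (- \<kappa> * g\<^sup>2) \<partial>std_normal_distribution) = 1 / sqrt (1 + 2 * \<kappa>)"
  proof -
    have "(\<integral>g. exp (- \<kappa> * g\<^sup>2) \<partial>std_normal_distribution) = (\<integral>g. std_normal_density g * exp (- \<kappa> * g\<^sup>2) \<partial>lborel)"
      by (subst integral_density) auto
    also have "\<dots> = \<sigma>" unfolding eq using \<sigma> by simp
    finally show ?thesis by (simp add: \<sigma>_def)
  qed
qed

text \<open>Markov's inequality for \<open>exp (g\<^sup>2 / 4)\<close>, whose mean is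
  \<open>sqrt 2\<close>.\<close>

lemma gauss_tail: "measure std_normal_distribution {g. u < \<bar>g\<bar>} \<le> 2 * exp (- u\<^sup>2 / 4)" if "u \<ge> 0"
proof -
  interpret G: prob_space std_normal_distribution by (rule prob_space_normal_density) simp
  have "measure std_normal_distribution {g. u < \<bar>g\<bar>} = (\<integral>g. indicator {g. u < \<bar>g\<bar>} g \<partial>std_normal_distribution)"
    by simp
  also have "\<dots> \<le> (\<integral>g. exp (- u\<^sup>2 / 4) * exp (- (-1 / 4) * g\<^sup>2) \<partial>std_normal_distribution)"
  proof (rule integral_mono)
    show "integrable std_normal_distribution (\<lambda>g. exp (- u\<^sup>2 / 4) * exp (- (-1 / 4) * g\<^sup>2))"
      by (intro integrable_mult_right integral_exp_square_gauss) simp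
    fix g :: real
    have "1 \<le> exp (g\<^sup>2 / 4 - u\<^sup>2 / 4)" if "u < \<bar>g\<bar>"
      using that \<open>u \<ge> 0\<close> abs_le_square_iff[of u g] by simp
    then show "indicator {g. u < \<bar>g\<bar>} g \<le> exp (- u\<^sup>2 / 4) * exp (- (-1 / 4) * g\<^sup>2)"
      by (auto simp: indicator_def mult_exp_exp)
  qed (auto intro!: G.integrable_const_bound[of _ 1])
  also have "\<dots> = exp (- u\<^sup>2 / 4) * sqrt 2"
    using integral_exp_square_gauss(2)[of "-1/4"] by (simp add: real_sqrt_divide)
  also have "\<dots> \<le> exp (- u\<^sup>2 / 4) * 2"
    by (intro mult_left_mono real_le_lsqrt) auto
  finally show ?thesis by (simp add: mult.commute)
qed

lemma term_le_suminf: "f k \<le> (\<Sum>k. f k)" for f :: "nat \<Rightarrow> ennreal"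
  using sum_le_suminf[of f "{k}"] by simp

text \<open>Dominates the Laplace kernel of width \<open>s\<close> by Gaussian kernels of widths
  \<open>Suc k * s\<close> with geometric weights: smoothing estimates Gaussian kernels, whereas
  sums of absolute values factorise through Laplace kernels.\<close>

lemma exp_minus_abs_le_series:
  fixes s y :: real
  assumes s: "s > 0"
  shows "ennreal (exp (- \<bar>y\<bar> / s)) \<le> (\<Sum>k. ennreal (2 * (1 / 2) ^ k * exp (- y\<^sup>2 / (2 * (real (Suc k) * s)\<^sup>2))))"
proof -
  \<comment> \<open>For this \<open>k\<close> the Gaussian of width \<open>Suc k * s\<close> is at
    least \<open>exp (- (1 / 2))\<close> at \<open>y\<close>, and the Laplace kernel is at most
    \<open>exp (- k) \<le> (1 / 2) ^ k\<close>.\<close>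
  define k where "k = nat \<lfloor>\<bar>y\<bar> / s\<rfloor>"
  have k: "real k \<le> \<bar>y\<bar> / s" "\<bar>y\<bar> / s \<le> real (Suc k)"
    using s real_of_int_floor_add_one_ge[of "\<bar>y\<bar> / s"] by (auto simp: k_def add.commute)
  have "exp (- \<bar>y\<bar> / s) \<le> exp (- real k)" using k by simp
  also have "\<dots> = exp (- 1) ^ k" by (simp add: exp_of_nat_mult[symmetric])
  also have "\<dots> \<le> (1 / 2) ^ k"
    using exp_ge_add_one_self[of 1] by (intro power_mono) (auto simp: exp_minus field_simps)
  also have "\<dots> \<le> 2 * (1 / 2) ^ k * exp (- y\<^sup>2 / (2 * (real (Suc k) * s)\<^sup>2))"
  proof -
    have "\<bar>y\<bar> \<le> real (Suc k) * s" using k(2) s by (simp add: field_simps)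
    then have "y\<^sup>2 \<le> (real (Suc k) * s)\<^sup>2" using s by (simp add: abs_le_square_iff[symmetric])
    then have "y\<^sup>2 / (real (Suc k) * s)\<^sup>2 \<le> 1"
      using s by (intro divide_le_eq_1_pos[THEN iffD2]) auto
    then have "- (1 / 2) \<le> - y\<^sup>2 / (2 * (real (Suc k) * s)\<^sup>2)" by simp
    then have "exp (- (1 / 2)) \<le> exp (- y\<^sup>2 / (2 * (real (Suc k) * s)\<^sup>2))" by simp
    moreover have "1 / 2 \<le> exp (- (1 / 2) :: real)" using exp_ge_add_one_self[of "- (1/2) :: real"] by simp
    ultimately have "1 \<le> 2 * exp (- y\<^sup>2 / (2 * (real (Suc k) * s)\<^sup>2))" by linarith
    then show ?thesis by (simp add: field_simps)
  qed
  finally have "ennreal (exp (- \<bar>y\<bar> / s)) \<le> ennreal (2 * (1 / 2) ^ k * exp (- y\<^sup>2 / (2 * (real (Suc k) * s)\<^sup>2)))"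
    by (intro ennreal_leI)
  also have "\<dots> \<le> (\<Sum>k. ennreal (2 * (1 / 2) ^ k * exp (- y\<^sup>2 / (2 * (real (Suc k) * s)\<^sup>2))))"
    by (rule term_le_suminf)
  finally show ?thesis .
qed

text \<open>Squared Euclidean distance to the integer lattice, since rounding is optimal in each
  coordinate.\<close>

definition dst2 :: "nat \<Rightarrow> (nat \<Rightarrow> real) \<Rightarrow> real" where
  "dst2 n v = (\<Sum>j<n. (v j - of_int (round (v j)))\<^sup>2)"

text \<open>In the terminology of Rudelson and Vershynin: the least common denominator of \<open>x\<close>, with
  parameters \<open>\<gamma>\<close> and \<open>\<mu> * sqrt n\<close>, is at least \<open>D\<close>.\<close>

definition lcd_ge :: "nat \<Rightarrow> real \<Rightarrow> real \<Rightarrow> real \<Rightarrow> (nat \<Rightarrow> real) \<Rightarrow> bool" where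
  "lcd_ge n \<gamma> \<mu> D x \<longleftrightarrow> (\<forall>\<theta>. 0 < \<theta> \<longrightarrow> \<theta> \<le> D \<longrightarrow> min (\<gamma>\<^sup>2 * \<theta>\<^sup>2) (\<mu>\<^sup>2 * real n) \<le> dst2 n (\<lambda>j. \<theta> * x j))"

context real_law
begin

text \<open>The exceptional set is covered by a measurable one, as the property itself may not be measurable.\<close>

definition typically :: "nat set \<Rightarrow> nat \<Rightarrow> real \<Rightarrow> ((nat \<times> nat \<Rightarrow> real) \<Rightarrow> bool) \<Rightarrow> bool" where
  "typically R n q \<Phi> \<longleftrightarrow> (\<exists>Bad \<in> sets (PR R n). measure (PR R n) Bad \<le> q \<and> (\<forall>A \<in> space (PR R n) - Bad. \<Phi> A))"

lemma typically_mono: "typically R n q \<Phi> \<Longrightarrow> q \<le> q' \<Longrightarrow> (\<And>A. \<Phi> A \<Longrightarrow> \<Psi> A) \<Longrightarrow> typically R n q' \<Psi>"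
  unfolding typically_def by (meson order_trans)

lemma typically_ball:
  fixes q :: real
  assumes "finite I" "\<And>k. k \<in> I \<Longrightarrow> typically R n q (\<Phi> k)"
  shows "typically R n (card I * q) (\<lambda>A. \<forall>k\<in>I. \<Phi> k A)"
proof -
  interpret Q: prob_space "PR R n" by (rule prob_space_P)
  obtain B where B: "\<And>k. k \<in> I \<Longrightarrow> B k \<in> sets (PR R n)" "\<And>k. k \<in> I \<Longrightarrow> measure (PR R n) (B k) \<le> q"
    "\<And>k A. k \<in> I \<Longrightarrow> A \<in> space (PR R n) - B k \<Longrightarrow> \<Phi> k A"
    using assms(2) unfolding typically_def by metis
  have "measure (PR R n) (\<Union>k\<in>I. B k) \<le> (\<Sum>k\<in>I. measure (PR R n) (B k))"
    using B(1) assms(1) by (intro Q.finite_measure_subadditive_finite) auto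
  also have "\<dots> \<le> card I * q" using sum_mono[of I, OF B(2)] by simp
  finally show ?thesis unfolding typically_def
    using B(1,3) assms(1) by (intro bexI[of _ "\<Union>k\<in>I. B k"]) auto
qed

lemma typically_conj:
  assumes "typically R n q \<Phi>" "typically R n q' \<Psi>"
  shows "typically R n (q + q') (\<lambda>A. \<Phi> A \<and> \<Psi> A)"
proof -
  obtain B B' where B: "B \<in> sets (PR R n)" "measure (PR R n) B \<le> q" "\<And>A. A \<in> space (PR R n) - B \<Longrightarrow> \<Phi> A"
    "B' \<in> sets (PR R n)" "measure (PR R n) B' \<le> q'" "\<And>A. A \<in> space (PR R n) - B' \<Longrightarrow> \<Psi> A"
    using assms unfolding typically_def by blast
  then show ?thesis unfolding typically_def
    using measure_Un_le[OF B(1,4)] by (intro bexI[of _ "B \<union> B'"]) auto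
qed

text \<open>The operator norm from the Euclidean norm to l1 is at most \<open>T\<close>. The natural
  size of \<open>T\<close> is a multiple of \<open>n\<close>: about \<open>n\<close> rows, each with
  a product of order 1 with a unit vector.\<close>

definition op_bounded :: "nat set \<Rightarrow> nat \<Rightarrow> real \<Rightarrow> (nat \<times> nat \<Rightarrow> real) \<Rightarrow> bool" where
  "op_bounded R n T A \<longleftrightarrow> (\<forall>x. l1 R n A x \<le> T * L2_set x {..<n})"

text \<open>A property of the fixed vector \<open>x\<close>, demanded for every finite set of rows:
  the nets use it with the rows under study, the final step with the rows left after conditioning.
  \<open>s\<close> is the scale per row.\<close>

definition anticoncentrated :: "real \<Rightarrow> nat \<Rightarrow> real \<Rightarrow> (nat \<Rightarrow> real) \<Rightarrow> bool" where
  "anticoncentrated C n s x \<longleftrightarrow> (\<forall>R. finite R \<longrightarrow> \<P>(A in PR R n. l1 R n A x \<le> s * card R) \<le> (C * s) ^ card R)"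

lemma measurable_entry: "k \<in> K \<Longrightarrow> (\<lambda>A. A k) \<in> borel_measurable (P K)"
  using measurable_component_singleton[of k K "\<lambda>_. M"] measurable_cong_sets[OF refl sets_M] by blast

lemma measurable_mv: "i \<in> R \<Longrightarrow> (\<lambda>A. mv n A x i) \<in> borel_measurable (PR R n)"
  unfolding mv_def by (intro borel_measurable_sum borel_measurable_times measurable_entry borel_measurable_const) auto

lemma measurable_l1: "R' \<subseteq> R \<Longrightarrow> (\<lambda>A. l1 R' n A x) \<in> borel_measurable (PR R n)"
  unfolding l1_def by (intro borel_measurable_sum borel_measurable_abs measurable_mv) auto

lemma mv_row: "mv n A x i = (\<Sum>k\<in>{i} \<times> {..<n}. A k * x (snd k))"
proof -
  have "(\<Sum>k\<in>{i} \<times> {..<n}. A k * x (snd k)) = (\<Sum>i\<in>{i}. \<Sum>j<n. A (i, j) * x j)"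
    by (subst sum.cartesian_product) (simp add: case_prod_beta)
  then show ?thesis by (simp add: mv_def)
qed

lemma nn_integral_rows:
  assumes "finite R" and [measurable]: "f \<in> borel_measurable borel"
  shows "(\<integral>\<^sup>+A. (\<Prod>i\<in>R. f (mv n A x i)) \<partial>PR R n) = (\<Prod>i\<in>R. \<integral>\<^sup>+A. f (mv n A x i) \<partial>PR {i} n)"
  using assms(1)
proof (induction R rule: finite_induct)
  case empty
  interpret pe: prob_space "P ({} :: (nat \<times> nat) set)" by (rule prob_space_P)
  show ?case using pe.emeasure_space_1 by simp
next
  case (insert r R)
  interpret pp: product_prob_space "\<lambda>_. M" "UNIV :: (nat \<times> nat) set" by (rule product_P)
  have un: "insert r R \<times> {..<n} = ({r} \<times> {..<n}) \<union> (R \<times> {..<n})" by auto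
  have disj: "({r} \<times> {..<n}) \<inter> (R \<times> {..<n}) = {}" using insert by auto
  have m: "(\<lambda>A. \<Prod>i\<in>R'. f (mv n A x i)) \<in> borel_measurable (PR R' n)" for R'
    by (intro borel_measurable_prod_ennreal measurable_compose[OF measurable_mv]) auto
  have mr: "(\<lambda>A. f (mv n A x r)) \<in> borel_measurable (PR {r} n)"
    by (intro measurable_compose[OF measurable_mv]) auto
  have "(\<integral>\<^sup>+A. (\<Prod>i\<in>insert r R. f (mv n A x i)) \<partial>PR (insert r R) n) =
    (\<integral>\<^sup>+A. \<integral>\<^sup>+B. (\<Prod>i\<in>insert r R. f (mv n (merge ({r} \<times> {..<n}) (R \<times> {..<n}) (A, B)) x i)) \<partial>PR R n \<partial>PR {r} n)"
    unfolding un using insert by (intro pp.product_nn_integral_fold disj m[of "insert r R", unfolded un]) auto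
  also have "\<dots> = (\<integral>\<^sup>+A. \<integral>\<^sup>+B. f (mv n A x r) * (\<Prod>i\<in>R. f (mv n B x i)) \<partial>PR R n \<partial>PR {r} n)"
  proof (intro nn_integral_cong)
    fix A B
    have "mv n (merge ({r} \<times> {..<n}) (R \<times> {..<n}) (A, B)) x r = mv n A x r"
      by (simp add: mv_def merge_def)
    moreover have "mv n (merge ({r} \<times> {..<n}) (R \<times> {..<n}) (A, B)) x i = mv n B x i" if "i \<in> R" for i
      using that insert by (auto simp: mv_def merge_def intro!: sum.cong)
    ultimately show "(\<Prod>i\<in>insert r R. f (mv n (merge ({r} \<times> {..<n}) (R \<times> {..<n}) (A, B)) x i)) =
      f (mv n A x r) * (\<Prod>i\<in>R. f (mv n B x i))" using insert by simp
  qed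
  also have "\<dots> = (\<integral>\<^sup>+A. f (mv n A x r) \<partial>PR {r} n) * (\<integral>\<^sup>+B. (\<Prod>i\<in>R. f (mv n B x i)) \<partial>PR R n)"
    using m[of R] mr by (simp add: nn_integral_cmult nn_integral_multc)
  finally show ?case using insert by simp
qed

text \<open>Tensorisation: the exponential Markov inequality at rate \<open>1 / s\<close> reduces
  the sum over the rows to one Laplace integral per row, the rows being independent.\<close>

lemma l1_tail:
  assumes R: "finite R" and s: "s > 0" and q: "0 \<le> q"
    and row: "\<And>i. i \<in> R \<Longrightarrow> (\<integral>\<^sup>+A. ennreal (exp (- \<bar>mv n A x i\<bar> / s)) \<partial>PR {i} n) \<le> ennreal q"
  shows "\<P>(A in PR R n. l1 R n A x \<le> u * s * card R)
    \<le> (exp u * q) ^ card R"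
proof -
  interpret p: prob_space "PR R n" by (rule prob_space_P)
  let ?E = "{A \<in> space (PR R n). l1 R n A x \<le> u * s * card R}"
  have E: "?E \<in> sets (PR R n)" using measurable_l1[of R R n x] by measurable
  have "ennreal (measure (PR R n) ?E) = (\<integral>\<^sup>+A. indicator ?E A \<partial>PR R n)"
    by (simp only: nn_integral_indicator[OF E] p.emeasure_eq_measure)
  also have "\<dots> \<le> (\<integral>\<^sup>+A. ennreal (exp u ^ card R) * (\<Prod>i\<in>R. ennreal (exp (- \<bar>mv n A x i\<bar> / s))) \<partial>PR R n)"
  proof (rule nn_integral_mono)
    fix A
    have "(1::real) \<le> exp (u * card R - l1 R n A x / s)" if "A \<in> ?E"
      using that s by (simp add: field_simps)
    also have "exp (u * card R - l1 R n A x / s) = exp u ^ card R * (\<Prod>i\<in>R. exp (- \<bar>mv n A x i\<bar> / s))"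
    proof -
      have "(\<Prod>i\<in>R. exp (- \<bar>mv n A x i\<bar> / s)) = exp (\<Sum>i\<in>R. - \<bar>mv n A x i\<bar> / s)"
        by (rule exp_sum[symmetric, OF R])
      also have "(\<Sum>i\<in>R. - \<bar>mv n A x i\<bar> / s) = - l1 R n A x / s"
        by (simp add: l1_def sum_negf sum_divide_distrib)
      finally show ?thesis
        by (simp only: exp_of_nat2_mult[symmetric] mult_exp_exp) (simp add: mult.commute)
    qed
    finally have "ennreal 1 \<le> ennreal (exp u ^ card R * (\<Prod>i\<in>R. exp (- \<bar>mv n A x i\<bar> / s)))" if "A \<in> ?E"
      using that by (intro ennreal_leI) auto
    then show "indicator ?E A \<le> ennreal (exp u ^ card R) * (\<Prod>i\<in>R. ennreal (exp (- \<bar>mv n A x i\<bar> / s)))"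
      by (auto simp: indicator_def ennreal_mult prod_ennreal prod_nonneg)
  qed
  also have "\<dots> = ennreal (exp u ^ card R) * (\<integral>\<^sup>+A. (\<Prod>i\<in>R. ennreal (exp (- \<bar>mv n A x i\<bar> / s))) \<partial>PR R n)"
    by (intro nn_integral_cmult borel_measurable_prod_ennreal measurable_compose[OF measurable_mv]) auto
  also have "\<dots> = ennreal (exp u ^ card R) * (\<Prod>i\<in>R. \<integral>\<^sup>+A. ennreal (exp (- \<bar>mv n A x i\<bar> / s)) \<partial>PR {i} n)"
    by (subst nn_integral_rows[OF R]) auto
  also have "\<dots> \<le> ennreal (exp u ^ card R) * (\<Prod>i\<in>R. ennreal q)"
    by (intro mult_left_mono prod_mono_ennreal row) auto
  also have "\<dots> = ennreal ((exp u * q) ^ card R)"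
    using q by (simp add: ennreal_power ennreal_mult[symmetric] power_mult_distrib)
  finally show ?thesis using q by (simp add: ennreal_le_iff)
qed

text \<open>Integrates the series of Gaussian kernels term by term. All widths
  \<open>Suc k * s\<close> occur, hence the hypothesis for every \<open>t \<ge> s\<close>; the
  constant is \<open>2 * C * s\<close> times the sum 4 of the terms
  \<open>Suc k * (1 / 2) ^ k\<close>.\<close>

lemma row_exp_le:
  assumes s: "s > 0" and C: "C \<ge> 0"
    and G: "\<And>t. t \<ge> s \<Longrightarrow> (\<integral>A. exp (- (mv n A x i)\<^sup>2 / (2 * t\<^sup>2)) \<partial>PR {i} n) \<le> C * t"
  shows "(\<integral>\<^sup>+A. ennreal (exp (- \<bar>mv n A x i\<bar> / s)) \<partial>PR {i} n) \<le> ennreal (8 * C * s)"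
proof -
  have mm: "(\<lambda>A. mv n A x i) \<in> borel_measurable (PR {i} n)" by (rule measurable_mv) simp
  have gm': "(\<lambda>y. exp (- y\<^sup>2 / (2 * c\<^sup>2))) \<in> borel_measurable borel" for c :: real
    by measurable
  have gm: "(\<lambda>y. ennreal (2 * (1 / 2) ^ k * exp (- y\<^sup>2 / (2 * (real (Suc k) * s)\<^sup>2)))) \<in> borel_measurable borel" for k
    using gm'[of "real (Suc k) * s"] by measurable
  have "(\<integral>\<^sup>+A. ennreal (exp (- \<bar>mv n A x i\<bar> / s)) \<partial>PR {i} n) \<le>
    (\<integral>\<^sup>+A. (\<Sum>k. ennreal (2 * (1 / 2) ^ k * exp (- (mv n A x i)\<^sup>2 / (2 * (real (Suc k) * s)\<^sup>2)))) \<partial>PR {i} n)"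
    by (intro nn_integral_mono exp_minus_abs_le_series s)
  also have "\<dots> = (\<Sum>k. \<integral>\<^sup>+A. ennreal (2 * (1 / 2) ^ k * exp (- (mv n A x i)\<^sup>2 / (2 * (real (Suc k) * s)\<^sup>2))) \<partial>PR {i} n)"
    by (rule nn_integral_suminf) (rule measurable_compose[OF mm gm])
  also have "\<dots> \<le> (\<Sum>k. ennreal (2 * C * s * (real (Suc k) * (1 / 2) ^ k)))"
  proof (intro suminf_le allI)
    fix k
    let ?t = "real (Suc k) * s"
    have int: "integrable (PR {i} n) (\<lambda>A. 2 * (1 / 2) ^ k * exp (- (mv n A x i)\<^sup>2 / (2 * ?t\<^sup>2)))"
    proof (intro integrable_mult_right integrable_bounded[OF prob_space_P, where B=1])
      show "(\<lambda>A. exp (- (mv n A x i)\<^sup>2 / (2 * ?t\<^sup>2))) \<in> borel_measurable (PR {i} n)" by (rule measurable_compose[OF mm gm'])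
      show "norm (exp (- (mv n A x i)\<^sup>2 / (2 * ?t\<^sup>2))) \<le> 1" for A by (simp del: of_nat_Suc)
    qed
    have "(\<integral>\<^sup>+A. ennreal (2 * (1 / 2) ^ k * exp (- (mv n A x i)\<^sup>2 / (2 * ?t\<^sup>2))) \<partial>PR {i} n)
      = ennreal (\<integral>A. 2 * (1 / 2) ^ k * exp (- (mv n A x i)\<^sup>2 / (2 * ?t\<^sup>2)) \<partial>PR {i} n)"
      by (rule nn_integral_eq_integral[OF int]) simp
    also have "\<dots> \<le> ennreal (2 * (1 / 2) ^ k * (C * ?t))"
    proof (rule ennreal_leI)
      have "1 * s \<le> ?t" using s by (intro mult_right_mono) auto
      then have "s \<le> ?t" by simp
      show "(\<integral>A. 2 * (1 / 2) ^ k * exp (- (mv n A x i)\<^sup>2 / (2 * ?t\<^sup>2)) \<partial>PR {i} n) \<le> 2 * (1 / 2) ^ k * (C * ?t)"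
        unfolding Bochner_Integration.integral_mult_right_zero
        by (rule mult_left_mono[OF G[OF \<open>s \<le> ?t\<close>]]) simp
    qed
    also have "2 * (1 / 2) ^ k * (C * ?t) = 2 * C * s * (real (Suc k) * (1 / 2) ^ k)" by (simp add: mult_ac)
    finally show "(\<integral>\<^sup>+A. ennreal (2 * (1 / 2) ^ k * exp (- (mv n A x i)\<^sup>2 / (2 * ?t\<^sup>2))) \<partial>PR {i} n)
      \<le> ennreal (2 * C * s * (real (Suc k) * (1 / 2) ^ k))" .
  qed auto
  also have "\<dots> = ennreal (8 * C * s)"
  proof (rule suminf_ennreal_eq)
    have "(\<lambda>k. real (Suc k) * (1 / 2) ^ k) sums (1 / (1 - 1 / 2)\<^sup>2)"
      by (rule geometric_deriv_sums) simp
    then have "(\<lambda>k. 2 * C * s * (real (Suc k) * (1 / 2) ^ k)) sums (2 * C * s * (1 / (1 - 1 / 2)\<^sup>2))"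
      by (rule sums_mult)
    then show "(\<lambda>k. 2 * C * s * (real (Suc k) * (1 / 2) ^ k)) sums (8 * C * s)"
      by (simp add: power2_eq_square mult.assoc)
  qed (use C s in auto)
  finally show ?thesis .
qed

lemma smoothing_row:
  assumes "t > 0" "p = measure sym {z. b \<le> \<bar>z\<bar> \<and> \<bar>z\<bar> \<le> B}" "0 < p"
    and q: "\<And>z. b \<le> z \<Longrightarrow> z \<le> B \<Longrightarrow>
      (\<integral>g. exp (- (p / 2) * (\<Sum>j<n. 1 - cos (g * x j * z / t))) \<partial>gauss) \<le> q"
  shows "(\<integral>A. exp (- (mv n A x i)\<^sup>2 / (2 * t\<^sup>2)) \<partial>PR {i} n) \<le> q"
  unfolding mv_row
proof (rule smoothing)
  fix z assume z: "b \<le> z" "z \<le> B"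
  have "(\<Sum>k\<in>{i} \<times> {..<n}. 1 - cos (g * x (snd k) * z / t)) = (\<Sum>j<n. 1 - cos (g * x j * z / t))" for g
  proof -
    have "(\<Sum>k\<in>{i} \<times> {..<n}. 1 - cos (g * x (snd k) * z / t)) = (\<Sum>i\<in>{i}. \<Sum>j<n. 1 - cos (g * x j * z / t))"
      by (subst sum.cartesian_product) (simp add: case_prod_beta)
    then show ?thesis by simp
  qed
  then show "(\<integral>g. exp (- (p / 2) * (\<Sum>k\<in>{i} \<times> {..<n}. 1 - cos (g * x (snd k) * z / t))) \<partial>gauss) \<le> q"
    using q[OF z] by simp
qed (use assms in auto)

text \<open>With \<theta> the frequency attached to \<open>g\<close>, the cosine sum is at least
  half of \<open>dst2\<close>. For \<theta> up to \<open>D\<close> one of the two members of the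
  minimum in \<open>lcd_ge\<close> applies: the quadratic one integrates to order \<open>t\<close>,
  the constant one is exponentially small. Larger frequencies fall under the Gaussian tail.\<close>

lemma gaussian_average_lcd:
  assumes b: "0 < b" "b \<le> z" "z \<le> B" and p: "0 < p" "p \<le> 1" and t: "t > 0" and \<gamma>: "\<gamma> > 0"
    and x: "lcd_ge n \<gamma> \<mu> D x" and D: "D \<ge> 0"
  shows "(\<integral>g. exp (- (p / 2) * (\<Sum>j<n. 1 - cos (g * x j * z / t))) \<partial>gauss)
    \<le> 4 * pi / (\<gamma> * b * p) * t + exp (- (p / 4) * (\<mu>\<^sup>2 * n)) + 2 * exp (- (2 * pi * t * D / B)\<^sup>2 / 4)"
proof -
  interpret G: prob_space gauss by (rule prob_space_gauss)
  \<comment> \<open>For \<open>\<bar>g\<bar> \<le> T\<close> every \<open>z \<le> B\<close> has a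
    frequency of at most \<open>D\<close>; \<kappa> is the quadratic rate for the smallest
    \<open>z\<close>, namely \<open>b\<close>.\<close>
  define T where "T = 2 * pi * t * D / B"
  define \<kappa> where "\<kappa> = p / 4 * (\<gamma> * b / (2 * pi * t))\<^sup>2"
  have B: "B > 0" using b by simp
  have \<kappa>: "\<kappa> > 0" using assms by (simp add: \<kappa>_def)
  have "(\<integral>g. exp (- (p / 2) * (\<Sum>j<n. 1 - cos (g * x j * z / t))) \<partial>gauss)
    \<le> (\<integral>g. exp (- \<kappa> * g\<^sup>2) + exp (- (p / 4) * (\<mu>\<^sup>2 * n)) + indicator {g. T < \<bar>g\<bar>} g \<partial>gauss)"
  proof (rule integral_mono)
    show "integrable gauss (\<lambda>g. exp (- (p / 2) * (\<Sum>j<n. 1 - cos (g * x j * z / t))))"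
      by (rule integrable_bounded[OF prob_space_gauss, where B=1]) (use p in \<open>auto intro!: mult_nonneg_nonneg sum_nonneg\<close>)
    show "integrable gauss (\<lambda>g. exp (- \<kappa> * g\<^sup>2) + exp (- (p / 4) * (\<mu>\<^sup>2 * n)) + indicator {g. T < \<bar>g\<bar>} g)"
      using \<kappa> p by (intro Bochner_Integration.integrable_add integral_exp_square_gauss integrable_bounded[OF prob_space_gauss, where B=1])
        (auto simp: indicator_def)
    fix g
    define \<theta> where "\<theta> = \<bar>g\<bar> * z / (2 * pi * t)"
    have "cos (g * x j * z / t) = cos (2 * pi * (\<theta> * x j))" for j
    proof -
      have "2 * pi * (\<theta> * x j) = \<bar>g\<bar> * x j * z / t" using t by (simp add: \<theta>_def)
      then show ?thesis by (cases "g \<ge> 0") auto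
    qed
    then have "(\<Sum>j<n. 1 - cos (g * x j * z / t)) \<ge> (\<Sum>j<n. (\<theta> * x j - of_int (round (\<theta> * x j)))\<^sup>2 / 2)"
      by (intro sum_mono) (simp only: one_minus_cos_ge_round)
    then have ge: "dst2 n (\<lambda>j. \<theta> * x j) / 2 \<le> (\<Sum>j<n. 1 - cos (g * x j * z / t))"
      by (simp add: dst2_def sum_divide_distrib)
    have d0: "0 \<le> dst2 n (\<lambda>j. \<theta> * x j)" by (simp add: dst2_def sum_nonneg)
    have le1: "exp (- (p / 2) * (\<Sum>j<n. 1 - cos (g * x j * z / t))) \<le> exp (- (p / 4) * dst2 n (\<lambda>j. \<theta> * x j))"
      using mult_left_mono[OF ge, of "p / 2"] p by simp
    consider "g = 0" | "T < \<bar>g\<bar>" | "g \<noteq> 0" "\<bar>g\<bar> \<le> T" by linarith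
    then show "exp (- (p / 2) * (\<Sum>j<n. 1 - cos (g * x j * z / t))) \<le>
      exp (- \<kappa> * g\<^sup>2) + exp (- (p / 4) * (\<mu>\<^sup>2 * n)) + indicator {g. T < \<bar>g\<bar>} g"
    proof cases
      case 1
      then show ?thesis by simp
    next
      case 2
      have "exp (- (p / 4) * dst2 n (\<lambda>j. \<theta> * x j)) \<le> 1" using d0 p by simp
      then have "exp (- (p / 2) * (\<Sum>j<n. 1 - cos (g * x j * z / t))) \<le> 1" using le1 by linarith
      moreover have "0 < exp (- \<kappa> * g\<^sup>2)" "0 < exp (- (p / 4) * (\<mu>\<^sup>2 * n))" by simp_all
      moreover have "indicator {g. T < \<bar>g\<bar>} g = (1::real)" using 2 by simp
      ultimately show ?thesis by linarith
    next
      case 3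
      have "\<theta> > 0" using 3 b t by (simp add: \<theta>_def)
      moreover have "\<theta> \<le> D"
      proof -
        have "\<bar>g\<bar> * z \<le> T * B" using 3 b by (intro mult_mono) auto
        also have "\<dots> = 2 * pi * t * D" using B by (simp add: T_def)
        finally show ?thesis using t by (simp add: \<theta>_def field_simps)
      qed
      ultimately have m: "min (\<gamma>\<^sup>2 * \<theta>\<^sup>2) (\<mu>\<^sup>2 * real n) \<le> dst2 n (\<lambda>j. \<theta> * x j)"
        using x by (auto simp: lcd_ge_def)
      have "\<bar>g\<bar> * b / (2 * pi * t) \<le> \<theta>" unfolding \<theta>_def using b t
        by (intro divide_right_mono mult_left_mono) auto
      then have "(\<bar>g\<bar> * b / (2 * pi * t))\<^sup>2 \<le> \<theta>\<^sup>2" using b t by (intro power_mono) auto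
      then have "p / 4 * (\<gamma>\<^sup>2 * (\<bar>g\<bar> * b / (2 * pi * t))\<^sup>2) \<le> p / 4 * (\<gamma>\<^sup>2 * \<theta>\<^sup>2)"
        using p by (intro mult_left_mono) auto
      then have k2: "\<kappa> * g\<^sup>2 \<le> p / 4 * (\<gamma>\<^sup>2 * \<theta>\<^sup>2)"
        by (simp add: \<kappa>_def power_mult_distrib power_divide mult_ac)
      have "exp (- (p / 4) * dst2 n (\<lambda>j. \<theta> * x j)) \<le> exp (- \<kappa> * g\<^sup>2) + exp (- (p / 4) * (\<mu>\<^sup>2 * n))"
      proof (cases "\<gamma>\<^sup>2 * \<theta>\<^sup>2 \<le> \<mu>\<^sup>2 * real n")
        case True
        then have "p / 4 * (\<gamma>\<^sup>2 * \<theta>\<^sup>2) \<le> p / 4 * dst2 n (\<lambda>j. \<theta> * x j)" using m p by (intro mult_left_mono) auto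
        then have "exp (- (p / 4) * dst2 n (\<lambda>j. \<theta> * x j)) \<le> exp (- \<kappa> * g\<^sup>2)" using k2 by simp
        then show ?thesis by (rule order_trans) simp
      next
        case False
        then have "p / 4 * (\<mu>\<^sup>2 * real n) \<le> p / 4 * dst2 n (\<lambda>j. \<theta> * x j)" using m p by (intro mult_left_mono) auto
        then have "exp (- (p / 4) * dst2 n (\<lambda>j. \<theta> * x j)) \<le> exp (- (p / 4) * (\<mu>\<^sup>2 * n))" by simp
        then show ?thesis by (rule order_trans) simp
      qed
      moreover have "0 \<le> (indicator {g. T < \<bar>g\<bar>} g :: real)" by simp
      ultimately show ?thesis using le1 by linarith
    qed
  qed
  also have "\<dots> = 1 / sqrt (1 + 2 * \<kappa>) + exp (- (p / 4) * (\<mu>\<^sup>2 * n)) + measure gauss {g. T < \<bar>g\<bar>}"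
  proof -
    have "integrable gauss (\<lambda>g. exp (- \<kappa> * g\<^sup>2))" using \<kappa> by (intro integral_exp_square_gauss) simp
    moreover have "integrable gauss (indicator {g. T < \<bar>g\<bar>} :: real \<Rightarrow> real)"
      by (rule integrable_bounded[OF prob_space_gauss, where B=1]) (auto simp: indicator_def)
    moreover have "(\<integral>g. c \<partial>gauss) = c" for c :: real using G.prob_space by simp
    ultimately show ?thesis
      using \<kappa> integral_exp_square_gauss(2)[of \<kappa>]
      by (simp only: Bochner_Integration.integral_add Bochner_Integration.integrable_add G.integrable_const) simp
  qed
  also have "\<dots> \<le> 4 * pi / (\<gamma> * b * p) * t + exp (- (p / 4) * (\<mu>\<^sup>2 * n)) + 2 * exp (- T\<^sup>2 / 4)"
  proof (intro add_mono order_refl gauss_tail)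
    show "0 \<le> T" using t D B by (simp add: T_def)
    \<comment> \<open>\<open>p \<le> 1\<close> gives \<open>(p / 2)\<^sup>2 \<le> p / 4\<close>,
      which keeps square roots of \<open>p\<close> out of the constant.\<close>
    have "p * p \<le> p * 1" using p by (intro mult_left_mono) auto
    then have "(p / 2 * (\<gamma> * b / (2 * pi * t)))\<^sup>2 \<le> \<kappa>"
      unfolding \<kappa>_def power_mult_distrib by (intro mult_right_mono) (auto simp: power2_eq_square)
    then have "(p / 2 * (\<gamma> * b / (2 * pi * t)))\<^sup>2 \<le> 1 + 2 * \<kappa>" using \<kappa> by simp
    then have "p / 2 * (\<gamma> * b / (2 * pi * t)) \<le> sqrt (1 + 2 * \<kappa>)" by (rule real_le_rsqrt)
    then have "1 / sqrt (1 + 2 * \<kappa>) \<le> 1 / (p / 2 * (\<gamma> * b / (2 * pi * t)))"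
      using p \<gamma> b t \<kappa> by (intro divide_left_mono mult_pos_pos divide_pos_pos) auto
    also have "\<dots> = 4 * pi / (\<gamma> * b * p) * t" using p \<gamma> b t by (simp add: field_simps)
    finally show "1 / sqrt (1 + 2 * \<kappa>) \<le> 4 * pi / (\<gamma> * b * p) * t" .
  qed
  finally show ?thesis by (simp add: T_def)
qed

end

section \<open>Nondegeneracy of the entries and small ball estimates\<close>

locale subgaussian_law = real_law +
  assumes subgaussian: "subgaussian_dist M"
    and mean: "integrable M (\<lambda>x. x)" "(\<integral>x. x \<partial>M) = 0"
    and variance: "integrable M (\<lambda>x. x\<^sup>2)" "(\<integral>x. x\<^sup>2 \<partial>M) = 1"
begin

lemma not_AE_const: "\<not> (AE y in M. y = x)"
proof
  assume ae: "AE y in M. y = x"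
  have "(\<integral>y. y \<partial>M) = (\<integral>y. x \<partial>M)"
    by (rule integral_cong_AE[OF _ _ ae]) (use mean(1) in \<open>auto dest: borel_measurable_integrable\<close>)
  then have x: "x = 0" using mean prob_space by simp
  have "(\<integral>y. y\<^sup>2 \<partial>M) = (\<integral>y. 0 \<partial>M)"
  proof (rule integral_cong_AE)
    show "AE y in M. y\<^sup>2 = 0" by (rule AE_mp[OF ae]) (simp add: x)
  qed measurable
  then show False using variance by simp
qed

text \<open>The shells exhaust the nonzero reals. Were all of them null, two independent entries
  would agree almost surely, and by Fubini the law would be a point mass.\<close>

lemma sym_nondegenerate:
  obtains b B where "0 < b" "b \<le> B" "0 < measure sym {z. b \<le> \<bar>z\<bar> \<and> \<bar>z\<bar> \<le> B}"
proof -
  interpret s: prob_space sym by (rule prob_space_sym)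
  interpret p: pair_prob_space M M by (rule pair_M)
  define S where "S k = {z :: real. 1 / real (Suc k) \<le> \<bar>z\<bar> \<and> \<bar>z\<bar> \<le> real (Suc k)}" for k
  have [measurable]: "S k \<in> sets borel" for k unfolding S_def by measurable
  have "\<exists>k. 0 < measure sym (S k)"
  proof (rule ccontr)
    assume "\<not> ?thesis"
    then have "measure sym (S k) = 0" for k by (meson measure_nonneg order.antisym not_less)
    then have "AE z in sym. z \<notin> S k" for k
      by (subst AE_iff_measurable[OF _ refl]) (auto simp: s.emeasure_eq_measure)
    then have "AE z in sym. \<forall>k. z \<notin> S k" by (simp add: AE_all_countable)
    then have "AE z in sym. z = 0"
    proof (rule AE_mp, intro AE_I2 impI)
      fix z assume n: "\<forall>k. z \<notin> S k"
      show "z = 0"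
      proof (rule ccontr)
        assume "z \<noteq> 0"
        obtain k1 where k1: "\<bar>z\<bar> \<le> real k1" using real_arch_simple by blast
        obtain k2 where k2: "1 / real (Suc k2) < \<bar>z\<bar>" using \<open>z \<noteq> 0\<close> nat_approx_posE[of "\<bar>z\<bar>"] by auto
        define k where "k = max k1 k2"
        have "1 / real (Suc k) \<le> 1 / real (Suc k2)" unfolding k_def by (intro divide_left_mono) auto
        then have "z \<in> S k" using k1 k2 by (auto simp: S_def k_def)
        then show False using n by auto
      qed
    qed
    then have "AE w in M \<Otimes>\<^sub>M M. fst w - snd w = 0"
      unfolding sym_def by (subst (asm) AE_distr_iff) (auto simp: case_prod_beta)
    then have "AE x in M. AE y in M. x - y = 0" using p.AE_pair by fastforce
    then have "AE x in M. False"
    proof (rule AE_mp, intro AE_I2 impI)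
      fix x assume "AE y in M. x - y = 0"
      then have "AE y in M. y = x" by (rule AE_mp) auto
      then show False using not_AE_const by blast
    qed
    then show False by simp
  qed
  then obtain k where "0 < measure sym (S k)" by auto
  then show ?thesis
  proof (intro that[of "1 / real (Suc k)" "real (Suc k)"])
    have "1 / real (Suc k) \<le> 1" by simp
    then show "1 / real (Suc k) \<le> real (Suc k)" by (rule order_trans) simp
  qed (simp_all only: S_def, simp)
qed

text \<open>The condition \<open>\<mu> * sqrt n \<le> s * D\<close> puts the Gaussian cut-off at a
  constant times \<open>\<mu> * sqrt n\<close> or higher for all widths \<open>t \<ge> s\<close>, so
  all error terms are of order \<open>exp (- c * \<mu>\<^sup>2 * n)\<close>, hence of order
  \<open>s\<close>. \<open>C\<close> and \<open>c\<close> depend on \<gamma> and the law only, so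
  that \<mu> can later be chosen in terms of \<open>C\<close>.\<close>

lemma small_ball_l1:
  assumes \<gamma>: "\<gamma> > 0"
  obtains C c :: real where "C > 0" "c > 0"
    "\<And>n x \<mu> D s. \<lbrakk>lcd_ge n \<gamma> \<mu> D x; s > 0; \<mu> \<ge> 0; D \<ge> 0; \<mu> * sqrt n \<le> s * D; exp (- c * \<mu>\<^sup>2 * n) \<le> s\<rbrakk>
      \<Longrightarrow> anticoncentrated C n s x"
proof -
  interpret sy: prob_space sym by (rule prob_space_sym)
  obtain b B where b: "0 < b" "b \<le> B" "0 < measure sym {z. b \<le> \<bar>z\<bar> \<and> \<bar>z\<bar> \<le> B}"
    by (rule sym_nondegenerate)
  define p where "p = measure sym {z. b \<le> \<bar>z\<bar> \<and> \<bar>z\<bar> \<le> B}"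
  have p: "0 < p" "p \<le> 1" using b by (auto simp: p_def)
  define C1 where "C1 = 4 * pi / (\<gamma> * b * p)"
  define c where "c = min (p / 4) (1 / B\<^sup>2)"
  have C1: "C1 > 0" using \<gamma> b p by (simp add: C1_def)
  have B: "B > 0" using b by simp
  have c: "c > 0" using p B by (simp add: c_def)
  show ?thesis
  \<comment> \<open>\<open>exp 1\<close> stems from \<open>l1_tail\<close> with
    \<open>u = 1\<close>, 8 from the series of Gaussian kernels, 3 from the two error terms, whose
    coefficients are 1 and 2.\<close>
  proof (rule that[of "exp 1 * (8 * (C1 + 3))" c])
    fix n \<mu> D s and x :: "nat \<Rightarrow> real"
    assume x: "lcd_ge n \<gamma> \<mu> D x" and s: "s > 0" and \<mu>: "\<mu> \<ge> 0" and D: "D \<ge> 0"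
      and sD: "\<mu> * sqrt n \<le> s * D" and se: "exp (- c * \<mu>\<^sup>2 * n) \<le> s"
    have G: "(\<integral>A. exp (- (mv n A x i)\<^sup>2 / (2 * t\<^sup>2)) \<partial>PR {i} n) \<le> (C1 + 3) * t" if t: "t \<ge> s" for t i
    proof (rule smoothing_row)
      show "t > 0" using s t by simp
      fix z assume z: "b \<le> z" "z \<le> B"
      have "(\<integral>g. exp (- (p / 2) * (\<Sum>j<n. 1 - cos (g * x j * z / t))) \<partial>gauss)
        \<le> C1 * t + exp (- (p / 4) * (\<mu>\<^sup>2 * n)) + 2 * exp (- (2 * pi * t * D / B)\<^sup>2 / 4)"
        unfolding C1_def using gaussian_average_lcd[OF b(1) z p \<open>t > 0\<close> \<gamma> x D] .
      also have "exp (- (p / 4) * (\<mu>\<^sup>2 * n)) \<le> exp (- c * \<mu>\<^sup>2 * n)"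
      proof -
        have "c * (\<mu>\<^sup>2 * n) \<le> p / 4 * (\<mu>\<^sup>2 * n)" by (intro mult_right_mono) (auto simp: c_def)
        then show ?thesis by (simp add: mult.assoc)
      qed
      also have "exp (- (2 * pi * t * D / B)\<^sup>2 / 4) \<le> exp (- c * \<mu>\<^sup>2 * n)"
      proof -
        have "\<mu> * sqrt n \<le> t * D" using sD mult_right_mono[OF t D] by linarith
        then have "(\<mu> * sqrt n)\<^sup>2 \<le> (t * D)\<^sup>2" using \<mu> by (intro power_mono) auto
        then have 1: "\<mu>\<^sup>2 * n \<le> (t * D)\<^sup>2" by (simp add: power_mult_distrib)
        have "c * (\<mu>\<^sup>2 * n) \<le> 1 / B\<^sup>2 * (t * D)\<^sup>2"
          using 1 by (intro mult_mono) (auto simp: c_def)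
        also have "\<dots> \<le> pi\<^sup>2 * (1 / B\<^sup>2 * (t * D)\<^sup>2)"
        proof -
          have "1 \<le> pi\<^sup>2" using pi_ge_two by (intro one_le_power) auto
          then have "1 * (1 / B\<^sup>2 * (t * D)\<^sup>2) \<le> pi\<^sup>2 * (1 / B\<^sup>2 * (t * D)\<^sup>2)" by (intro mult_right_mono) auto
          then show ?thesis by simp
        qed
        also have "\<dots> = (2 * pi * t * D / B)\<^sup>2 / 4" by (simp add: power_mult_distrib power_divide)
        finally show ?thesis by (simp add: mult.assoc)
      qed
      finally have "(\<integral>g. exp (- (p / 2) * (\<Sum>j<n. 1 - cos (g * x j * z / t))) \<partial>gauss) \<le> C1 * t + exp (- c * \<mu>\<^sup>2 * n) + 2 * exp (- c * \<mu>\<^sup>2 * n)"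
        by simp
      then show "(\<integral>g. exp (- (p / 2) * (\<Sum>j<n. 1 - cos (g * x j * z / t))) \<partial>gauss) \<le> (C1 + 3) * t"
        using se t by (simp add: algebra_simps)
    qed (use p in \<open>auto simp: p_def\<close>)
    show "anticoncentrated (exp 1 * (8 * (C1 + 3))) n s x" unfolding anticoncentrated_def
    proof (intro allI impI)
      fix R :: "nat set" assume R: "finite R"
      have "\<P>(A in PR R n. l1 R n A x \<le> 1 * s * card R) \<le> (exp 1 * (8 * (C1 + 3) * s)) ^ card R"
      proof (rule l1_tail[OF R s])
        show "(\<integral>\<^sup>+A. ennreal (exp (- \<bar>mv n A x i\<bar> / s)) \<partial>PR {i} n) \<le> ennreal (8 * (C1 + 3) * s)" for i
          by (rule row_exp_le[OF s _ G]) (use C1 in auto)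
      qed (use C1 s in auto)
      then show "\<P>(A in PR R n. l1 R n A x \<le> s * card R) \<le> (exp 1 * (8 * (C1 + 3)) * s) ^ card R"
        by (simp add: mult.assoc)
    qed
  qed (use C1 c in auto)
qed

text \<open>The exponent is negative on (0, 1), a set of positive Gaussian measure. Strictness is
  what yields \<open>q < 1\<close> uniformly over unit vectors.\<close>

lemma integral_exp_bump_gauss:
  assumes "\<kappa> > 0"
  shows "(\<integral>g. exp (- \<kappa> * (if \<bar>g\<bar> \<le> 1 then g\<^sup>2 else 0)) \<partial>gauss) < 1"
proof (rule ccontr)
  interpret G: prob_space gauss by (rule prob_space_gauss)
  let ?f = "\<lambda>g. exp (- \<kappa> * (if \<bar>g\<bar> \<le> 1 then g\<^sup>2 else 0))"
  have i: "integrable gauss ?f"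
    by (rule integrable_bounded[OF prob_space_gauss, where B=1]) (use assms in auto)
  have f1: "?f g \<le> 1" for g using assms by auto
  assume "\<not> (\<integral>g. ?f g \<partial>gauss) < 1"
  then have "(\<integral>g. 1 - ?f g \<partial>gauss) \<le> 0" using i G.prob_space by simp
  moreover have "0 \<le> (\<integral>g. 1 - ?f g \<partial>gauss)" using f1 by (intro integral_nonneg_AE) simp
  ultimately have "(\<integral>g. 1 - ?f g \<partial>gauss) = 0" by simp
  then have "AE g in gauss. 1 - ?f g = 0"
    using i f1 by (subst (asm) integral_nonneg_eq_0_iff_AE) auto
  then have "AE g in lborel. 0 < std_normal_density g \<longrightarrow> 1 - ?f g = 0"
    by (subst (asm) AE_density) auto
  then have "AE g in lborel. g \<notin> {0<..<1::real}"
    by (rule AE_mp) (use assms in \<open>auto intro!: AE_I2 simp: normal_density_pos\<close>)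
  then have "emeasure lborel {0<..<1::real} = 0"
    using AE_iff_null_sets[of "{0<..<1::real}" lborel] null_setsD1 by auto
  then show False by simp
qed

text \<open>Covers all unit vectors, coordinate vectors included, hence only with some
  \<open>q < 1\<close> per row in place of a power of the scale. At width \<open>B\<close>, values
  \<open>\<bar>g\<bar> \<le> 1\<close> keep all angles within [-1, 1], where 1 - cos is bounded
  below by a square, and the squared coordinates sum to 1.\<close>

lemma unit_vector_l1:
  obtains c q :: real where "c > 0" "0 < q" "q < 1"
    "\<And>n x R. \<lbrakk>sph n x; finite R\<rbrakk>
      \<Longrightarrow> \<P>(A in PR R n. l1 R n A x \<le> c * card R) \<le> q ^ card R"
proof -
  interpret sy: prob_space sym by (rule prob_space_sym)
  interpret G: prob_space gauss by (rule prob_space_gauss)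
  obtain b B where b: "0 < b" "b \<le> B" "0 < measure sym {z. b \<le> \<bar>z\<bar> \<and> \<bar>z\<bar> \<le> B}"
    by (rule sym_nondegenerate)
  have B: "B > 0" using b by simp
  define p where "p = measure sym {z. b \<le> \<bar>z\<bar> \<and> \<bar>z\<bar> \<le> B}"
  have p: "0 < p" "p \<le> 1" using b by (auto simp: p_def)
  \<comment> \<open>\<open>p / 2\<close> comes from the smoothing lemma, 18 from
    \<open>one_minus_cos_ge\<close> and \<open>(b / B)\<^sup>2\<close> from the smallest admissible
    \<open>z\<close>.\<close>
  define \<kappa> where "\<kappa> = p * b\<^sup>2 / (36 * B\<^sup>2)"
  have \<kappa>: "\<kappa> > 0" using p b by (simp add: \<kappa>_def)
  let ?f = "\<lambda>g. exp (- \<kappa> * (if \<bar>g\<bar> \<le> 1 then g\<^sup>2 else 0))"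
  have intf: "integrable gauss ?f"
    by (rule integrable_bounded[OF prob_space_gauss, where B=1]) (use \<kappa> in auto)
  define p1 where "p1 = 1 - (\<integral>g. ?f g \<partial>gauss)"
  have "0 \<le> (\<integral>g. ?f g \<partial>gauss)" by (intro integral_nonneg_AE) simp
  then have p1: "0 < p1" "p1 \<le> 1" using integral_exp_bump_gauss[OF \<kappa>] by (auto simp: p1_def)
  \<comment> \<open>Chosen such that the Laplace kernel of width \<open>s\<close> exceeds the
    Gaussian kernel of width \<open>B\<close> by at most \<open>p1 / 2\<close>, half of the
    gain.\<close>
  define s where "s = sqrt (2 * B\<^sup>2 / ln (2 / p1))"
  have ln0: "ln (2 / p1) > 0" using p1 by simp
  have s: "s > 0" using ln0 B by (simp add: s_def)
  have es: "exp (- 2 * B\<^sup>2 / s\<^sup>2) = p1 / 2"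
  proof -
    have "s\<^sup>2 = 2 * B\<^sup>2 / ln (2 / p1)" using ln0 by (simp add: s_def)
    then have "- 2 * B\<^sup>2 / s\<^sup>2 = - ln (2 / p1)" using B ln0 by simp
    then show ?thesis using p1 by (simp add: exp_minus)
  qed
  define q0 where "q0 = 1 - p1 / 2"
  have q0: "0 < q0" "q0 < 1" using p1 by (auto simp: q0_def)
  \<comment> \<open>Half of the exponential gain per row pays for the factor \<open>exp u\<close> of
    the tail estimate.\<close>
  define u where "u = - ln q0 / 2"
  have u: "u > 0" using q0 by (simp add: u_def ln_less_zero)
  have "exp u * q0 = exp (u + ln q0)" using q0 by (simp add: exp_add)
  also have "u + ln q0 = - u" by (simp add: u_def)
  finally have eu: "exp u * q0 = exp (- u)" .
  show ?thesis
  proof (rule that[of "u * s" "exp (- u)"])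
    fix n x and R :: "nat set" assume x: "sph n x" and R: "finite R"
    have x1: "\<bar>x j\<bar> \<le> 1" if "j < n" for j
    proof -
      have "(x j)\<^sup>2 \<le> (\<Sum>j<n. (x j)\<^sup>2)" using that by (intro member_le_sum) auto
      then show ?thesis using x by (simp add: sph_def abs_square_le_1)
    qed
    have row: "(\<integral>A. exp (- (mv n A x i)\<^sup>2 / (2 * B\<^sup>2)) \<partial>PR {i} n) \<le> 1 - p1" for i
    proof (rule smoothing_row)
      fix z assume z: "b \<le> z" "z \<le> B"
      have "(\<integral>g. exp (- (p / 2) * (\<Sum>j<n. 1 - cos (g * x j * z / B))) \<partial>gauss) \<le> (\<integral>g. ?f g \<partial>gauss)"
      proof (rule integral_mono[OF _ intf])
        show "integrable gauss (\<lambda>g. exp (- (p / 2) * (\<Sum>j<n. 1 - cos (g * x j * z / B))))"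
          by (rule integrable_bounded[OF prob_space_gauss, where B=1]) (use p in \<open>auto intro!: mult_nonneg_nonneg sum_nonneg\<close>)
        fix g
        show "exp (- (p / 2) * (\<Sum>j<n. 1 - cos (g * x j * z / B))) \<le> ?f g"
        proof (cases "\<bar>g\<bar> \<le> 1")
          case True
          have "(g * x j * z / B)\<^sup>2 / 18 \<le> 1 - cos (g * x j * z / B)" if "j < n" for j
          proof (rule one_minus_cos_ge)
            have "\<bar>g\<bar> * \<bar>x j\<bar> * z \<le> 1 * 1 * B" using True x1[OF that] z b by (intro mult_mono) auto
            then have "\<bar>g * x j * z / B\<bar> \<le> 1" using z b B by (simp add: abs_mult)
            then show "\<bar>g * x j * z / B\<bar> \<le> pi" using pi_ge_two by linarith
          qed
          then have "(\<Sum>j<n. (g * x j * z / B)\<^sup>2 / 18) \<le> (\<Sum>j<n. 1 - cos (g * x j * z / B))"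
            by (intro sum_mono) auto
          moreover have "(\<Sum>j<n. (g * x j * z / B)\<^sup>2 / 18) = g\<^sup>2 * z\<^sup>2 / (18 * B\<^sup>2) * (\<Sum>j<n. (x j)\<^sup>2)"
            by (simp add: sum_distrib_left sum_divide_distrib power_mult_distrib power_divide mult_ac)
          ultimately have "g\<^sup>2 * z\<^sup>2 / (18 * B\<^sup>2) \<le> (\<Sum>j<n. 1 - cos (g * x j * z / B))"
            using x by (simp add: sph_def)
          moreover have "g\<^sup>2 * b\<^sup>2 / (18 * B\<^sup>2) \<le> g\<^sup>2 * z\<^sup>2 / (18 * B\<^sup>2)"
            using z b by (intro divide_right_mono mult_left_mono power_mono) auto
          ultimately have "p / 2 * (g\<^sup>2 * b\<^sup>2 / (18 * B\<^sup>2)) \<le> p / 2 * (\<Sum>j<n. 1 - cos (g * x j * z / B))"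
            using p by (intro mult_left_mono) auto
          then have "\<kappa> * g\<^sup>2 \<le> p / 2 * (\<Sum>j<n. 1 - cos (g * x j * z / B))"
            by (simp add: \<kappa>_def mult_ac)
          then show ?thesis using True by simp
        next
          case False
          then show ?thesis using p by (auto intro!: mult_nonneg_nonneg sum_nonneg)
        qed
      qed
      then show "(\<integral>g. exp (- (p / 2) * (\<Sum>j<n. 1 - cos (g * x j * z / B))) \<partial>gauss) \<le> 1 - p1"
        by (simp add: p1_def)
    qed (use p B in \<open>auto simp: p_def\<close>)
    have "(\<integral>\<^sup>+A. ennreal (exp (- \<bar>mv n A x i\<bar> / s)) \<partial>PR {i} n) \<le> ennreal q0" for i
    proof -
      interpret Q: prob_space "PR {i} n" by (rule prob_space_P)
      have mm: "(\<lambda>A. mv n A x i) \<in> borel_measurable (PR {i} n)" by (rule measurable_mv) simp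
      have gm: "(\<lambda>y. exp (- y\<^sup>2 / (2 * B\<^sup>2))) \<in> borel_measurable borel" by measurable
      have int: "integrable (PR {i} n) (\<lambda>A. exp (- (mv n A x i)\<^sup>2 / (2 * B\<^sup>2)))"
        by (rule integrable_bounded[OF prob_space_P, where B=1], rule measurable_compose[OF mm gm]) simp
      have le: "exp (- \<bar>y\<bar> / s) \<le> exp (- y\<^sup>2 / (2 * B\<^sup>2)) + p1 / 2" for y
      proof (cases "\<bar>y\<bar> \<le> 2 * B\<^sup>2 / s")
        case True
        then have "\<bar>y\<bar> * \<bar>y\<bar> \<le> (2 * B\<^sup>2 / s) * \<bar>y\<bar>" by (intro mult_right_mono) auto
        then have "y\<^sup>2 / (2 * B\<^sup>2) \<le> \<bar>y\<bar> / s" using B s by (simp add: field_simps power2_eq_square)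
        then have "exp (- \<bar>y\<bar> / s) \<le> exp (- y\<^sup>2 / (2 * B\<^sup>2))" by simp
        then show ?thesis using p1 by linarith
      next
        case False
        then have "2 * B\<^sup>2 / s / s \<le> \<bar>y\<bar> / s" using s by (intro divide_right_mono) auto
        then have "exp (- \<bar>y\<bar> / s) \<le> exp (- 2 * B\<^sup>2 / s\<^sup>2)" by (simp add: power2_eq_square)
        then show ?thesis unfolding es by (rule order_trans) simp
      qed
      have "(\<integral>\<^sup>+A. ennreal (exp (- \<bar>mv n A x i\<bar> / s)) \<partial>PR {i} n) \<le>
        (\<integral>\<^sup>+A. ennreal (exp (- (mv n A x i)\<^sup>2 / (2 * B\<^sup>2)) + p1 / 2) \<partial>PR {i} n)"
        by (intro nn_integral_mono ennreal_leI le)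
      also have "\<dots> = ennreal (\<integral>A. exp (- (mv n A x i)\<^sup>2 / (2 * B\<^sup>2)) + p1 / 2 \<partial>PR {i} n)"
        using int p1 by (intro nn_integral_eq_integral) auto
      also have "(\<integral>A. exp (- (mv n A x i)\<^sup>2 / (2 * B\<^sup>2)) + p1 / 2 \<partial>PR {i} n) \<le> q0"
        using int row[of i] Q.prob_space by (simp add: q0_def)
      finally show ?thesis by (simp add: ennreal_leI)
    qed
    then show "\<P>(A in PR R n. l1 R n A x \<le> u * s * card R) \<le> exp (- u) ^ card R"
      using l1_tail[OF R s, of q0 n x u] q0 eu by simp
  qed (use u s in auto)
qed

end

section \<open>Counting integer points\<close>

text \<open>A geometric sum on each side of zero, at most \<open>r / (1 - r)\<close>; this is at
  most \<open>1 / \<nu>\<close> because \<open>exp \<nu> \<ge> 1 + \<nu>\<close>.\<close>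

lemma sum_exp_abs_int_le:
  fixes \<nu> :: real
  assumes \<nu>: "\<nu> > 0"
  shows "(\<Sum>z\<in>{- int m..int m}. exp (- \<nu> * \<bar>of_int z\<bar>)) \<le> 1 + 2 / \<nu>"
proof -
  define r where "r = exp (- \<nu>)"
  have r: "0 < r" "r < 1" using \<nu> by (auto simp: r_def)
  have "(\<Sum>z\<in>{- int m..int m}. exp (- \<nu> * \<bar>of_int z\<bar>)) = 1 + 2 * (r * (1 - r ^ m) / (1 - r))"
  proof (induction m)
    case 0
    then show ?case by simp
  next
    case (Suc m)
    have e: "{- int (Suc m)..int (Suc m)} = insert (int (Suc m)) (insert (- int (Suc m)) {- int m..int m})" by auto
    have "exp (- \<nu> * \<bar>real_of_int (int (Suc m))\<bar>) = r ^ Suc m"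
      unfolding r_def exp_of_nat_mult[symmetric] by (simp add: algebra_simps)
    then have r': "exp (- \<nu> * (1 + real m)) = r ^ Suc m" by simp
    then have "(\<Sum>z\<in>{- int (Suc m)..int (Suc m)}. exp (- \<nu> * \<bar>of_int z\<bar>)) =
        2 * r ^ Suc m + (\<Sum>z\<in>{- int m..int m}. exp (- \<nu> * \<bar>of_int z\<bar>))"
      unfolding e by (subst sum.insert, simp, simp, subst sum.insert, simp, simp) (simp add: add.commute)
    also have "\<dots> = 1 + 2 * (r * (1 - r ^ Suc m) / (1 - r))"
      unfolding Suc using r by (simp add: field_simps)
    finally show ?case .
  qed
  also have "r * (1 - r ^ m) / (1 - r) \<le> 1 / \<nu>"
  proof -
    have "r * (1 - r ^ m) / (1 - r) \<le> r * 1 / (1 - r)"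
      using r by (intro divide_right_mono mult_left_mono) auto
    also have "\<dots> \<le> 1 / \<nu>"
    proof -
      have "r * (1 + \<nu>) \<le> r * exp \<nu>" using r exp_ge_add_one_self[of \<nu>] by (intro mult_left_mono) auto
      also have "\<dots> = 1" by (simp add: r_def mult_exp_exp)
      finally show ?thesis using r \<nu> by (simp add: field_simps)
    qed
    finally show ?thesis .
  qed
  finally show ?thesis by simp
qed

text \<open>Markov's inequality for the counting measure, with a product weight.\<close>

lemma card_integer_points_le:
  fixes g :: "int \<Rightarrow> real"
  assumes F: "F \<subseteq> (\<Pi>\<^sub>E j\<in>{..<n}. {- m..m})" and g: "\<And>z. 0 \<le> g z" and V: "0 \<le> V"
    and le: "\<And>p. p \<in> F \<Longrightarrow> 1 \<le> V * (\<Prod>j<n. g (p j))" and W: "(\<Sum>z\<in>{- m..m}. g z) \<le> W"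
  shows "finite F" "real (card F) \<le> V * W ^ n"
proof -
  have fin: "finite (\<Pi>\<^sub>E j\<in>{..<n}. {- m..m})" by (intro finite_PiE) auto
  then show "finite F" using F finite_subset by auto
  have "real (card F) = (\<Sum>p\<in>F. 1)" by simp
  also have "\<dots> \<le> (\<Sum>p\<in>F. V * (\<Prod>j<n. g (p j)))" using le by (intro sum_mono) auto
  also have "\<dots> \<le> (\<Sum>p\<in>(\<Pi>\<^sub>E j\<in>{..<n}. {- m..m}). V * (\<Prod>j<n. g (p j)))"
    using F fin g V by (intro sum_mono2) (auto intro!: mult_nonneg_nonneg prod_nonneg)
  also have "\<dots> = V * (\<Prod>j<n. \<Sum>z\<in>{- m..m}. g z)"
    using prod_sum_PiE[of "{..<n}" "\<lambda>_. {- m..m}" "\<lambda>_. g"] by (simp add: sum_distrib_left[symmetric])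
  also have "\<dots> \<le> V * W ^ n" using V W g by (auto intro!: mult_left_mono power_mono sum_nonneg)
  finally show "real (card F) \<le> V * W ^ n" .
qed

text \<open>An l1 constraint is compatible with product weights, and Euclidean bounds imply it by
  Cauchy-Schwarz. Extensionality makes the set finite.\<close>

definition int_points :: "nat \<Rightarrow> real \<Rightarrow> (nat \<Rightarrow> int) set" where
  "int_points n L = {p \<in> extensional {..<n}. (\<Sum>j<n. \<bar>real_of_int (p j)\<bar>) \<le> L}"

lemma int_points_box: "int_points n L \<subseteq> (\<Pi>\<^sub>E j\<in>{..<n}. {- int (nat \<lceil>L\<rceil>)..int (nat \<lceil>L\<rceil>)})"
proof
  fix p assume p: "p \<in> int_points n L"
  have "p j \<in> {- int (nat \<lceil>L\<rceil>)..int (nat \<lceil>L\<rceil>)}" if "j < n" for j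
  proof -
    have "\<bar>real_of_int (p j)\<bar> \<le> (\<Sum>j<n. \<bar>real_of_int (p j)\<bar>)" using that by (intro member_le_sum) auto
    then have "real_of_int \<bar>p j\<bar> \<le> L" using p by (simp add: int_points_def)
    then have "\<bar>p j\<bar> \<le> \<lceil>L\<rceil>" by linarith
    then have "\<bar>p j\<bar> \<le> int (nat \<lceil>L\<rceil>)" by linarith
    then show ?thesis by (simp only: atLeastAtMost_iff) linarith
  qed
  then show "p \<in> (\<Pi>\<^sub>E j\<in>{..<n}. {- int (nat \<lceil>L\<rceil>)..int (nat \<lceil>L\<rceil>)})"
    using p by (auto simp: PiE_iff int_points_def)
qed

text \<open>Points are weighted by \<open>h\<close> per nonzero coordinate and by
  \<open>exp (- \<nu>)\<close> per unit of l1 norm. Those of \<open>F\<close> have weight at least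
  \<open>h powr k * exp (- \<nu> * L)\<close>, while a whole box has at most
  \<open>(1 + 2 * h / \<nu>) ^ n\<close>. A small \<open>h\<close> exploits sparsity;
  \<open>h = 1\<close> ignores it.\<close>

lemma card_int_points_weighted:
  assumes h: "0 < h" "h \<le> 1" and \<nu>: "\<nu> > 0" and F: "F \<subseteq> int_points n L"
    and supp: "\<And>p. p \<in> F \<Longrightarrow> real (card {j. j < n \<and> p j \<noteq> 0}) \<le> k"
  shows "finite F" "real (card F) \<le> h powr (- k) * exp (\<nu> * L) * (1 + 2 * h / \<nu>) ^ n"
proof -
  define m where "m = nat \<lceil>L\<rceil>"
  define g where "g z = (if z = 0 then 1 else h) * exp (- \<nu> * \<bar>of_int z\<bar>)" for z :: int
  have 1: "1 \<le> (h powr (- k) * exp (\<nu> * L)) * (\<Prod>j<n. g (p j))" if p: "p \<in> F" for p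
  proof -
    have pL: "(\<Sum>j<n. \<bar>real_of_int (p j)\<bar>) \<le> L" using p F by (auto simp: int_points_def)
    have "(\<Prod>j<n. g (p j)) = (\<Prod>j<n. if p j = 0 then 1 else h) * (\<Prod>j<n. exp (- \<nu> * \<bar>of_int (p j)\<bar>))"
      by (simp add: g_def prod.distrib)
    also have "(\<Prod>j<n. if p j = 0 then 1 else h) = (\<Prod>j\<in>{j. j < n \<and> p j \<noteq> 0}. h)"
      by (rule prod.mono_neutral_cong_right) auto
    also have "\<dots> = h powr (card {j. j < n \<and> p j \<noteq> 0})" using h by (simp add: powr_realpow)
    also have "(\<Prod>j<n. exp (- \<nu> * \<bar>of_int (p j)\<bar>)) = exp (- \<nu> * (\<Sum>j<n. \<bar>real_of_int (p j)\<bar>))"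
      by (simp add: exp_sum[symmetric] sum_distrib_left)
    finally have eq: "(\<Prod>j<n. g (p j)) = h powr (card {j. j < n \<and> p j \<noteq> 0}) * exp (- \<nu> * (\<Sum>j<n. \<bar>real_of_int (p j)\<bar>))" .
    have "h powr k * exp (- \<nu> * L) \<le> (\<Prod>j<n. g (p j))"
      unfolding eq using h supp[OF p] pL \<nu> by (intro mult_mono powr_mono') auto
    then have "(h powr (- k) * exp (\<nu> * L)) * (h powr k * exp (- \<nu> * L)) \<le> (h powr (- k) * exp (\<nu> * L)) * (\<Prod>j<n. g (p j))"
      by (intro mult_left_mono) auto
    moreover have "(h powr (- k) * exp (\<nu> * L)) * (h powr k * exp (- \<nu> * L)) = 1"
      using h by (simp add: powr_minus exp_minus field_simps)
    ultimately show ?thesis by simp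
  qed
  have 2: "(\<Sum>z\<in>{- int m..int m}. g z) \<le> 1 + 2 * h / \<nu>"
  proof -
    have s: "(\<Sum>z\<in>{- int m..int m}. f z) = f 0 + (\<Sum>z\<in>{- int m..int m} - {0}. f z)" for f :: "int \<Rightarrow> real"
      by (rule sum.remove) auto
    have "(\<Sum>z\<in>{- int m..int m} - {0}. exp (- \<nu> * \<bar>of_int z\<bar>)) \<le> 2 / \<nu>"
      using sum_exp_abs_int_le[OF \<nu>, of m] by (subst (asm) s) simp
    then have "h * (\<Sum>z\<in>{- int m..int m} - {0}. exp (- \<nu> * \<bar>of_int z\<bar>)) \<le> h * (2 / \<nu>)"
      using h by (intro mult_left_mono) auto
    moreover have "(\<Sum>z\<in>{- int m..int m} - {0}. g z) = h * (\<Sum>z\<in>{- int m..int m} - {0}. exp (- \<nu> * \<bar>of_int z\<bar>))"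
      unfolding sum_distrib_left by (intro sum.cong) (auto simp: g_def)
    ultimately show ?thesis by (subst s) (simp add: g_def mult.commute)
  qed
  have sub: "F \<subseteq> (\<Pi>\<^sub>E j\<in>{..<n}. {- int m..int m})" using F int_points_box[of n L] by (auto simp: m_def)
  have g0: "0 \<le> g z" for z using h by (simp add: g_def)
  show "finite F" "real (card F) \<le> h powr (- k) * exp (\<nu> * L) * (1 + 2 * h / \<nu>) ^ n"
    using card_integer_points_le[OF sub g0 _ 1 2] by auto
qed

lemma card_int_points:
  assumes \<nu>: "\<nu> > 0"
  shows "finite (int_points n L)" "real (card (int_points n L)) \<le> exp (\<nu> * L) * (1 + 2 / \<nu>) ^ n"
proof -
  have "real (card {j. j < n \<and> p j \<noteq> 0}) \<le> real n" for p :: "nat \<Rightarrow> int"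
    using card_mono[of "{..<n}" "{j. j < n \<and> p j \<noteq> 0}"] by auto
  from card_int_points_weighted[where h = 1 and k = "real n" and L = L and F = "int_points n L", OF _ _ \<nu> order_refl this]
  show "finite (int_points n L)" "real (card (int_points n L)) \<le> exp (\<nu> * L) * (1 + 2 / \<nu>) ^ n"
    by auto
qed

section \<open>Rounding to integer points and the operator norm\<close>

lemma sum_abs_le_sqrt:
  fixes x :: "nat \<Rightarrow> real"
  shows "(\<Sum>j\<in>J. \<bar>x j\<bar>) \<le> sqrt (card J) * L2_set x J"
proof -
  have "(\<Sum>j\<in>J. \<bar>x j\<bar>) = (\<Sum>j\<in>J. \<bar>1\<bar> * \<bar>x j\<bar>)" by simp
  also have "\<dots> \<le> L2_set (\<lambda>_. 1) J * L2_set x J" by (rule L2_set_mult_ineq)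
  also have "L2_set (\<lambda>_. 1 :: real) J = sqrt (card J)" by (simp add: L2_set_def)
  finally show ?thesis .
qed

text \<open>There is no additive error since arguments below 1/2 round to 0. So the l1 norm of a
  rounded vector is controlled by that of the vector, without a term of order
  \<open>n\<close>.\<close>

lemma abs_round_le: "\<bar>real_of_int (round y)\<bar> \<le> 2 * \<bar>y\<bar>" for y :: real
proof (cases "\<bar>y\<bar> < 1 / 2")
  case True
  then have "round y = 0" by (intro round_unique') auto
  then show ?thesis by simp
next
  case False
  then show ?thesis using of_int_round_abs_le[of y] by linarith
qed

definition round_vec :: "nat \<Rightarrow> (nat \<Rightarrow> real) \<Rightarrow> nat \<Rightarrow> int" where
  "round_vec n v = (\<lambda>j\<in>{..<n}. round (v j))"

lemma round_vec_dist: "L2_set (\<lambda>j. v j - of_int (round_vec n v j)) {..<n} = sqrt (dst2 n v)"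
  by (simp add: L2_set_def dst2_def round_vec_def)

lemma dst2_le: "dst2 n v \<le> real n / 4"
proof -
  have "(y - of_int (round y))\<^sup>2 \<le> 1 / 4" for y :: real
  proof -
    have "\<bar>y - of_int (round y)\<bar> \<le> 1 / 2" using of_int_round_abs_le[of y] by (simp add: abs_minus_commute)
    then have "(y - of_int (round y))\<^sup>2 \<le> (1 / 2)\<^sup>2" by (intro abs_le_square_iff[THEN iffD1]) simp
    then show ?thesis by (simp add: power2_eq_square)
  qed
  then have "dst2 n v \<le> (\<Sum>j<n. 1 / 4)" unfolding dst2_def by (intro sum_mono) auto
  then show ?thesis by simp
qed

lemma round_vec_int_points:
  assumes "sph n x" "\<theta> \<ge> 0" "2 * \<theta> * sqrt n \<le> L"
  shows "round_vec n (\<lambda>j. \<theta> * x j) \<in> int_points n L"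
proof -
  have "(\<Sum>j<n. \<bar>real_of_int (round_vec n (\<lambda>j. \<theta> * x j) j)\<bar>) \<le> (\<Sum>j<n. 2 * \<theta> * \<bar>x j\<bar>)"
    using assms by (intro sum_mono) (auto simp: round_vec_def abs_mult intro: order_trans[OF abs_round_le])
  also have "\<dots> = 2 * \<theta> * (\<Sum>j<n. \<bar>x j\<bar>)" by (simp add: sum_distrib_left)
  also have "\<dots> \<le> 2 * \<theta> * (sqrt n * L2_set x {..<n})"
    using assms sum_abs_le_sqrt[of x "{..<n}"] by (intro mult_left_mono) auto
  also have "L2_set x {..<n} = 1" using assms by (simp add: L2_set_def sph_def)
  finally show ?thesis using assms by (simp add: int_points_def round_vec_def)
qed

text \<open>A crude bound depending on the matrix; it makes the supremum in
  \<open>l1_operator_bound\<close> finite.\<close>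

lemma l1_le_bound:
  assumes "finite R"
  shows "l1 R n A x \<le> (\<Sum>i\<in>R. \<Sum>j<n. \<bar>A (i, j)\<bar>) * L2_set x {..<n}"
proof -
  have "\<bar>mv n A x i\<bar> \<le> (\<Sum>j<n. \<bar>A (i, j)\<bar>) * L2_set x {..<n}" for i
  proof -
    have "\<bar>mv n A x i\<bar> \<le> (\<Sum>j<n. \<bar>A (i, j) * x j\<bar>)" unfolding mv_def by (rule sum_abs)
    also have "\<dots> \<le> (\<Sum>j<n. \<bar>A (i, j)\<bar> * L2_set x {..<n})"
    proof (rule sum_mono)
      fix j assume "j \<in> {..<n}"
      then have "\<bar>x j\<bar> \<le> L2_set x {..<n}"
        using member_le_L2_set[of "{..<n}" j "\<lambda>j. \<bar>x j\<bar>"] by (simp add: L2_set_def)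
      then show "\<bar>A (i, j) * x j\<bar> \<le> \<bar>A (i, j)\<bar> * L2_set x {..<n}"
        unfolding abs_mult by (intro mult_left_mono) auto
    qed
    finally show ?thesis by (simp add: sum_distrib_right)
  qed
  then show ?thesis unfolding l1_def by (simp add: sum_distrib_right sum_mono)
qed

text \<open>Successive approximation: an estimate on the rounded vectors, at distance at most half of the
  norm, propagates to all vectors.\<close>

lemma l1_operator_bound:
  assumes n: "n \<ge> 1" and R: "finite R" and T: "T \<ge> 0"
    and F: "\<And>x. sph n x \<Longrightarrow> l1 R n A (\<lambda>j. of_int (round_vec n (\<lambda>j. sqrt n * x j) j)) \<le> T * sqrt n / 2"
  shows "l1 R n A x \<le> T * L2_set x {..<n}"
proof -
  define S where "S = Sup ((l1 R n A) ` {x. sph n x})"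
  have bdd: "bdd_above ((l1 R n A) ` {x. sph n x})"
  proof (rule bdd_aboveI2)
    fix x assume "x \<in> {x. sph n x}"
    then show "l1 R n A x \<le> (\<Sum>i\<in>R. \<Sum>j<n. \<bar>A (i, j)\<bar>)"
      using l1_le_bound[OF R, of n A x] by (simp add: sph_def L2_set_def)
  qed
  have le: "l1 R n A x \<le> S" if "sph n x" for x
    unfolding S_def using bdd that by (intro cSup_upper) auto
  have ne: "{x. sph n x} \<noteq> {}"
    using n kernel_sph[of "{}" n] by auto
  have S0: "S \<ge> 0" using ne le l1_nonneg[of R n A] order_trans by blast
  have le': "l1 R n A x \<le> S * L2_set x {..<n}" for x
  proof (cases "\<exists>j<n. x j \<noteq> 0")
    case True
    let ?r = "L2_set x {..<n}"
    note p = sph_normalize[OF True]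
    have "l1 R n A (\<lambda>j. inverse ?r * x j) \<le> S" using p le by blast
    then show ?thesis using p(1) by (subst (asm) l1_scale) (simp add: field_simps)
  next
    case False
    then have "l1 R n A x = 0" by (simp add: l1_def mv_def)
    then show ?thesis using S0 by (simp add: L2_set_nonneg)
  qed
  have half: "l1 R n A x \<le> T / 2 + S / 2" if x: "sph n x" for x
  proof -
    define p where "p = round_vec n (\<lambda>j. sqrt n * x j)"
    have sn: "sqrt n > 0" using n by simp
    have "sqrt n * l1 R n A x = l1 R n A (\<lambda>j. sqrt n * x j)" using sn by (simp add: l1_scale)
    also have "(\<lambda>j. sqrt n * x j) = (\<lambda>j. of_int (p j) + (sqrt n * x j - of_int (p j)))" by auto
    also have "l1 R n A \<dots> \<le> l1 R n A (\<lambda>j. of_int (p j)) + l1 R n A (\<lambda>j. sqrt n * x j - of_int (p j))"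
      by (rule l1_triangle)
    also have "\<dots> \<le> T * sqrt n / 2 + S * sqrt (n / 4)"
    proof (intro add_mono)
      show "l1 R n A (\<lambda>j. of_int (p j)) \<le> T * sqrt n / 2" unfolding p_def by (rule F[OF x])
      have "l1 R n A (\<lambda>j. sqrt n * x j - of_int (p j)) \<le> S * L2_set (\<lambda>j. sqrt n * x j - of_int (p j)) {..<n}" by (rule le')
      also have "\<dots> \<le> S * sqrt (n / 4)" unfolding p_def round_vec_dist using S0 dst2_le by (intro mult_left_mono real_sqrt_le_mono) auto
      finally show "l1 R n A (\<lambda>j. sqrt n * x j - of_int (p j)) \<le> S * sqrt (n / 4)" .
    qed
    also have "\<dots> = sqrt n * (T / 2 + S / 2)" by (simp add: real_sqrt_divide algebra_simps)
    finally show ?thesis using sn by simp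
  qed
  \<comment> \<open>The rounding error of \<open>sqrt n * x\<close> has norm at most
    \<open>sqrt n / 2\<close>, whence the term \<open>S / 2\<close>; as \<open>S\<close> is finite,
    it can be absorbed.\<close>
  have "S \<le> T / 2 + S / 2" unfolding S_def using ne half by (intro cSup_least) (auto simp: S_def)
  then have "S \<le> T" by simp
  then show ?thesis using le'[of x] mult_right_mono[of S T "L2_set x {..<n}"] L2_set_nonneg[of x "{..<n}"] by linarith
qed

text \<open>Taylor with an explicit remainder; the linear term is kept because it integrates to zero
  for centred entries.\<close>

lemma exp_le_quadratic: "exp x \<le> 1 + x + x\<^sup>2 * exp \<bar>x\<bar>" for x :: real
proof -
  obtain t where t: "\<bar>t\<bar> \<le> \<bar>x\<bar>" "exp x = (\<Sum>m<2. x ^ m / fact m) + exp t / fact 2 * x ^ 2"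
    using Maclaurin_exp_le[of x 2] by auto
  have "exp t / fact 2 * x ^ 2 \<le> exp \<bar>x\<bar> * x ^ 2"
  proof (rule mult_right_mono)
    have "exp t \<le> exp \<bar>x\<bar>" using t by simp
    then show "exp t / fact 2 \<le> exp \<bar>x\<bar>" using exp_gt_zero[of "\<bar>x\<bar>"] by (simp only: fact_2)
  qed simp
  then show ?thesis using t(2) by (simp add: numeral_2_eq_2 mult.commute)
qed

section \<open>Nets and the operator norm\<close>

context real_law
begin

text \<open>The net is indexed by integer points only: if \<open>\<theta> * x\<close> and
  \<open>\<omega> p * y p\<close> are both close to \<open>p\<close>, they differ by at most
  \<open>2 * r\<close> whatever the multipliers, so these need not be discretised. That both
  multipliers lie between \<open>D\<close> and \<open>2 * D\<close> costs a factor 2 in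
  \<tau>.\<close>

lemma net_bound:
  fixes X :: "(nat \<Rightarrow> real) set" and F :: "(nat \<Rightarrow> int) set" and q :: real
  assumes R: "finite R" and F: "finite F" and D: "0 < D" and \<tau>: "0 \<le> \<tau>" and r: "0 \<le> r" and T: "0 \<le> T"
    and q: "0 \<le> q"
    and close: "\<And>x. x \<in> X \<Longrightarrow> \<exists>\<theta> p. D \<le> \<theta> \<and> \<theta> \<le> 2 * D \<and> p \<in> F \<and>
        L2_set (\<lambda>j. \<theta> * x j - of_int (p j)) {..<n} \<le> r"
    and prob: "\<And>x. x \<in> X \<Longrightarrow>
        \<P>(A in PR R n. l1 R n A x \<le> 2 * \<tau> + 2 * r * T / D) \<le> q"
  shows "typically R n (card F * q) (\<lambda>A. op_bounded R n T A \<longrightarrow> (\<forall>x\<in>X. \<tau> < l1 R n A x))"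
proof -
  interpret Q: prob_space "PR R n" by (rule prob_space_P)
  define ok where "ok p x \<theta> \<longleftrightarrow> x \<in> X \<and> D \<le> \<theta> \<and> \<theta> \<le> 2 * D \<and> L2_set (\<lambda>j. \<theta> * x j - of_int (p j)) {..<n} \<le> r"
    for p :: "nat \<Rightarrow> int" and x \<theta>
  define G where "G = {p \<in> F. \<exists>x \<theta>. ok p x \<theta>}"
  \<comment> \<open>A representative inside \<open>X\<close> is chosen for each integer point that
    approximates something, because the small ball hypothesis is available on \<open>X\<close>
    only.\<close>
  have "\<forall>p\<in>G. \<exists>x \<theta>. ok p x \<theta>" by (auto simp: G_def)
  then obtain y \<omega> where y: "\<And>p. p \<in> G \<Longrightarrow> ok p (y p) (\<omega> p)" by metis
  define E where "E p = {A \<in> space (PR R n). l1 R n A (y p) \<le> 2 * \<tau> + 2 * r * T / D}" for p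
  have E: "E p \<in> sets (PR R n)" for p
    unfolding E_def using measurable_l1[of R R n "y p"] by measurable
  have G: "finite G" "card G \<le> card F" using F by (auto simp: G_def intro: card_mono)
  show ?thesis unfolding typically_def op_bounded_def
  proof (intro bexI[of _ "\<Union>p\<in>G. E p"] conjI ballI impI)
    show "(\<Union>p\<in>G. E p) \<in> sets (PR R n)" using E G by auto
    have "measure (PR R n) (\<Union>p\<in>G. E p) \<le> (\<Sum>p\<in>G. measure (PR R n) (E p))"
      using E G by (intro Q.finite_measure_subadditive_finite) auto
    also have "\<dots> \<le> (\<Sum>p\<in>G. q)"
      using y prob by (intro sum_mono) (auto simp: E_def ok_def)
    also have "\<dots> \<le> card F * q" using G q by (auto intro: mult_right_mono)
    finally show "measure (PR R n) (\<Union>p\<in>G. E p) \<le> card F * q" .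
  next
    fix A x assume A: "A \<in> space (PR R n) - (\<Union>p\<in>G. E p)"
      and op: "\<forall>x. l1 R n A x \<le> T * L2_set x {..<n}" and x: "x \<in> X"
    show "\<tau> < l1 R n A x"
    proof (rule ccontr)
      assume "\<not> \<tau> < l1 R n A x"
      then have le: "l1 R n A x \<le> \<tau>" by simp
      obtain \<theta> p where p: "D \<le> \<theta>" "\<theta> \<le> 2 * D" "p \<in> F" "L2_set (\<lambda>j. \<theta> * x j - of_int (p j)) {..<n} \<le> r"
        using close[OF x] by auto
      then have pG: "p \<in> G" using x by (auto simp: G_def ok_def)
      then have yp: "D \<le> \<omega> p" "\<omega> p \<le> 2 * D" "L2_set (\<lambda>j. \<omega> p * y p j - of_int (p j)) {..<n} \<le> r"
        using y[OF pG] by (auto simp: ok_def)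
      have o: "\<omega> p > 0" using yp D by simp
      define d where "d j = (\<omega> p * y p j - of_int (p j)) + (- 1) * (\<theta> * x j - of_int (p j))" for j
      have "L2_set d {..<n} \<le> L2_set (\<lambda>j. \<omega> p * y p j - of_int (p j)) {..<n} + L2_set (\<lambda>j. (- 1) * (\<theta> * x j - of_int (p j))) {..<n}"
        unfolding d_def by (rule L2_set_triangle_ineq)
      also have "L2_set (\<lambda>j. (- 1) * (\<theta> * x j - of_int (p j))) {..<n} = L2_set (\<lambda>j. \<theta> * x j - of_int (p j)) {..<n}"
        by (simp add: L2_set_def power2_commute)
      finally have d: "L2_set d {..<n} \<le> 2 * r" using yp p by simp
      have "\<omega> p * l1 R n A (y p) = l1 R n A (\<lambda>j. \<omega> p * y p j)" using o by (simp add: l1_scale)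
      also have "(\<lambda>j. \<omega> p * y p j) = (\<lambda>j. \<theta> * x j + d j)" by (auto simp: d_def)
      also have "l1 R n A \<dots> \<le> l1 R n A (\<lambda>j. \<theta> * x j) + l1 R n A d" by (rule l1_triangle)
      also have "\<dots> \<le> \<theta> * \<tau> + T * (2 * r)"
      proof (intro add_mono)
        show "l1 R n A (\<lambda>j. \<theta> * x j) \<le> \<theta> * \<tau>" using p D le by (simp only: l1_scale) (simp add: mult_left_mono)
        show "l1 R n A d \<le> T * (2 * r)" using op d T by (meson mult_left_mono order_trans)
      qed
      also have "\<dots> \<le> \<omega> p * (2 * \<tau>) + T * (2 * r)"
      proof -
        have "\<theta> * \<tau> \<le> (2 * \<omega> p) * \<tau>" using p yp \<tau> by (intro mult_right_mono) auto
        then show ?thesis by simp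
      qed
      finally have "l1 R n A (y p) \<le> 2 * \<tau> + 2 * r * T / \<omega> p" using o by (simp add: field_simps)
      also have "\<dots> \<le> 2 * \<tau> + 2 * r * T / D"
        using yp D r T by (intro add_left_mono divide_left_mono) auto
      finally have "A \<in> E p" using A by (simp add: E_def)
      then show False using A pG by auto
    qed
  qed
qed

end

section \<open>Exponential moments and the norm of the random matrix\<close>

context subgaussian_law
begin

text \<open>Layers of width 1: on each of them the subgaussian tail outweighs
  \<open>exp (2 * \<bar>x\<bar>)\<close> and leaves a geometric series. The factor 2 makes room for
  \<open>x\<^sup>2 * exp \<bar>x\<bar>\<close> in \<open>mgf_bound\<close>.\<close>

lemma exp_moment: "(\<integral>\<^sup>+x. ennreal (exp (2 * \<bar>x\<bar>)) \<partial>M) < \<infinity>"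
proof -
  obtain C v where Cv: "C > 0" "v > 0" "\<And>t. t > 0 \<Longrightarrow> measure M {x. \<bar>x\<bar> > t} \<le> C * exp (- v * t\<^sup>2)"
    using subgaussian unfolding subgaussian_dist_def by auto
  have layers: "(\<integral>\<^sup>+x. a + (\<Sum>k. c k * indicator (S k) x) \<partial>M) = a + (\<Sum>k. c k * emeasure M (S k))"
    if S: "\<And>k. S k \<in> sets M" for a :: ennreal and c :: "nat \<Rightarrow> ennreal" and S
  proof -
    have "(\<integral>\<^sup>+x. a + (\<Sum>k. c k * indicator (S k) x) \<partial>M) = (\<integral>\<^sup>+x. a \<partial>M) + (\<integral>\<^sup>+x. (\<Sum>k. c k * indicator (S k) x) \<partial>M)"
      using S by (intro nn_integral_add) auto
    also have "(\<integral>\<^sup>+x. (\<Sum>k. c k * indicator (S k) x) \<partial>M) = (\<Sum>k. \<integral>\<^sup>+x. c k * indicator (S k) x \<partial>M)"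
      using S by (intro nn_integral_suminf) auto
    finally show ?thesis using S by (simp add: nn_integral_cmult_indicator emeasure_space_1[simplified])
  qed
  \<comment> \<open>Completing the square: \<open>3 * y - v * y\<^sup>2 \<le> 9 / (4 * v)\<close>,
    where one of the three \<open>y\<close> is spent on the geometric decay.\<close>
  define L where "L = exp (2 + 9 / (4 * v)) * C"
  have L: "L \<ge> 0" using Cv by (simp add: L_def)
  have le: "ennreal (exp (2 * \<bar>x\<bar>)) \<le> ennreal (exp 2) +
      (\<Sum>k. ennreal (exp (2 * (real k + 2))) * indicator {x. \<bar>x\<bar> > real k + 1} x)" for x :: real
  proof (cases "\<bar>x\<bar> \<le> 1")
    case True
    then have "ennreal (exp (2 * \<bar>x\<bar>)) \<le> ennreal (exp 2) + 0" by (simp add: ennreal_leI)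
    then show ?thesis by (rule order_trans) (intro add_left_mono, simp)
  next
    case False
    define k where "k = nat (\<lceil>\<bar>x\<bar>\<rceil> - 2)"
    have "\<lceil>\<bar>x\<bar>\<rceil> \<ge> 2" using False by linarith
    then have "real k = of_int \<lceil>\<bar>x\<bar>\<rceil> - 2" by (simp add: k_def)
    then have k: "real k + 1 < \<bar>x\<bar>" "\<bar>x\<bar> \<le> real k + 2" by linarith+
    have "ennreal (exp (2 * \<bar>x\<bar>)) \<le> ennreal (exp (2 * (real k + 2)))"
      using k by (intro ennreal_leI) auto
    also have "\<dots> = (\<lambda>k. ennreal (exp (2 * (real k + 2))) * indicator {x. \<bar>x\<bar> > real k + 1} x) k"
      using k by simp
    also have "\<dots> \<le> (\<Sum>k. ennreal (exp (2 * (real k + 2))) * indicator {x. \<bar>x\<bar> > real k + 1} x)"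
      by (rule term_le_suminf)
    finally show ?thesis by (rule order_trans) simp
  qed
  have "(\<integral>\<^sup>+x. ennreal (exp (2 * \<bar>x\<bar>)) \<partial>M) \<le>
    (\<integral>\<^sup>+x. ennreal (exp 2) + (\<Sum>k. ennreal (exp (2 * (real k + 2))) * indicator {x. \<bar>x\<bar> > real k + 1} x) \<partial>M)"
    by (intro nn_integral_mono le)
  also have "\<dots> = ennreal (exp 2) + (\<Sum>k. ennreal (exp (2 * (real k + 2))) * emeasure M {x. \<bar>x\<bar> > real k + 1})"
    by (rule layers) measurable
  also have "\<dots> \<le> ennreal (exp 2) + (\<Sum>k. ennreal (L * exp (- 1) ^ k))"
  proof (intro add_left_mono suminf_le allI)
    fix k
    define y where "y = real k + 1"
    have "emeasure M {x. \<bar>x\<bar> > y} \<le> ennreal (C * exp (- v * y\<^sup>2))"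
      unfolding emeasure_eq_measure by (intro ennreal_leI Cv) (simp add: y_def)
    then have "ennreal (exp (2 * (y + 1))) * emeasure M {x. \<bar>x\<bar> > y} \<le> ennreal (exp (2 * (y + 1))) * ennreal (C * exp (- v * y\<^sup>2))"
      by (intro mult_left_mono) auto
    also have "\<dots> = ennreal (exp (2 * (y + 1) - v * y\<^sup>2) * C)"
      using Cv by (simp add: ennreal_mult[symmetric] exp_diff exp_minus field_simps)
    also have "\<dots> \<le> ennreal (exp (2 + 9 / (4 * v) - y) * C)"
    proof -
      have "0 \<le> (v * y - 3 / 2)\<^sup>2 / v" using Cv by simp
      also have "(v * y - 3 / 2)\<^sup>2 / v = v * y\<^sup>2 - 3 * y + 9 / (4 * v)"
        using Cv by (simp add: power2_eq_square field_simps)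
      finally show ?thesis using Cv by (intro ennreal_leI mult_right_mono) auto
    qed
    also have "\<dots> \<le> ennreal (L * exp (- 1) ^ k)"
    proof (rule ennreal_leI)
      have "exp (2 + 9 / (4 * v) - y) \<le> exp (2 + 9 / (4 * v)) * exp (- real k)"
        by (simp add: mult_exp_exp y_def)
      also have "exp (- real k) = exp (- 1) ^ k" by (simp add: exp_of_nat_mult[symmetric])
      finally have "exp (2 + 9 / (4 * v) - y) * C \<le> (exp (2 + 9 / (4 * v)) * exp (- 1) ^ k) * C"
        using Cv by (intro mult_right_mono) auto
      then show "exp (2 + 9 / (4 * v) - y) * C \<le> L * exp (- 1) ^ k" by (simp add: L_def mult_ac)
    qed
    finally show "ennreal (exp (2 * (real k + 2))) * emeasure M {x. \<bar>x\<bar> > real k + 1} \<le> ennreal (L * exp (- 1) ^ k)"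
      by (simp add: y_def add.assoc)
  qed auto
  also have "(\<Sum>k. ennreal (L * exp (- 1) ^ k)) = ennreal (L * (1 / (1 - exp (- 1))))"
    using L by (intro suminf_ennreal_eq sums_mult geometric_sums) auto
  also have "ennreal (exp 2) + \<dots> < \<infinity>" by simp
  finally show ?thesis .
qed

text \<open>Bounds the second order term of the moment generating function, see
  \<open>mgf_bound\<close>.\<close>

definition \<kappa> :: real where "\<kappa> = (\<integral>x. x\<^sup>2 * exp \<bar>x\<bar> \<partial>M)"

lemma \<kappa>_nonneg: "\<kappa> \<ge> 0"
  unfolding \<kappa>_def by (intro integral_nonneg_AE) simp

lemma integrable_exp2: "integrable M (\<lambda>x. exp (2 * \<bar>x\<bar>))"
  using exp_moment by (intro integrableI_bounded) auto

text \<open>Centring removes the linear term, and \<open>\<bar>w\<bar> \<le> 1\<close> bounds the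
  remainder by \<open>w\<^sup>2\<close> times the integrable
  \<open>x\<^sup>2 * exp \<bar>x\<bar>\<close>.\<close>

lemma mgf_bound:
  assumes w: "\<bar>w\<bar> \<le> 1"
  shows "(\<integral>\<^sup>+x. ennreal (exp (w * x)) \<partial>M) \<le> ennreal (exp (\<kappa> * w\<^sup>2))"
proof -
  have sq: "x\<^sup>2 * exp \<bar>x\<bar> \<le> 2 * exp (2 * \<bar>x\<bar>)" for x :: real
  proof -
    have "1 + \<bar>x\<bar> + \<bar>x\<bar>\<^sup>2 / 2 \<le> exp \<bar>x\<bar>" by (rule exp_lower_Taylor_quadratic) simp
    then have "x\<^sup>2 \<le> 2 * exp \<bar>x\<bar>" by simp
    then have "x\<^sup>2 * exp \<bar>x\<bar> \<le> 2 * exp \<bar>x\<bar> * exp \<bar>x\<bar>" by (intro mult_right_mono) auto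
    then show ?thesis by (simp add: mult_exp_exp mult.assoc)
  qed
  have i2: "integrable M (\<lambda>x. x\<^sup>2 * exp \<bar>x\<bar>)"
    by (rule Bochner_Integration.integrable_bound[OF integrable_mult_right[OF integrable_exp2, of 2]])
       (auto simp: sq)
  have i1: "integrable M (\<lambda>x. exp (w * x))"
  proof (rule Bochner_Integration.integrable_bound[OF integrable_exp2])
    show "AE x in M. norm (exp (w * x)) \<le> norm (exp (2 * \<bar>x\<bar>))"
    proof (rule AE_I2)
      fix x
      have "w * x \<le> \<bar>w\<bar> * \<bar>x\<bar>" by (simp add: abs_mult[symmetric])
      also have "\<dots> \<le> 2 * \<bar>x\<bar>" using w by (intro mult_right_mono) auto
      finally show "norm (exp (w * x)) \<le> norm (exp (2 * \<bar>x\<bar>))" by simp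
    qed
  qed measurable
  have "(\<integral>\<^sup>+x. ennreal (exp (w * x)) \<partial>M) = ennreal (\<integral>x. exp (w * x) \<partial>M)"
    by (rule nn_integral_eq_integral[OF i1]) simp
  also have "(\<integral>x. exp (w * x) \<partial>M) \<le> (\<integral>x. 1 + w * x + w\<^sup>2 * (x\<^sup>2 * exp \<bar>x\<bar>) \<partial>M)"
  proof (rule integral_mono[OF i1])
    show "integrable M (\<lambda>x. 1 + w * x + w\<^sup>2 * (x\<^sup>2 * exp \<bar>x\<bar>))"
      using i2 mean by (intro Bochner_Integration.integrable_add integrable_mult_right) auto
    fix x
    have "exp (w * x) \<le> 1 + w * x + (w * x)\<^sup>2 * exp \<bar>w * x\<bar>" by (rule exp_le_quadratic)
    also have "(w * x)\<^sup>2 * exp \<bar>w * x\<bar> \<le> (w * x)\<^sup>2 * exp \<bar>x\<bar>"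
    proof -
      have "\<bar>w * x\<bar> \<le> 1 * \<bar>x\<bar>" unfolding abs_mult using w by (intro mult_right_mono) auto
      then show ?thesis by (intro mult_left_mono) auto
    qed
    finally show "exp (w * x) \<le> 1 + w * x + w\<^sup>2 * (x\<^sup>2 * exp \<bar>x\<bar>)" by (simp add: power_mult_distrib mult_ac)
  qed
  also have "\<dots> = 1 + \<kappa> * w\<^sup>2"
    using i2 mean prob_space by (simp add: \<kappa>_def)
  also have "\<dots> \<le> exp (\<kappa> * w\<^sup>2)" using exp_ge_add_one_self[of "\<kappa> * w\<^sup>2"] by simp
  finally show ?thesis by (simp add: ennreal_leI)
qed

lemma row_mgf:
  assumes w: "\<And>j. j < n \<Longrightarrow> \<bar>l * x j\<bar> \<le> 1"
  shows "(\<integral>\<^sup>+A. ennreal (exp (l * mv n A x i)) \<partial>PR {i} n) \<le> ennreal (exp (\<kappa> * (l\<^sup>2 * (\<Sum>j<n. (x j)\<^sup>2))))"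
proof -
  interpret pp: product_prob_space "\<lambda>_. M" "UNIV :: (nat \<times> nat) set" by (rule product_P)
  let ?K = "{i} \<times> {..<n}"
  have "(\<integral>\<^sup>+A. ennreal (exp (l * mv n A x i)) \<partial>P ?K) = (\<integral>\<^sup>+A. (\<Prod>k\<in>?K. ennreal (exp (l * x (snd k) * A k))) \<partial>P ?K)"
  proof (rule nn_integral_cong)
    fix A
    have "exp (l * mv n A x i) = (\<Prod>k\<in>?K. exp (l * x (snd k) * A k))"
      by (subst exp_sum[symmetric]) (auto simp: mv_row sum_distrib_left mult_ac)
    then show "ennreal (exp (l * mv n A x i)) = (\<Prod>k\<in>?K. ennreal (exp (l * x (snd k) * A k)))"
      by (simp add: prod_ennreal)
  qed
  also have "\<dots> = (\<Prod>k\<in>?K. \<integral>\<^sup>+y. ennreal (exp (l * x (snd k) * y)) \<partial>M)"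
    by (rule pp.product_nn_integral_prod) auto
  also have "\<dots> \<le> (\<Prod>k\<in>?K. ennreal (exp (\<kappa> * (l * x (snd k))\<^sup>2)))"
    by (intro prod_mono_ennreal mgf_bound) (use w in auto)
  also have "\<dots> = ennreal (exp (\<Sum>k\<in>?K. \<kappa> * (l * x (snd k))\<^sup>2))"
    by (simp add: prod_ennreal exp_sum)
  also have "(\<Sum>k\<in>?K. \<kappa> * (l * x (snd k))\<^sup>2) = (\<Sum>i\<in>{i}. \<Sum>j<n. \<kappa> * (l * x j)\<^sup>2)"
    by (subst sum.cartesian_product) (simp add: case_prod_beta)
  also have "\<dots> = \<kappa> * (l\<^sup>2 * (\<Sum>j<n. (x j)\<^sup>2))"
    by (simp add: sum_distrib_left power_mult_distrib)
  finally show ?thesis .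
qed

text \<open>Since \<open>exp (l * \<bar>y\<bar>) \<le> exp (l * y) + exp (- l * y)\<close>, each row
  costs a factor \<open>2 * exp \<kappa>\<close> in the exponential Markov inequality.\<close>

lemma l1_upper_tail:
  assumes R: "finite R" and l: "l > 0" and w: "\<And>j. j < n \<Longrightarrow> \<bar>l * x j\<bar> \<le> 1" and x: "l\<^sup>2 * (\<Sum>j<n. (x j)\<^sup>2) \<le> 1"
  shows "\<P>(A in PR R n. u < l1 R n A x) \<le> exp (- l * u) * (2 * exp \<kappa>) ^ card R"
proof -
  interpret p: prob_space "PR R n" by (rule prob_space_P)
  let ?E = "{A \<in> space (PR R n). u < l1 R n A x}"
  have E: "?E \<in> sets (PR R n)" using measurable_l1[of R R n x] by measurable
  have row: "(\<integral>\<^sup>+A. ennreal (exp (l * \<bar>mv n A x i\<bar>)) \<partial>PR {i} n) \<le> ennreal (2 * exp \<kappa>)" for i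
  proof -
    have m: "(\<lambda>A. mv n A x i) \<in> borel_measurable (PR {i} n)" by (rule measurable_mv) simp
    have g: "(\<lambda>y. ennreal (exp (c * y))) \<in> borel_measurable borel" for c :: real by measurable
    have half: "(\<integral>\<^sup>+A. ennreal (exp (c * mv n A x i)) \<partial>PR {i} n) \<le> ennreal (exp \<kappa>)" if "c = l \<or> c = - l" for c
    proof -
      have "\<kappa> * (c\<^sup>2 * (\<Sum>j<n. (x j)\<^sup>2)) \<le> \<kappa> * 1" using that x \<kappa>_nonneg by (intro mult_left_mono) auto
      then have "ennreal (exp (\<kappa> * (c\<^sup>2 * (\<Sum>j<n. (x j)\<^sup>2)))) \<le> ennreal (exp \<kappa>)" by (intro ennreal_leI) simp
      moreover have "\<bar>c * x j\<bar> \<le> 1" if "j < n" for j using w[OF that] \<open>c = l \<or> c = - l\<close> by auto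
      ultimately show ?thesis using row_mgf[of n c x i] order_trans by blast
    qed
    have "(\<integral>\<^sup>+A. ennreal (exp (l * \<bar>mv n A x i\<bar>)) \<partial>PR {i} n) \<le>
      (\<integral>\<^sup>+A. ennreal (exp (l * mv n A x i)) + ennreal (exp (- l * mv n A x i)) \<partial>PR {i} n)"
    proof (rule nn_integral_mono)
      fix A
      have "exp (l * \<bar>mv n A x i\<bar>) \<le> exp (l * mv n A x i) + exp (- l * mv n A x i)"
        by (cases "mv n A x i \<ge> 0") auto
      then show "ennreal (exp (l * \<bar>mv n A x i\<bar>)) \<le> ennreal (exp (l * mv n A x i)) + ennreal (exp (- l * mv n A x i))"
        by (simp add: ennreal_plus[symmetric] ennreal_leI del: ennreal_plus)
    qed
    also have "\<dots> = (\<integral>\<^sup>+A. ennreal (exp (l * mv n A x i)) \<partial>PR {i} n) + (\<integral>\<^sup>+A. ennreal (exp (- l * mv n A x i)) \<partial>PR {i} n)"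
      by (intro nn_integral_add measurable_compose[OF m g])
    also have "\<dots> \<le> ennreal (exp \<kappa>) + ennreal (exp \<kappa>)" by (intro add_mono half) auto
    also have "\<dots> = ennreal (2 * exp \<kappa>)" by (simp add: ennreal_plus[symmetric] del: ennreal_plus)
    finally show ?thesis .
  qed
  have g: "(\<lambda>y. ennreal (exp (l * \<bar>y\<bar>))) \<in> borel_measurable borel" by measurable
  have "ennreal (measure (PR R n) ?E) = (\<integral>\<^sup>+A. indicator ?E A \<partial>PR R n)"
    by (simp only: nn_integral_indicator[OF E] p.emeasure_eq_measure)
  also have "\<dots> \<le> (\<integral>\<^sup>+A. ennreal (exp (- l * u)) * (\<Prod>i\<in>R. ennreal (exp (l * \<bar>mv n A x i\<bar>))) \<partial>PR R n)"
  proof (rule nn_integral_mono)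
    fix A
    have "(\<Prod>i\<in>R. exp (l * \<bar>mv n A x i\<bar>)) = exp (l * l1 R n A x)"
      by (subst exp_sum[symmetric, OF R]) (simp add: l1_def sum_distrib_left)
    then have eq: "exp (- l * u) * (\<Prod>i\<in>R. exp (l * \<bar>mv n A x i\<bar>)) = exp (l * (l1 R n A x - u))"
      by (simp add: mult_exp_exp algebra_simps)
    have "1 \<le> exp (- l * u) * (\<Prod>i\<in>R. exp (l * \<bar>mv n A x i\<bar>))" if "A \<in> ?E"
      unfolding eq using that l by simp
    then have "ennreal 1 \<le> ennreal (exp (- l * u) * (\<Prod>i\<in>R. exp (l * \<bar>mv n A x i\<bar>)))" if "A \<in> ?E"
      using that by (intro ennreal_leI) auto
    then show "indicator ?E A \<le> ennreal (exp (- l * u)) * (\<Prod>i\<in>R. ennreal (exp (l * \<bar>mv n A x i\<bar>)))"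
      by (auto simp: indicator_def ennreal_mult prod_ennreal prod_nonneg)
  qed
  also have "\<dots> = ennreal (exp (- l * u)) * (\<integral>\<^sup>+A. (\<Prod>i\<in>R. ennreal (exp (l * \<bar>mv n A x i\<bar>))) \<partial>PR R n)"
    by (intro nn_integral_cmult borel_measurable_prod_ennreal measurable_compose[OF measurable_mv g])
  also have "\<dots> = ennreal (exp (- l * u)) * (\<Prod>i\<in>R. \<integral>\<^sup>+A. ennreal (exp (l * \<bar>mv n A x i\<bar>)) \<partial>PR {i} n)"
    by (subst nn_integral_rows[OF R g]) simp
  also have "\<dots> \<le> ennreal (exp (- l * u)) * (\<Prod>i\<in>R. ennreal (2 * exp \<kappa>))"
    by (intro mult_left_mono prod_mono_ennreal row) auto
  also have "\<dots> = ennreal (exp (- l * u) * (2 * exp \<kappa>) ^ card R)"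
    by (simp add: ennreal_power ennreal_mult[symmetric])
  finally show ?thesis by (subst (asm) ennreal_le_iff) auto
qed

lemma norm_event:
  obtains K :: real where "K \<ge> 1"
    "\<And>n R. \<lbrakk>n \<ge> 1; finite R; card R \<le> 2 * n\<rbrakk> \<Longrightarrow> typically R n (exp (- real n)) (op_bounded R n (K * n))"
proof -
  \<comment> \<open>With \<open>l = 1 / (2 * sqrt n)\<close> the exponent
    \<open>l * (K * n * sqrt n / 2)\<close> is \<open>(7 + 2 * \<kappa>) * n\<close>. The rows cost
    at most \<open>2 * (1 + \<kappa>) * n\<close>, the net \<open>4 * n\<close>, and
    \<open>n\<close> remains.\<close>
  define K where "K = 4 * (7 + 2 * \<kappa>)"
  have "K \<ge> 1" using \<kappa>_nonneg by (simp add: K_def)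
  moreover have "typically R n (exp (- real n)) (op_bounded R n (K * n))"
    if n: "n \<ge> 1" and R: "finite R" "card R \<le> 2 * n" for n and R :: "nat set"
  proof -
    interpret Q: prob_space "PR R n" by (rule prob_space_P)
    \<comment> \<open>The Euclidean constraint holds for the rounded vectors, as rounding at most
      doubles coordinates, and it bounds the moment generating functions.\<close>
    define F where "F = {p \<in> int_points n (2 * n). (\<Sum>j<n. (real_of_int (p j))\<^sup>2) \<le> 4 * n}"
    define E where "E p = {A \<in> space (PR R n). K * n * sqrt n / 2 < l1 R n A (\<lambda>j. of_int (p j))}" for p :: "nat \<Rightarrow> int"
    have E: "E p \<in> sets (PR R n)" for p
      unfolding E_def using measurable_l1[of R R n "\<lambda>j. of_int (p j)"] by measurable
    have fin: "finite F" and "card F \<le> card (int_points n (2 * n))"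
      using card_int_points(1)[of 1 n "2 * n"] by (auto simp: F_def intro: card_mono)
    then have "real (card F) \<le> exp (1 * (2 * n)) * (1 + 2 / 1) ^ n"
      using card_int_points(2)[of 1 n "2 * n"] by simp
    also have "\<dots> \<le> exp (2 * n) * exp 2 ^ n"
      using exp_ge_add_one_self[of 2] by (intro mult_mono power_mono) auto
    also have "\<dots> = exp (4 * real n)" by (simp add: exp_of_nat_mult[symmetric] mult_exp_exp)
    finally have cardF: "real (card F) \<le> exp (4 * real n)" .
    have prob: "measure (PR R n) (E p) \<le> exp (- 5 * real n)" if "p \<in> F" for p
    proof -
      have sp: "(\<Sum>j<n. (real_of_int (p j))\<^sup>2) \<le> 4 * n" using that by (simp add: F_def)
      define l where "l = 1 / (2 * sqrt n)"
      have l: "l > 0" "l\<^sup>2 = 1 / (4 * n)" using n by (auto simp: l_def power_divide power_mult_distrib)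
      have sx: "l\<^sup>2 * (\<Sum>j<n. (real_of_int (p j))\<^sup>2) \<le> 1" using sp n by (simp add: l field_simps)
      have w: "\<bar>l * real_of_int (p j)\<bar> \<le> 1" if "j < n" for j
      proof -
        have "(real_of_int (p j))\<^sup>2 \<le> (\<Sum>j<n. (real_of_int (p j))\<^sup>2)" using that by (intro member_le_sum) auto
        then have "(l * real_of_int (p j))\<^sup>2 \<le> 1" using sx mult_left_mono[of "(real_of_int (p j))\<^sup>2" _ "l\<^sup>2"]
          by (simp add: power_mult_distrib) (meson order_trans zero_le_power2)
        then show ?thesis by (simp add: abs_square_le_1)
      qed
      have "measure (PR R n) (E p) \<le> exp (- l * (K * n * sqrt n / 2)) * (2 * exp \<kappa>) ^ card R"
        unfolding E_def by (rule l1_upper_tail[OF R(1) l(1) w sx])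
      also have "- l * (K * n * sqrt n / 2) = - (7 + 2 * \<kappa>) * n" using n by (simp add: l_def K_def field_simps)
      also have "(2 * exp \<kappa>) ^ card R \<le> (2 * exp \<kappa>) ^ (2 * n)"
        using R \<kappa>_nonneg one_le_exp_iff[of \<kappa>] by (intro power_increasing) (auto simp del: one_le_exp_iff)
      also have "\<dots> \<le> (exp (1 + \<kappa>)) ^ (2 * n)"
        using exp_ge_add_one_self[of 1] by (intro power_mono) (auto simp: exp_add)
      also have "\<dots> = exp (2 * (1 + \<kappa>) * n)" by (simp add: exp_of_nat_mult[symmetric] mult_ac)
      finally show ?thesis by (simp add: mult_exp_exp algebra_simps)
    qed
    show ?thesis unfolding typically_def op_bounded_def
    proof (intro bexI[of _ "\<Union>p\<in>F. E p"] conjI ballI allI)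
      show "(\<Union>p\<in>F. E p) \<in> sets (PR R n)" using E fin by auto
      have "measure (PR R n) (\<Union>p\<in>F. E p) \<le> (\<Sum>p\<in>F. measure (PR R n) (E p))"
        using E fin by (intro Q.finite_measure_subadditive_finite) auto
      also have "\<dots> \<le> (\<Sum>p\<in>F. exp (- 5 * real n))" using prob by (intro sum_mono) auto
      also have "\<dots> \<le> exp (4 * real n) * exp (- 5 * real n)" using cardF by (simp add: mult_right_mono)
      also have "\<dots> = exp (- real n)" by (simp add: mult_exp_exp)
      finally show "measure (PR R n) (\<Union>p\<in>F. E p) \<le> exp (- real n)" .
    next
      fix A x assume A: "A \<in> space (PR R n) - (\<Union>p\<in>F. E p)"
      show "l1 R n A x \<le> K * n * L2_set x {..<n}"
      proof (rule l1_operator_bound[OF n R(1)])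
        show "0 \<le> K * n" using \<open>K \<ge> 1\<close> by simp
        fix y assume y: "sph n y"
        define p where "p = round_vec n (\<lambda>j. sqrt n * y j)"
        have "(\<Sum>j<n. (real_of_int (p j))\<^sup>2) \<le> (\<Sum>j<n. (2 * (sqrt n * y j))\<^sup>2)"
        proof (intro sum_mono)
          fix j assume "j \<in> {..<n}"
          then show "(real_of_int (p j))\<^sup>2 \<le> (2 * (sqrt n * y j))\<^sup>2"
            using abs_round_le[of "sqrt n * y j"]
            by (intro abs_le_square_iff[THEN iffD1]) (simp add: p_def round_vec_def abs_mult)
        qed
        also have "\<dots> = 4 * n * (\<Sum>j<n. (y j)\<^sup>2)" by (simp add: power_mult_distrib sum_distrib_left mult.assoc)
        finally have "(\<Sum>j<n. (real_of_int (p j))\<^sup>2) \<le> 4 * n" using y by (simp add: sph_def)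
        moreover have "p \<in> int_points n (2 * n)" unfolding p_def
          by (rule round_vec_int_points[OF y]) auto
        ultimately have "p \<in> F" by (simp add: F_def)
        then show "l1 R n A (\<lambda>j. of_int (round_vec n (\<lambda>j. sqrt n * y j) j)) \<le> K * n * sqrt n / 2"
          using A by (auto simp: E_def p_def not_less)
      qed
    qed
  qed
  ultimately show ?thesis by (rule that)
qed

end

section \<open>Compressible vectors and level sets\<close>

text \<open>A quantitative form of incompressibility. A unit vector has at most
  \<open>\<delta> * n\<close> coordinates above the threshold, so a unit vector that is not spread
  lies within \<rho> of a sparse one.\<close>

definition spread :: "nat \<Rightarrow> real \<Rightarrow> real \<Rightarrow> (nat \<Rightarrow> real) \<Rightarrow> bool" where
  "spread n \<delta> \<rho> x \<longleftrightarrow> \<rho>\<^sup>2 \<le> (\<Sum>j | j < n \<and> \<bar>x j\<bar> \<le> 1 / sqrt (\<delta> * n). (x j)\<^sup>2)"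

lemma lcd_ge_mono: "lcd_ge n \<gamma> \<mu> D x \<Longrightarrow> D' \<le> D \<Longrightarrow> lcd_ge n \<gamma> \<mu> D' x"
  by (auto simp: lcd_ge_def)

text \<open>For these \<theta> the small coordinates of \<open>\<theta> * x\<close> are at most 1/2,
  so zero is a nearest integer and their whole mass counts in the distance. This is the initial
  lower bound for the least common denominator.\<close>

lemma spread_lcd_ge:
  assumes x: "spread n \<delta> \<rho> x" and pos: "\<delta> > 0" "n \<ge> 1"
  shows "lcd_ge n \<rho> \<mu> (sqrt (\<delta> * n) / 2) x"
  unfolding lcd_ge_def
proof (intro allI impI)
  fix \<theta> :: real assume \<theta>: "0 < \<theta>" "\<theta> \<le> sqrt (\<delta> * n) / 2"
  define J where "J = {j. j < n \<and> \<bar>x j\<bar> \<le> 1 / sqrt (\<delta> * n)}"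
  have s: "sqrt (\<delta> * n) > 0" using pos by simp
  have "\<rho>\<^sup>2 * \<theta>\<^sup>2 \<le> (\<Sum>j\<in>J. (x j)\<^sup>2) * \<theta>\<^sup>2"
    using x by (intro mult_right_mono) (auto simp: spread_def J_def)
  also have "\<dots> = (\<Sum>j\<in>J. (\<theta> * x j)\<^sup>2)" by (simp only: power_mult_distrib sum_distrib_left[symmetric]) (simp add: mult.commute)
  also have "\<dots> \<le> (\<Sum>j\<in>J. (\<theta> * x j - of_int (round (\<theta> * x j)))\<^sup>2)"
  proof (rule sum_mono)
    fix j assume j: "j \<in> J"
    have "\<bar>\<theta> * x j\<bar> \<le> (sqrt (\<delta> * n) / 2) * (1 / sqrt (\<delta> * n))"
      unfolding abs_mult using j \<theta> s by (intro mult_mono) (auto simp: J_def)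
    then have y: "\<bar>\<theta> * x j\<bar> \<le> 1 / 2" using s pos by simp
    have "\<bar>\<theta> * x j\<bar> \<le> \<bar>\<theta> * x j - of_int (round (\<theta> * x j))\<bar>"
    proof (cases "round (\<theta> * x j) = 0")
      case False
      then have "1 \<le> \<bar>round (\<theta> * x j)\<bar>" by linarith
      then have "1 \<le> \<bar>real_of_int (round (\<theta> * x j))\<bar>" by linarith
      then show ?thesis using y by linarith
    qed simp
    then show "(\<theta> * x j)\<^sup>2 \<le> (\<theta> * x j - of_int (round (\<theta> * x j)))\<^sup>2" by (simp only: abs_le_square_iff)
  qed
  also have "\<dots> \<le> dst2 n (\<lambda>j. \<theta> * x j)" unfolding dst2_def by (intro sum_mono2) (auto simp: J_def)
  finally show "min (\<rho>\<^sup>2 * \<theta>\<^sup>2) (\<mu>\<^sup>2 * real n) \<le> dst2 n (\<lambda>j. \<theta> * x j)" by linarith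
qed

lemma compressible_round:
  assumes x: "sph n x" "\<not> spread n \<delta> \<rho> x" and pos: "\<delta> > 0" "\<rho> > 0" "n \<ge> 1"
  obtains p where "p \<in> int_points n (2 * sqrt \<delta> / \<rho> * n)" "real (card {j. j < n \<and> p j \<noteq> 0}) \<le> \<delta> * n"
    "L2_set (\<lambda>j. sqrt n / \<rho> * x j - of_int (p j)) {..<n} \<le> 2 * sqrt n"
proof -
  define J where "J = {j. j < n \<and> \<bar>x j\<bar> \<le> 1 / sqrt (\<delta> * n)}"
  define J' where "J' = {..<n} - J"
  \<comment> \<open>At this scale the discarded small coordinates, of norm below \<rho>, contribute
    at most \<open>sqrt n\<close>, the order of the rounding error of the others.\<close>
  define \<theta> where "\<theta> = sqrt n / \<rho>"
  have \<theta>: "\<theta> > 0" using pos by (simp add: \<theta>_def)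
  define p where "p = (\<lambda>j\<in>{..<n}. if j \<in> J then 0 else round (\<theta> * x j))"
  have J: "J \<subseteq> {..<n}" "finite J" "finite J'" by (auto simp: J_def J'_def)
  have s: "sqrt (\<delta> * n) > 0" using pos by simp
  have cardJ': "real (card J') \<le> \<delta> * n"
  proof -
    have "real (card J') / (\<delta> * n) = (\<Sum>j\<in>J'. 1 / (\<delta> * n))" by simp
    also have "\<dots> \<le> (\<Sum>j\<in>J'. (x j)\<^sup>2)"
    proof (rule sum_mono)
      fix j assume "j \<in> J'"
      then have "1 / sqrt (\<delta> * n) \<le> \<bar>x j\<bar>" by (auto simp: J'_def J_def)
      then have "(1 / sqrt (\<delta> * n))\<^sup>2 \<le> \<bar>x j\<bar>\<^sup>2" using s by (intro power_mono) auto
      then show "1 / (\<delta> * n) \<le> (x j)\<^sup>2" using pos by (simp add: power_divide)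
    qed
    also have "\<dots> \<le> (\<Sum>j<n. (x j)\<^sup>2)" by (intro sum_mono2) (auto simp: J'_def)
    finally show ?thesis using x pos by (simp add: sph_def field_simps)
  qed
  have supp: "{j. j < n \<and> p j \<noteq> 0} \<subseteq> J'" by (auto simp: p_def J'_def)
  have "real (card {j. j < n \<and> p j \<noteq> 0}) \<le> real (card J')" using card_mono[OF J(3) supp] by simp
  then have 2: "real (card {j. j < n \<and> p j \<noteq> 0}) \<le> \<delta> * n" using cardJ' by linarith
  have "(\<Sum>j<n. \<bar>real_of_int (p j)\<bar>) = (\<Sum>j\<in>J'. \<bar>real_of_int (p j)\<bar>)"
    by (rule sum.mono_neutral_right) (use supp in \<open>auto simp: J'_def\<close>)
  also have "\<dots> \<le> (\<Sum>j\<in>J'. 2 * \<theta> * \<bar>x j\<bar>)"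
  proof (rule sum_mono)
    fix j assume "j \<in> J'"
    then show "\<bar>real_of_int (p j)\<bar> \<le> 2 * \<theta> * \<bar>x j\<bar>"
      using abs_round_le[of "\<theta> * x j"] \<theta> by (simp add: p_def J'_def abs_mult)
  qed
  also have "\<dots> = 2 * \<theta> * (\<Sum>j\<in>J'. \<bar>x j\<bar>)" by (simp add: sum_distrib_left)
  also have "\<dots> \<le> 2 * \<theta> * (sqrt (\<delta> * n) * 1)"
  proof (intro mult_left_mono)
    have "L2_set x J' \<le> L2_set x {..<n}" unfolding L2_set_def
      by (intro real_sqrt_le_mono sum_mono2) (auto simp: J'_def)
    also have "\<dots> = 1" using x by (simp add: L2_set_def sph_def)
    finally have "sqrt (card J') * L2_set x J' \<le> sqrt (\<delta> * n) * 1"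
      using cardJ' by (intro mult_mono real_sqrt_le_mono) (auto simp: L2_set_nonneg)
    then show "(\<Sum>j\<in>J'. \<bar>x j\<bar>) \<le> sqrt (\<delta> * n) * 1" using sum_abs_le_sqrt[of x J'] by linarith
  qed (use \<theta> in auto)
  also have "\<dots> = 2 * sqrt \<delta> / \<rho> * n"
    using pos by (simp add: \<theta>_def real_sqrt_mult)
  finally have 1: "p \<in> int_points n (2 * sqrt \<delta> / \<rho> * n)" by (simp add: int_points_def p_def)
  have "(\<Sum>j<n. (\<theta> * x j - of_int (p j))\<^sup>2) = (\<Sum>j\<in>J. (\<theta> * x j - of_int (p j))\<^sup>2) + (\<Sum>j\<in>J'. (\<theta> * x j - of_int (p j))\<^sup>2)"
    unfolding J'_def using J by (intro sum.subset_diff[of J "{..<n}", THEN trans]) (auto simp: add.commute)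
  also have "(\<Sum>j\<in>J. (\<theta> * x j - of_int (p j))\<^sup>2) = \<theta>\<^sup>2 * (\<Sum>j\<in>J. (x j)\<^sup>2)"
    unfolding sum_distrib_left by (intro sum.cong) (use J in \<open>auto simp: p_def power_mult_distrib\<close>)
  also have "\<dots> \<le> \<theta>\<^sup>2 * \<rho>\<^sup>2" using x by (intro mult_left_mono) (auto simp: spread_def J_def)
  also have "\<theta>\<^sup>2 * \<rho>\<^sup>2 = n" using pos by (simp add: \<theta>_def power_divide)
  also have "(\<Sum>j\<in>J'. (\<theta> * x j - of_int (p j))\<^sup>2) = (\<Sum>j\<in>J'. (\<theta> * x j - of_int (round (\<theta> * x j)))\<^sup>2)"
    by (intro sum.cong) (auto simp: p_def J'_def)
  also have "\<dots> \<le> dst2 n (\<lambda>j. \<theta> * x j)" unfolding dst2_def by (intro sum_mono2) (auto simp: J'_def)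
  also have "\<dots> \<le> n / 4" by (rule dst2_le)
  finally have "(\<Sum>j<n. (\<theta> * x j - of_int (p j))\<^sup>2) \<le> 4 * n" by simp
  then have "L2_set (\<lambda>j. \<theta> * x j - of_int (p j)) {..<n} \<le> sqrt (4 * n)"
    unfolding L2_set_def by (rule real_sqrt_le_mono)
  also have "\<dots> = 2 * sqrt n" by (simp add: real_sqrt_mult)
  finally show ?thesis using that[of p] 1 2 by (simp add: \<theta>_def)
qed

section \<open>Compressible vectors have large images\<close>

context subgaussian_law
begin

text \<open>Sparse integer points are so few that a fixed \<open>q0 < 1\<close> per row suffices: at
  most \<open>exp (3 * \<zeta> * n)\<close> net points against a probability of at most
  \<open>exp (- 4 * \<zeta> * n)\<close> each.\<close>

lemma compressible_event:
  fixes K :: real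
  assumes K: "K \<ge> 1"
  obtains c \<rho> \<delta> \<zeta> :: real where "c > 0" "\<rho> > 0" "\<delta> > 0" "\<zeta> > 0"
    "\<And>n R. \<lbrakk>n \<ge> 1; finite R; n \<le> 2 * card R\<rbrakk> \<Longrightarrow> typically R n (exp (- \<zeta> * n))
      (\<lambda>A. op_bounded R n (K * n) A \<longrightarrow> (\<forall>x. sph n x \<and> \<not> spread n \<delta> \<rho> x \<longrightarrow> c * n < l1 R n A x))"
proof -
  obtain c0 q0 :: real where c0: "c0 > 0" and q0: "0 < q0" "q0 < 1" and unit:
    "\<And>n x R. \<lbrakk>sph n x; finite R\<rbrakk>
      \<Longrightarrow> \<P>(A in PR R n. l1 R n A x \<le> c0 * card R) \<le> q0 ^ card R"
    by (rule unit_vector_l1) blast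
  \<comment> \<open>\<open>q0 = exp (- 8 * \<zeta>)\<close>, and half of the exponent survives since
    at least \<open>n / 2\<close> rows are guaranteed.\<close>
  define \<zeta> where "\<zeta> = - ln q0 / 8"
  have \<zeta>: "\<zeta> > 0" using q0 by (simp add: \<zeta>_def ln_less_zero)
  have q0e: "q0 = exp (- 8 * \<zeta>)" using q0 by (simp add: \<zeta>_def)
  \<comment> \<open>Makes the net error \<open>4 * K * \<rho> * n\<close> equal to
    \<open>c0 / 4 * n\<close>; with twice the threshold \<open>c0 / 8 * n\<close> this is
    \<open>c0 / 2 * n \<le> c0 * card R\<close>.\<close>
  define \<rho> where "\<rho> = c0 / (16 * K)"
  have \<rho>: "\<rho> > 0" using c0 K by (simp add: \<rho>_def)
  define h where "h = min 1 (\<zeta> / 2)"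
  have h: "0 < h" "h \<le> 1" "2 * h \<le> \<zeta>" using \<zeta> by (auto simp: h_def)
  \<comment> \<open>The two bounds serve the sparsity factor
    \<open>h powr (- (\<delta> * n))\<close> and the l1 factor of the count, so that each is at most
    \<open>exp (\<zeta> * n)\<close>.\<close>
  define \<delta> where "\<delta> = min (\<zeta> / (1 - ln h)) ((\<rho> * \<zeta> / 2)\<^sup>2)"
  have lnh: "ln h \<le> 0" using h by simp
  have \<delta>: "\<delta> > 0" using \<zeta> lnh \<rho> by (simp add: \<delta>_def)
  have \<delta>1: "- ln h * \<delta> \<le> \<zeta>"
  proof -
    have "\<delta> * (1 - ln h) \<le> \<zeta> / (1 - ln h) * (1 - ln h)" using lnh by (intro mult_right_mono) (auto simp: \<delta>_def)
    then have "\<delta> * (1 - ln h) \<le> \<zeta>" using lnh by simp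
    then show ?thesis using \<delta> by (simp add: algebra_simps)
  qed
  have \<delta>2: "2 * sqrt \<delta> / \<rho> \<le> \<zeta>"
  proof -
    have "sqrt \<delta> \<le> \<rho> * \<zeta> / 2" using \<rho> \<zeta> by (intro real_le_lsqrt) (auto simp: \<delta>_def)
    then show ?thesis using \<rho> by (simp add: field_simps)
  qed
  show ?thesis
  proof (rule that[of "c0 / 8" \<rho> \<delta> \<zeta>])
    fix n and R :: "nat set" assume n: "n \<ge> 1" and R: "finite R" "n \<le> 2 * card R"
    define F where "F = {p \<in> int_points n (2 * sqrt \<delta> / \<rho> * n). real (card {j. j < n \<and> p j \<noteq> 0}) \<le> \<delta> * n}"
    define X where "X = {x. sph n x \<and> \<not> spread n \<delta> \<rho> x}"
    have Fc: "finite F" "real (card F) \<le> h powr (- (\<delta> * n)) * exp (1 * (2 * sqrt \<delta> / \<rho> * n)) * (1 + 2 * h / 1) ^ n"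
    proof -
      have sub: "F \<subseteq> int_points n (2 * sqrt \<delta> / \<rho> * n)" by (auto simp: F_def)
      have sup: "real (card {j. j < n \<and> p j \<noteq> 0}) \<le> \<delta> * n" if "p \<in> F" for p using that by (simp add: F_def)
      show "finite F" "real (card F) \<le> h powr (- (\<delta> * n)) * exp (1 * (2 * sqrt \<delta> / \<rho> * n)) * (1 + 2 * h / 1) ^ n"
        by (rule card_int_points_weighted[OF h(1,2) zero_less_one sub sup]; assumption)+
    qed
    note Fc(2)
    also have "h powr (- (\<delta> * n)) * exp (1 * (2 * sqrt \<delta> / \<rho> * n)) * (1 + 2 * h / 1) ^ n
      \<le> exp (\<zeta> * n) * exp (\<zeta> * n) * exp (\<zeta> * n)"
    proof (intro mult_mono)
      have "(- ln h * \<delta>) * n \<le> \<zeta> * n" using \<delta>1 by (intro mult_right_mono) auto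
      then show "h powr (- (\<delta> * n)) \<le> exp (\<zeta> * n)" using h by (simp add: powr_def mult_ac)
      have "2 * sqrt \<delta> / \<rho> * n \<le> \<zeta> * n" using \<delta>2 by (intro mult_right_mono) auto
      then show "exp (1 * (2 * sqrt \<delta> / \<rho> * n)) \<le> exp (\<zeta> * n)" by simp
      have "1 + 2 * h \<le> exp \<zeta>" using h exp_ge_add_one_self[of \<zeta>] by linarith
      then have "(1 + 2 * h) ^ n \<le> exp \<zeta> ^ n" using h by (intro power_mono) auto
      then show "(1 + 2 * h / 1) ^ n \<le> exp (\<zeta> * n)" by (simp add: exp_of_nat2_mult)
    qed (use h in auto)
    also have "\<dots> = exp (3 * \<zeta> * n)" by (simp add: mult_exp_exp algebra_simps)
    finally have cF: "real (card F) \<le> exp (3 * \<zeta> * n)" .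
    have qk: "q0 ^ card R \<le> exp (- 4 * \<zeta> * n)"
    proof -
      have "q0 ^ card R = exp (- 8 * \<zeta> * card R)" unfolding q0e by (simp only: exp_of_nat2_mult)
      moreover have "real n \<le> 2 * real (card R)" using R(2) by linarith
      then have "4 * \<zeta> * n \<le> 4 * \<zeta> * (2 * real (card R))" using \<zeta> by (intro mult_left_mono) auto
      ultimately show ?thesis by simp
    qed
    have "typically R n (card F * q0 ^ card R) (\<lambda>A. op_bounded R n (K * n) A \<longrightarrow> (\<forall>x\<in>X. c0 / 8 * n < l1 R n A x))"
    proof (rule net_bound[OF R(1) Fc(1), where D = "sqrt n / \<rho>" and r = "2 * sqrt n"])
      fix x assume "x \<in> X"
      then have x: "sph n x" "\<not> spread n \<delta> \<rho> x" by (auto simp: X_def)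
      obtain p where p: "p \<in> int_points n (2 * sqrt \<delta> / \<rho> * n)" "real (card {j. j < n \<and> p j \<noteq> 0}) \<le> \<delta> * n"
        "L2_set (\<lambda>j. sqrt n / \<rho> * x j - of_int (p j)) {..<n} \<le> 2 * sqrt n"
        by (rule compressible_round[OF x \<delta> \<rho> n])
      show "\<exists>\<theta> p. sqrt n / \<rho> \<le> \<theta> \<and> \<theta> \<le> 2 * (sqrt n / \<rho>) \<and> p \<in> F \<and> L2_set (\<lambda>j. \<theta> * x j - of_int (p j)) {..<n} \<le> 2 * sqrt n"
      proof (intro exI[of _ "sqrt n / \<rho>"] exI[of _ p] conjI)
        have "0 \<le> sqrt n / \<rho>" using \<rho> by simp
        then show "sqrt n / \<rho> \<le> 2 * (sqrt n / \<rho>)" by linarith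
        show "p \<in> F" using p by (simp add: F_def)
      qed (use p in simp_all)
      have "2 * (c0 / 8 * n) + 2 * (2 * sqrt n) * (K * n) / (sqrt n / \<rho>) = c0 / 2 * n"
        using n K by (simp add: \<rho>_def field_simps)
      also have "\<dots> \<le> c0 / 2 * (2 * card R)" using R c0 by (intro mult_left_mono) linarith+
      finally have le: "2 * (c0 / 8 * n) + 2 * (2 * sqrt n) * (K * n) / (sqrt n / \<rho>) \<le> c0 * card R" by simp
      interpret Q: prob_space "PR R n" by (rule prob_space_P)
      have "\<P>(A in PR R n. l1 R n A x \<le> 2 * (c0 / 8 * n) + 2 * (2 * sqrt n) * (K * n) / (sqrt n / \<rho>))
        \<le> \<P>(A in PR R n. l1 R n A x \<le> c0 * card R)"
        using le measurable_l1[of R R n x] by (intro Q.finite_measure_mono) auto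
      also have "\<dots> \<le> q0 ^ card R" by (rule unit[OF x(1) R(1)])
      finally show "\<P>(A in PR R n. l1 R n A x \<le> 2 * (c0 / 8 * n) + 2 * (2 * sqrt n) * (K * n) / (sqrt n / \<rho>)) \<le> q0 ^ card R" .
    qed (use n \<rho> c0 K q0 in auto)
    moreover have "card F * q0 ^ card R \<le> exp (- \<zeta> * n)"
    proof -
      have "card F * q0 ^ card R \<le> exp (3 * \<zeta> * n) * exp (- 4 * \<zeta> * n)"
        using cF qk q0 by (intro mult_mono) auto
      also have "\<dots> = exp (- \<zeta> * n)" by (simp add: mult_exp_exp algebra_simps)
      finally show ?thesis .
    qed
    ultimately show "typically R n (exp (- \<zeta> * n))
      (\<lambda>A. op_bounded R n (K * n) A \<longrightarrow> (\<forall>x. sph n x \<and> \<not> spread n \<delta> \<rho> x \<longrightarrow> c0 / 8 * n < l1 R n A x))"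
      by (rule typically_mono) (auto simp: X_def)
  qed (use c0 \<rho> \<delta> \<zeta> in auto)
qed

lemma spread_event:
  obtains K c \<rho> \<delta> \<zeta> :: real where "K \<ge> 1" "c > 0" "\<rho> > 0" "\<delta> > 0" "\<zeta> > 0" "\<zeta> \<le> 1"
    "\<And>n R. \<lbrakk>n \<ge> 1; finite R; n \<le> 2 * card R; card R \<le> 2 * n\<rbrakk> \<Longrightarrow> typically R n (2 * exp (- \<zeta> * n))
      (\<lambda>A. op_bounded R n (K * n) A \<and> (\<forall>x. sph n x \<and> \<not> spread n \<delta> \<rho> x \<longrightarrow> c * n < l1 R n A x))"
proof -
  obtain K :: real where K: "K \<ge> 1" and norm:
    "\<And>n R. \<lbrakk>n \<ge> 1; finite R; card R \<le> 2 * n\<rbrakk> \<Longrightarrow> typically R n (exp (- real n)) (op_bounded R n (K * n))"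
    by (rule norm_event) blast
  obtain c \<rho> \<delta> \<zeta> :: real where c: "c > 0" "\<rho> > 0" "\<delta> > 0" "\<zeta> > 0" and comp:
    "\<And>n R. \<lbrakk>n \<ge> 1; finite R; n \<le> 2 * card R\<rbrakk> \<Longrightarrow> typically R n (exp (- \<zeta> * n))
      (\<lambda>A. op_bounded R n (K * n) A \<longrightarrow> (\<forall>x. sph n x \<and> \<not> spread n \<delta> \<rho> x \<longrightarrow> c * n < l1 R n A x))"
    by (rule compressible_event[OF K]) blast
  define \<eta> where "\<eta> = min 1 \<zeta>"
  show ?thesis
  proof (rule that[OF K c(1,2,3), of \<eta>])
    fix n and R :: "nat set" assume R: "n \<ge> 1" "finite R" "n \<le> 2 * card R" "card R \<le> 2 * n"
    have "\<eta> * n \<le> 1 * real n" "\<eta> * n \<le> \<zeta> * n" by (intro mult_right_mono; simp add: \<eta>_def)+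
    then have "exp (- real n) \<le> exp (- \<eta> * n)" "exp (- \<zeta> * n) \<le> exp (- \<eta> * n)" by simp_all
    then have "exp (- real n) + exp (- \<zeta> * n) \<le> 2 * exp (- \<eta> * n)" by linarith
    then show "typically R n (2 * exp (- \<eta> * n))
      (\<lambda>A. op_bounded R n (K * n) A \<and> (\<forall>x. sph n x \<and> \<not> spread n \<delta> \<rho> x \<longrightarrow> c * n < l1 R n A x))"
      by (rule typically_mono[OF typically_conj[OF norm[OF R(1,2,4)] comp[OF R(1,2,3)]]]) blast
  qed (use c in \<open>auto simp: \<eta>_def\<close>)
qed

text \<open>One dyadic level. A vector of the level has a multiple, by some \<theta> between
  \<open>D\<close> and \<open>2 * D\<close>, within \<open>\<mu> * sqrt n\<close> of an integer
  point, so a net has at most \<open>(Q * D / sqrt n) ^ n\<close> points. The small ball estimate at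
  the matching scale gives \<open>(C * s) ^ (n - 1)\<close> with \<open>s\<close> proportional to
  \<open>\<mu> * sqrt n / D\<close>. The ratio \<open>D / sqrt n\<close> cancels up to one factor,
  and \<mu> remains in the power.\<close>

lemma level_set_event:
  fixes C c K \<rho> \<delta> \<mu> D :: real
  assumes ball: "\<And>x s. \<lbrakk>lcd_ge n \<rho> \<mu> D x; s > 0; \<mu> * sqrt n \<le> s * D; exp (- c * \<mu>\<^sup>2 * n) \<le> s\<rbrakk> \<Longrightarrow> anticoncentrated C n s x"
    and C: "C > 0" and K: "K \<ge> 1" and \<mu>: "\<mu> > 0" and \<delta>: "\<delta> > 0"
    and n: "n \<ge> 2" and R: "finite R" "card R = n - 1"
    and D: "sqrt (\<delta> * n) / 2 \<le> D" and sD: "exp (- c * \<mu>\<^sup>2 * n) \<le> 4 * K * \<mu> * sqrt n / D"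
  defines "Q \<equiv> exp 1 * (8 + 2 / sqrt \<delta>)"
  shows "typically R n (Q * D * (4 * C * K * \<mu> * Q) ^ (n - 1)) (\<lambda>A. op_bounded R n (K * n) A \<longrightarrow>
    (\<forall>x. sph n x \<and> lcd_ge n \<rho> \<mu> D x \<and> \<not> lcd_ge n \<rho> \<mu> (2 * D) x \<longrightarrow> 0 < l1 R n A x))"
proof -
  define X where "X = {x. sph n x \<and> lcd_ge n \<rho> \<mu> D x \<and> \<not> lcd_ge n \<rho> \<mu> (2 * D) x}"
  define F where "F = int_points n (4 * D * sqrt n)"
  \<comment> \<open>The net error \<open>2 * (\<mu> * sqrt n) * (K * n) / D\<close> is
    \<open>s / 2 * n\<close>, at most \<open>s * card R\<close> because
    \<open>card R = n - 1 \<ge> n / 2\<close>.\<close>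
  define s where "s = 4 * K * \<mu> * sqrt n / D"
  define y where "y = D / sqrt n"
  have sn: "sqrt n > 0" using n by simp
  have "sqrt (\<delta> * n) / 2 > 0" using \<delta> n by simp
  then have D0: "D > 0" using D by linarith
  have s: "s > 0" using D0 K \<mu> n by (simp add: s_def)
  have y: "y > 0" using D0 sn by (simp add: y_def)
  \<comment> \<open>The lower bound on \<open>D\<close> absorbs the 1 in \<open>1 + 8 * y\<close>;
    this is the origin of \<open>2 / sqrt \<delta>\<close> in \<open>Q\<close>.\<close>
  have y1: "1 \<le> 2 / sqrt \<delta> * y"
    using D \<delta> sn by (simp add: y_def real_sqrt_mult field_simps)
  have "real (card F) \<le> exp ((sqrt n / (4 * D)) * (4 * D * sqrt n)) * (1 + 2 / (sqrt n / (4 * D))) ^ n"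
    unfolding F_def by (rule card_int_points(2)) (use D0 sn in simp)
  also have "(sqrt n / (4 * D)) * (4 * D * sqrt n) = n" using D0 by simp
  also have "exp (real n) = exp 1 ^ n" by (simp add: exp_of_nat_mult[symmetric])
  also have "2 / (sqrt n / (4 * D)) = 8 * y" using D0 sn by (simp add: y_def)
  also have "exp 1 ^ n * (1 + 8 * y) ^ n = (exp 1 * (1 + 8 * y)) ^ n" by (simp add: power_mult_distrib)
  also have "\<dots> \<le> (Q * y) ^ n"
  proof (rule power_mono)
    have "1 + 8 * y \<le> (8 + 2 / sqrt \<delta>) * y" using y1 by (simp add: algebra_simps)
    then show "exp 1 * (1 + 8 * y) \<le> Q * y" by (simp add: Q_def mult.assoc)
  qed (use y in simp)
  finally have cF: "real (card F) \<le> (Q * y) ^ n" .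
  have fin: "finite F" unfolding F_def using card_int_points(1)[of 1] by simp
  have net: "typically R n (card F * (C * s) ^ (n - 1)) (\<lambda>A. op_bounded R n (K * n) A \<longrightarrow> (\<forall>x\<in>X. 0 < l1 R n A x))"
  proof (rule net_bound[OF R(1) fin D0, where r = "\<mu> * sqrt n"])
    fix x assume "x \<in> X"
    then have x: "sph n x" "lcd_ge n \<rho> \<mu> D x" "\<not> lcd_ge n \<rho> \<mu> (2 * D) x" by (auto simp: X_def)
    from x(3) obtain \<theta> where \<theta>: "0 < \<theta>" "\<theta> \<le> 2 * D" "dst2 n (\<lambda>j. \<theta> * x j) < min (\<rho>\<^sup>2 * \<theta>\<^sup>2) (\<mu>\<^sup>2 * real n)"
      by (auto simp: lcd_ge_def not_le)
    have "D < \<theta>" using x(2) \<theta> unfolding lcd_ge_def by (meson not_le)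
    have "sqrt (dst2 n (\<lambda>j. \<theta> * x j)) \<le> sqrt (\<mu>\<^sup>2 * n)" using \<theta>(3) by (intro real_sqrt_le_mono) simp
    also have "\<dots> = \<mu> * sqrt n" using \<mu> by (simp add: real_sqrt_mult)
    finally have d: "L2_set (\<lambda>j. \<theta> * x j - of_int (round_vec n (\<lambda>j. \<theta> * x j) j)) {..<n} \<le> \<mu> * sqrt n"
      by (simp only: round_vec_dist)
    have "\<theta> * sqrt n \<le> 2 * D * sqrt n" using \<theta> by (intro mult_right_mono) auto
    then have "round_vec n (\<lambda>j. \<theta> * x j) \<in> F" unfolding F_def
      using \<theta> by (intro round_vec_int_points[OF x(1)]) auto
    then show "\<exists>\<theta> p. D \<le> \<theta> \<and> \<theta> \<le> 2 * D \<and> p \<in> F \<and> L2_set (\<lambda>j. \<theta> * x j - of_int (p j)) {..<n} \<le> \<mu> * sqrt n"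
      using d \<theta> \<open>D < \<theta>\<close> by (intro exI[of _ \<theta>] exI[of _ "round_vec n (\<lambda>j. \<theta> * x j)"]) auto
    have "2 * (\<mu> * sqrt n) * (K * n) / D = s / 2 * n" by (simp add: s_def mult_ac)
    also have "\<dots> \<le> s / 2 * (2 * card R)" using R n s by (intro mult_left_mono) linarith+
    finally have le: "2 * 0 + 2 * (\<mu> * sqrt n) * (K * n) / D \<le> s * card R" by simp
    interpret Q: prob_space "PR R n" by (rule prob_space_P)
    have "\<P>(A in PR R n. l1 R n A x \<le> 2 * 0 + 2 * (\<mu> * sqrt n) * (K * n) / D)
      \<le> \<P>(A in PR R n. l1 R n A x \<le> s * card R)"
      using le measurable_l1[of R R n x] by (intro Q.finite_measure_mono) auto
    also have "\<dots> \<le> (C * s) ^ card R"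
    proof -
      have "\<mu> * sqrt n \<le> s * D"
        using D0 K \<mu> mult_right_mono[of 1 "4 * K" "\<mu> * sqrt n"] by (simp add: s_def mult.assoc)
      then have "anticoncentrated C n s x" using sD by (intro ball[OF x(2) s]) (simp_all add: s_def)
      then show ?thesis unfolding anticoncentrated_def using R(1) by blast
    qed
    finally show "\<P>(A in PR R n. l1 R n A x \<le> 2 * 0 + 2 * (\<mu> * sqrt n) * (K * n) / D) \<le> (C * s) ^ (n - 1)"
      using R by simp
  qed (use \<mu> K C s in auto)
  have "card F * (C * s) ^ (n - 1) \<le> (Q * y) ^ n * (C * s) ^ (n - 1)"
    using cF C s by (intro mult_right_mono) auto
  \<comment> \<open>One of the \<open>n\<close> net factors has no row to cancel with, as there are
    only \<open>n - 1\<close> rows; it is bounded by \<open>Q * D\<close> in the end.\<close>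
  also have "(Q * y) ^ n = (Q * y) * (Q * y) ^ (n - 1)" using n by (cases n) auto
  also have "(Q * y) * (Q * y) ^ (n - 1) * (C * s) ^ (n - 1) = (Q * y) * (Q * y * (C * s)) ^ (n - 1)"
    by (simp add: power_mult_distrib)
  also have "Q * y * (C * s) = 4 * C * K * \<mu> * Q" using D0 sn by (simp add: y_def s_def)
  also have "Q * y * (4 * C * K * \<mu> * Q) ^ (n - 1) \<le> Q * D * (4 * C * K * \<mu> * Q) ^ (n - 1)"
  proof (intro mult_right_mono mult_left_mono)
    have "1 \<le> sqrt n" using n by simp
    then show "y \<le> D" using D0 sn by (simp add: y_def field_simps)
  qed (use C K \<mu> \<delta> in \<open>auto simp: Q_def\<close>)
  finally show ?thesis by (rule typically_mono[OF net]) (auto simp: X_def)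
qed

text \<open>A spread kernel vector starts with the bound of \<open>spread_lcd_ge\<close>. At each
  level this bound must double, because no vector of the level lies in the kernel; this continues up
  to \<open>exp (a * n)\<close>.\<close>

lemma all_levels_event:
  fixes C c K \<rho> \<delta> :: real
  assumes ball: "\<And>n x \<mu> D s. \<lbrakk>lcd_ge n \<rho> \<mu> D x; s > 0; \<mu> \<ge> 0; D \<ge> 0; \<mu> * sqrt n \<le> s * D; exp (- c * \<mu>\<^sup>2 * n) \<le> s\<rbrakk>
      \<Longrightarrow> anticoncentrated C n s x"
    and C: "C > 0" and c: "c > 0" and K: "K \<ge> 1" and \<delta>: "\<delta> > 0"
  obtains \<mu> a :: real and n1 :: nat where "\<mu> > 0" "a > 0"
    "\<And>n R. \<lbrakk>n \<ge> n1; finite R; card R = n - 1\<rbrakk> \<Longrightarrow> typically R n (exp (- real n)) (\<lambda>A. op_bounded R n (K * n) A \<longrightarrow>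
      (\<forall>x. sph n x \<and> spread n \<delta> \<rho> x \<and> (\<forall>i\<in>R. mv n A x i = 0) \<longrightarrow> lcd_ge n \<rho> \<mu> (exp (a * n)) x))"
proof -
  define Q where "Q = exp 1 * (8 + 2 / sqrt \<delta>)"
  have Q: "Q > 0" using \<delta> by (simp add: Q_def add_pos_pos)
  \<comment> \<open>\<open>C\<close> and \<open>Q\<close> do not depend on \<mu>, so each level can
    be given the base \<open>exp (- 3)\<close>: one factor \<open>exp n\<close> pays for
    \<open>D\<close>, one is the target probability, one covers the number of levels and the
    constants.\<close>
  define \<mu> where "\<mu> = exp (- 3) / (4 * C * K * Q)"
  have \<mu>: "\<mu> > 0" using C K Q by (simp add: \<mu>_def)
  have \<mu>e: "4 * C * K * \<mu> * Q = exp (- 3)" using C K Q by (simp add: \<mu>_def)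
  \<comment> \<open>\<open>a \<le> 1\<close> keeps \<open>D\<close> below \<open>exp n\<close>;
    \<open>a \<le> c * \<mu>\<^sup>2 / 2\<close> secures
    \<open>exp (- c * \<mu>\<^sup>2 * n) \<le> s\<close> on all levels for large
    \<open>n\<close>.\<close>
  define a where "a = min 1 (c * \<mu>\<^sup>2 / 2)"
  have a: "a > 0" "a \<le> 1" "a \<le> c * \<mu>\<^sup>2 / 2" using c \<mu> by (auto simp: a_def)
  define b where "b = c * \<mu>\<^sup>2 / 2"
  define e where "e = 4 * K * \<mu>"
  have be: "b > 0" "e > 0" using c \<mu> K by (auto simp: b_def e_def)
  have 1: "eventually (\<lambda>n::nat. exp (- b * real n) \<le> e * sqrt (real n)) at_top"
    using be by real_asymp
  \<comment> \<open>\<open>2 * n\<close> doublings carry the initial bound beyond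
    \<open>exp n\<close>, as \<open>exp 1 \<le> 3 < 4\<close>.\<close>
  have 2: "eventually (\<lambda>n::nat. exp (real n) \<le> sqrt (\<delta> * real n) / 2 * 2 ^ (2 * n)) at_top"
  proof -
    define \<delta>' where "\<delta>' = sqrt \<delta>"
    have "\<delta>' > 0" using \<delta> by (simp add: \<delta>'_def)
    then have "eventually (\<lambda>n::nat. 3 ^ n \<le> \<delta>' * sqrt (real n) / 2 * 4 ^ n) at_top" by real_asymp
    then show ?thesis
    proof eventually_elim
      case (elim n)
      have "exp (real n) = exp 1 ^ n" by (simp add: exp_of_nat_mult[symmetric])
      also have "\<dots> \<le> 3 ^ n" using exp_le by (intro power_mono) auto
      also have "\<dots> \<le> sqrt (\<delta> * real n) / 2 * 2 ^ (2 * n)"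
        using elim by (simp add: \<delta>'_def real_sqrt_mult power_mult)
      finally show ?case .
    qed
  qed
  have 3: "eventually (\<lambda>n::nat. (2 * real n) * (Q * exp (real n) * exp (- 3) ^ (n - 1)) \<le> exp (- real n)) at_top"
  proof -
    have "eventually (\<lambda>n::nat. (2 * real n) * (Q * exp (real n) * (exp 3 * exp (- 3 * real n))) \<le> exp (- real n)) at_top"
      using Q by real_asymp
    then show ?thesis using eventually_ge_at_top[of "1::nat"]
    proof eventually_elim
      case (elim n)
      have "exp (- 3) ^ (n - 1) = exp (real (n - 1) * (- 3) :: real)" by (rule exp_of_nat_mult[symmetric])
      also have "real (n - 1) * (- 3) = 3 + (- 3 * real n)" using elim by simp
      finally show ?case using elim by (simp only: exp_add)
    qed
  qed
  from 1 2 3 have "eventually (\<lambda>n. exp (- b * real n) \<le> e * sqrt (real n) \<and>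
      exp (real n) \<le> sqrt (\<delta> * real n) / 2 * 2 ^ (2 * n) \<and>
      (2 * real n) * (Q * exp (real n) * exp (- 3) ^ (n - 1)) \<le> exp (- real n) \<and> n \<ge> 2) at_top"
    using eventually_ge_at_top[of 2] by eventually_elim auto
  then obtain n1 where n1: "\<And>n. n \<ge> n1 \<Longrightarrow> exp (- b * real n) \<le> e * sqrt (real n) \<and>
      exp (real n) \<le> sqrt (\<delta> * real n) / 2 * 2 ^ (2 * n) \<and>
      (2 * real n) * (Q * exp (real n) * exp (- 3) ^ (n - 1)) \<le> exp (- real n) \<and> n \<ge> 2"
    by (auto simp: eventually_at_top_linorder)
  show ?thesis
  proof (rule that[OF \<mu> a(1), of n1])
    fix n and R :: "nat set" assume "n1 \<le> n" and R: "finite R" "card R = n - 1"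
    note n = n1[OF \<open>n1 \<le> n\<close>]
    define D where "D k = sqrt (\<delta> * n) / 2 * 2 ^ k" for k
    have Dpos: "D k > 0" for k using \<delta> n by (simp add: D_def)
    define I where "I = {k. k < 2 * n \<and> D k \<le> exp (a * n)}"
    have finI: "finite I" by (simp add: I_def)
    define \<Phi> where "\<Phi> k A \<longleftrightarrow> (op_bounded R n (K * n) A \<longrightarrow>
      (\<forall>x. sph n x \<and> lcd_ge n \<rho> \<mu> (D k) x \<and> \<not> lcd_ge n \<rho> \<mu> (2 * D k) x \<longrightarrow> 0 < l1 R n A x))" for k A
    have level: "typically R n (Q * exp n * exp (- 3) ^ (n - 1)) (\<Phi> k)" if k: "k \<in> I" for k
    proof -
      have "sqrt (\<delta> * n) / 2 * 1 \<le> D k" unfolding D_def using \<delta> by (intro mult_left_mono) auto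
      then have Dge: "sqrt (\<delta> * n) / 2 \<le> D k" by simp
      have Dle: "D k \<le> exp (a * n)" using k by (simp add: I_def)
      have "exp (- c * \<mu>\<^sup>2 * n) * D k \<le> exp (- c * \<mu>\<^sup>2 * n) * exp (a * n)" using Dle by (intro mult_left_mono) auto
      also have "\<dots> \<le> exp (- b * n)"
      proof -
        have "a * n \<le> c * \<mu>\<^sup>2 / 2 * n" using a by (intro mult_right_mono) auto
        then show ?thesis by (simp add: mult_exp_exp b_def)
      qed
      also have "\<dots> \<le> 4 * K * \<mu> * sqrt n" using n by (simp add: e_def)
      finally have sD: "exp (- c * \<mu>\<^sup>2 * n) \<le> 4 * K * \<mu> * sqrt n / D k" using Dpos[of k] by (simp add: field_simps)
      have "typically R n (Q * D k * (4 * C * K * \<mu> * Q) ^ (n - 1)) (\<Phi> k)"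
        unfolding Q_def \<Phi>_def
        by (rule level_set_event[OF ball C K \<mu> \<delta> _ R Dge sD]; (assumption | use n \<mu> Dpos[of k] in simp))
      moreover have "Q * D k * (4 * C * K * \<mu> * Q) ^ (n - 1) \<le> Q * exp n * exp (- 3) ^ (n - 1)"
        unfolding \<mu>e
      proof (intro mult_right_mono mult_left_mono)
        have "a * n \<le> 1 * real n" using a by (intro mult_right_mono) auto
        then have "exp (a * n) \<le> exp n" by simp
        then show "D k \<le> exp n" using Dle by linarith
      qed (use Q in auto)
      ultimately show ?thesis by (rule typically_mono)
    qed
    have "real (card I) * (Q * exp n * exp (- 3) ^ (n - 1)) \<le> (2 * real n) * (Q * exp n * exp (- 3) ^ (n - 1))"
    proof (intro mult_right_mono)
      have "card I \<le> card {..<2 * n}" by (intro card_mono) (auto simp: I_def)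
      then show "real (card I) \<le> 2 * real n" by simp
    qed (use Q in auto)
    also have "\<dots> \<le> exp (- real n)" using n by simp
    finally have total: "real (card I) * (Q * exp n * exp (- 3) ^ (n - 1)) \<le> exp (- real n)" .
    have "typically R n (card I * (Q * exp n * exp (- 3) ^ (n - 1))) (\<lambda>A. \<forall>k\<in>I. \<Phi> k A)"
      by (rule typically_ball[OF finI level])
    then show "typically R n (exp (- real n)) (\<lambda>A. op_bounded R n (K * n) A \<longrightarrow>
      (\<forall>x. sph n x \<and> spread n \<delta> \<rho> x \<and> (\<forall>i\<in>R. mv n A x i = 0) \<longrightarrow> lcd_ge n \<rho> \<mu> (exp (a * n)) x))"
    proof (rule typically_mono[OF _ total], intro impI allI)
      fix A x assume A: "\<forall>k\<in>I. \<Phi> k A" and op: "op_bounded R n (K * n) A"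
        and x: "sph n x \<and> spread n \<delta> \<rho> x \<and> (\<forall>i\<in>R. mv n A x i = 0)"
      have l0: "l1 R n A x = 0" using x by (simp add: l1_def)
      have step: "k \<le> 2 * n \<Longrightarrow> lcd_ge n \<rho> \<mu> (min (D k) (exp (a * n))) x" for k
      proof (induction k)
        case 0
        have "lcd_ge n \<rho> \<mu> (D 0) x" unfolding D_def using spread_lcd_ge[of n \<delta> \<rho> x \<mu>] x \<delta> n by simp
        then show ?case by (rule lcd_ge_mono) simp
      next
        case (Suc k)
        then have IH: "lcd_ge n \<rho> \<mu> (min (D k) (exp (a * n))) x" by simp
        show ?case
        proof (cases "D k \<le> exp (a * n)")
          case True
          then have "k \<in> I" using Suc.prems by (simp add: I_def)
          moreover have "lcd_ge n \<rho> \<mu> (D k) x" using IH True by (simp add: min_def)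
          ultimately have "lcd_ge n \<rho> \<mu> (2 * D k) x" using A op x l0 by (force simp: \<Phi>_def)
          then show ?thesis by (rule lcd_ge_mono) (simp add: D_def)
        next
          case False
          then have "lcd_ge n \<rho> \<mu> (exp (a * n)) x" using IH by (simp add: min_def)
          then show ?thesis by (rule lcd_ge_mono) simp
        qed
      qed
      have "a * n \<le> 1 * real n" using a by (intro mult_right_mono) auto
      then have "exp (a * n) \<le> exp n" by simp
      also have "\<dots> \<le> D (2 * n)" using n by (simp add: D_def)
      finally show "lcd_ge n \<rho> \<mu> (exp (a * n)) x" using step[of "2 * n"] by (simp add: min_def split: if_splits)
    qed
  qed
qed

text \<open>Kernel vectors have image 0, hence are spread, and their denominators are at least
  \<open>exp (a * n)\<close>; so the small ball estimate reaches down to the scale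
  \<open>r ^ n\<close>. It concerns fresh rows, while the probability \<open>q ^ n\<close> refers to
  the rows defining the kernel.\<close>

lemma kernel_small_ball:
  obtains C r q :: real and n1 :: nat where "C > 0" "0 < r" "r < 1" "0 < q" "q < 1"
    "\<And>n R. \<lbrakk>n \<ge> n1; finite R; card R = n - 1\<rbrakk> \<Longrightarrow> typically R n (q ^ n)
      (\<lambda>A. \<forall>x. sph n x \<and> (\<forall>i\<in>R. mv n A x i = 0) \<longrightarrow> (\<forall>s. r ^ n \<le> s \<longrightarrow> anticoncentrated C n s x))"
proof -
  obtain K c0 \<rho> \<delta> \<zeta> :: real where K: "K \<ge> 1" and c0: "c0 > 0" "\<rho> > 0" "\<delta> > 0" "\<zeta> > 0" "\<zeta> \<le> 1" and sprd:
    "\<And>n R. \<lbrakk>n \<ge> 1; finite R; n \<le> 2 * card R; card R \<le> 2 * n\<rbrakk> \<Longrightarrow> typically R n (2 * exp (- \<zeta> * n))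
      (\<lambda>A. op_bounded R n (K * n) A \<and> (\<forall>x. sph n x \<and> \<not> spread n \<delta> \<rho> x \<longrightarrow> c0 * n < l1 R n A x))"
    by (rule spread_event) blast
  obtain C c :: real where C: "C > 0" and c: "c > 0" and ball:
    "\<And>n x \<mu> D s. \<lbrakk>lcd_ge n \<rho> \<mu> D x; s > 0; \<mu> \<ge> 0; D \<ge> 0; \<mu> * sqrt n \<le> s * D; exp (- c * \<mu>\<^sup>2 * n) \<le> s\<rbrakk>
      \<Longrightarrow> anticoncentrated C n s x"
    by (rule small_ball_l1[OF c0(2)]) blast
  obtain \<mu> a :: real and n0 :: nat where \<mu>: "\<mu> > 0" and a: "a > 0" and lev:
    "\<And>n R. \<lbrakk>n \<ge> n0; finite R; card R = n - 1\<rbrakk> \<Longrightarrow> typically R n (exp (- real n)) (\<lambda>A. op_bounded R n (K * n) A \<longrightarrow>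
      (\<forall>x. sph n x \<and> spread n \<delta> \<rho> x \<and> (\<forall>i\<in>R. mv n A x i = 0) \<longrightarrow> lcd_ge n \<rho> \<mu> (exp (a * n)) x))"
    by (rule all_levels_event[OF ball C c K c0(3)]) (assumption | blast)+
  \<comment> \<open>\<open>a / 2\<close> leaves \<open>exp (a / 2 * n)\<close> in
    \<open>s * exp (a * n)\<close> to dominate \<open>\<mu> * sqrt n\<close>; the other member
    serves the condition on \<open>exp (- c * \<mu>\<^sup>2 * n)\<close>.\<close>
  define r where "r = exp (- min (a / 2) (c * \<mu>\<^sup>2))"
  define q where "q = exp (- \<zeta> / 2)"
  have r: "0 < r" "r < 1" using a c \<mu> by (auto simp: r_def min_def)
  have q: "0 < q" "q < 1" using c0 by (auto simp: q_def)
  have 1: "eventually (\<lambda>n::nat. \<mu> * sqrt (real n) \<le> exp (a / 2 * real n)) at_top" using \<mu> a by real_asymp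
  have 2: "eventually (\<lambda>n::nat. 3 * exp (- \<zeta> * real n) \<le> exp (- \<zeta> / 2 * real n)) at_top" using c0(4) by real_asymp
  from 1 2 have "eventually (\<lambda>n::nat. \<mu> * sqrt (real n) \<le> exp (a / 2 * real n) \<and> 3 * exp (- \<zeta> * real n) \<le> exp (- \<zeta> / 2 * real n) \<and> n \<ge> 2 \<and> n \<ge> n0) at_top"
    using eventually_ge_at_top[of 2] eventually_ge_at_top[of n0] by eventually_elim auto
  then obtain n1 where n1: "\<And>n. n \<ge> n1 \<Longrightarrow> \<mu> * sqrt (real n) \<le> exp (a / 2 * real n) \<and> 3 * exp (- \<zeta> * real n) \<le> exp (- \<zeta> / 2 * real n) \<and> n \<ge> 2 \<and> n \<ge> n0"
    by (auto simp: eventually_at_top_linorder)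
  show ?thesis
  proof (rule that[OF C r q, of n1])
    fix n and R :: "nat set" assume "n \<ge> n1" and R: "finite R" "card R = n - 1"
    note n = n1[OF \<open>n \<ge> n1\<close>]
    have nR: "n \<ge> 1" "n \<le> 2 * card R" "card R \<le> 2 * n" "n \<ge> n0" using n R by auto
    have "2 * exp (- \<zeta> * n) + exp (- real n) \<le> 3 * exp (- \<zeta> * n)"
      using c0 mult_right_mono[of \<zeta> 1 "real n"] by simp
    also have "\<dots> \<le> exp (- \<zeta> / 2 * n)" using n by blast
    also have "\<dots> = q ^ n" unfolding q_def by (rule exp_of_nat2_mult)
    finally show "typically R n (q ^ n)
      (\<lambda>A. \<forall>x. sph n x \<and> (\<forall>i\<in>R. mv n A x i = 0) \<longrightarrow> (\<forall>s. r ^ n \<le> s \<longrightarrow> anticoncentrated C n s x))"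
    proof (rule typically_mono[OF typically_conj[OF sprd[OF nR(1) R(1) nR(2,3)] lev[OF nR(4) R]]], intro allI impI)
      fix A x s
      assume A: "(op_bounded R n (K * n) A \<and> (\<forall>x. sph n x \<and> \<not> spread n \<delta> \<rho> x \<longrightarrow> c0 * n < l1 R n A x)) \<and>
          (op_bounded R n (K * n) A \<longrightarrow>
            (\<forall>x. sph n x \<and> spread n \<delta> \<rho> x \<and> (\<forall>i\<in>R. mv n A x i = 0) \<longrightarrow> lcd_ge n \<rho> \<mu> (exp (a * n)) x))"
        and x: "sph n x \<and> (\<forall>i\<in>R. mv n A x i = 0)" and s: "r ^ n \<le> s"
      have "0 \<le> c0 * n" using c0 by simp
      then have "\<not> c0 * n < l1 R n A x" using x by (simp add: l1_def)
      then have lcd: "lcd_ge n \<rho> \<mu> (exp (a * n)) x" using A x by blast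
      have rn: "r ^ n = exp (- (min (a / 2) (c * \<mu>\<^sup>2) * n))" unfolding r_def by (simp add: exp_of_nat2_mult[symmetric])
      show "anticoncentrated C n s x"
      proof (rule ball[OF lcd])
        show "s > 0" using s r by (meson less_le_trans zero_less_power)
        have "min (a / 2) (c * \<mu>\<^sup>2) * n \<le> a / 2 * n" by (intro mult_right_mono) auto
        then have "exp (- (a / 2 * n)) \<le> r ^ n" unfolding rn by simp
        then have sa: "exp (- (a / 2 * n)) \<le> s" using s by linarith
        have "\<mu> * sqrt n \<le> exp (a / 2 * n)" using n by simp
        also have "\<dots> = exp (- (a / 2 * n)) * exp (a * n)" by (simp add: mult_exp_exp)
        also have "\<dots> \<le> s * exp (a * n)" using sa by (intro mult_right_mono) auto
        finally show "\<mu> * sqrt n \<le> s * exp (a * n)" .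
        have "min (a / 2) (c * \<mu>\<^sup>2) * n \<le> c * \<mu>\<^sup>2 * n" by (intro mult_right_mono) auto
        then have "exp (- c * \<mu>\<^sup>2 * n) \<le> r ^ n" unfolding rn by simp
        then show "exp (- c * \<mu>\<^sup>2 * n) \<le> s" using s by linarith
      qed (use \<mu> in auto)
    qed
  qed
qed

text \<open>Up to constants a net of fixed scale \<open>h\<close> has size
  \<open>(1 / h) ^ n\<close> and each point fails with probability \<open>h ^ N\<close>; the surplus
  of \<open>d * n\<close> rows leaves \<open>h powr (d * n)\<close>, which beats the constants for
  small \<open>h\<close>. For spread vectors the initial denominator bound is enough at this
  scale.\<close>

lemma tall_matrix_event:
  assumes d: "d > 0"
  obtains c q :: real and n1 :: nat where "c > 0" "0 < q" "q < 1"
    "\<And>n N. \<lbrakk>n \<ge> n1; real n * (1 + d) \<le> real N; N \<le> 2 * n\<rbrakk> \<Longrightarrow>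
      typically {..<N} n (q ^ n) (\<lambda>A. \<forall>x. sph n x \<longrightarrow> c * n < l1 {..<N} n A x)"
proof -
  obtain K c0 \<rho> \<delta> \<zeta> :: real where K: "K \<ge> 1" and c0: "c0 > 0" "\<rho> > 0" "\<delta> > 0" "\<zeta> > 0" "\<zeta> \<le> 1" and sprd:
    "\<And>n R. \<lbrakk>n \<ge> 1; finite R; n \<le> 2 * card R; card R \<le> 2 * n\<rbrakk> \<Longrightarrow> typically R n (2 * exp (- \<zeta> * n))
      (\<lambda>A. op_bounded R n (K * n) A \<and> (\<forall>x. sph n x \<and> \<not> spread n \<delta> \<rho> x \<longrightarrow> c0 * n < l1 R n A x))"
    by (rule spread_event) blast
  obtain C c :: real where C: "C > 0" and c: "c > 0" and ball:
    "\<And>n x \<mu> D s. \<lbrakk>lcd_ge n \<rho> \<mu> D x; s > 0; \<mu> \<ge> 0; D \<ge> 0; \<mu> * sqrt n \<le> s * D; exp (- c * \<mu>\<^sup>2 * n) \<le> s\<rbrakk>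
      \<Longrightarrow> anticoncentrated C n s x"
    by (rule small_ball_l1[OF c0(2)]) blast
  define L where "L = 6 * exp 2 * C * K"
  have L: "L > 0" using C K by (simp add: L_def)
  \<comment> \<open>\<open>b = C * s\<close> will be the probability per row. The net factor times
    \<open>b powr (1 + d)\<close> equals \<open>L * b powr d\<close>, made at most
    \<open>exp (- 1)\<close>; the bound \<open>2 * C * K\<close> gives
    \<open>h \<le> 1\<close>.\<close>
  define b where "b = min (min 1 (2 * C * K)) ((exp (- 1) / L) powr (1 / d))"
  have b: "0 < b" "b \<le> 1" "b \<le> 2 * C * K" using C K L by (auto simp: b_def)
  have bd: "L * b powr d \<le> exp (- 1)"
  proof -
    have "b powr d \<le> ((exp (- 1) / L) powr (1 / d)) powr d" using b d by (intro powr_mono2) (auto simp: b_def)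
    also have "\<dots> = exp (- 1) / L" using d L by (simp add: powr_powr)
    finally show ?thesis using L by (simp add: field_simps)
  qed
  define h where "h = b / (2 * C * K)"
  have h: "0 < h" "h \<le> 1" using b C K by (auto simp: h_def)
  define s where "s = 2 * K * h"
  have s: "s > 0" "C * s = b" using b(1) h(1) K C by (simp_all add: s_def, simp add: h_def)
  \<comment> \<open>Makes \<open>\<mu> * sqrt n \<le> s * D\<close> an equality for
    \<open>D = sqrt (\<delta> * n) / 2\<close>.\<close>
  define \<mu> where "\<mu> = s * sqrt \<delta> / 2"
  have \<mu>: "\<mu> > 0" using s c0 by (simp add: \<mu>_def)
  define c1 where "c1 = min c0 (K * h / 2)"
  have c1: "c1 > 0" using c0 K h by (simp add: c1_def)
  define q where "q = exp (- \<zeta> / 2)"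
  have q: "0 < q" "q < 1" using c0 by (auto simp: q_def)
  define e where "e = c * \<mu>\<^sup>2"
  have e: "e > 0" using c \<mu> by (simp add: e_def)
  have 1: "eventually (\<lambda>n::nat. exp (- e * real n) \<le> s) at_top" using e s(1) by real_asymp
  have 2: "eventually (\<lambda>n::nat. 3 * exp (- \<zeta> * real n) \<le> exp (- \<zeta> / 2 * real n)) at_top" using c0(4) by real_asymp
  from 1 2 have "eventually (\<lambda>n::nat. exp (- e * real n) \<le> s \<and> 3 * exp (- \<zeta> * real n) \<le> exp (- \<zeta> / 2 * real n) \<and> n \<ge> 1) at_top"
    using eventually_ge_at_top[of 1] by eventually_elim auto
  then obtain n1 where n1: "\<And>n. n \<ge> n1 \<Longrightarrow> exp (- e * real n) \<le> s \<and> 3 * exp (- \<zeta> * real n) \<le> exp (- \<zeta> / 2 * real n) \<and> n \<ge> 1"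
    by (auto simp: eventually_at_top_linorder)
  show ?thesis
  proof (rule that[OF c1 q, of n1])
    fix n N assume "n \<ge> n1" and N: "real n * (1 + d) \<le> real N" "N \<le> 2 * n"
    note n = n1[OF \<open>n \<ge> n1\<close>]
    define R where "R = {..<N}"
    have R: "finite R" "card R = N" by (auto simp: R_def)
    interpret P: prob_space "PR R n" by (rule prob_space_P)
    have sn: "sqrt n > 0" using n by simp
    have "real n * 1 \<le> real n * (1 + d)" using d by (intro mult_left_mono) auto
    then have "real n \<le> real N" using N(1) by linarith
    then have nN: "n \<le> N" by simp
    have nR: "n \<ge> 1" "n \<le> 2 * card R" "card R \<le> 2 * n" using n N nN R by auto
    define F where "F = int_points n (2 / h * n)"
    define X where "X = {x. sph n x \<and> spread n \<delta> \<rho> x}"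
    have fin: "finite F" unfolding F_def using card_int_points(1)[of 1] by simp
    have D0: "sqrt n / h > 0" using sn h by simp
    have net: "typically R n (card F * b ^ N) (\<lambda>A. op_bounded R n (K * n) A \<longrightarrow> (\<forall>x\<in>X. K * h / 2 * n < l1 R n A x))"
    proof (rule net_bound[OF R(1) fin D0, where r = "sqrt n / 2"])
      fix x assume "x \<in> X"
      then have x: "sph n x" "spread n \<delta> \<rho> x" by (auto simp: X_def)
      have "sqrt (dst2 n (\<lambda>j. sqrt n / h * x j)) \<le> sqrt (n / 4)" by (intro real_sqrt_le_mono dst2_le)
      also have "\<dots> = sqrt n / 2" by (simp add: real_sqrt_divide)
      finally have d: "L2_set (\<lambda>j. sqrt n / h * x j - of_int (round_vec n (\<lambda>j. sqrt n / h * x j) j)) {..<n} \<le> sqrt n / 2"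
        by (simp only: round_vec_dist)
      have "2 * (sqrt n / h) * sqrt n = 2 / h * (sqrt n * sqrt n)" by simp
      then have "2 * (sqrt n / h) * sqrt n \<le> 2 / h * n" by (simp only: real_sqrt_mult_self)
      then have "round_vec n (\<lambda>j. sqrt n / h * x j) \<in> F" unfolding F_def
        by (rule round_vec_int_points[OF x(1) less_imp_le[OF D0]])
      then show "\<exists>\<theta> p. sqrt n / h \<le> \<theta> \<and> \<theta> \<le> 2 * (sqrt n / h) \<and> p \<in> F \<and> L2_set (\<lambda>j. \<theta> * x j - of_int (p j)) {..<n} \<le> sqrt n / 2"
        using d D0 by (intro exI[of _ "sqrt n / h"] exI[of _ "round_vec n (\<lambda>j. sqrt n / h * x j)"] conjI) linarith+
      have "2 * (K * h / 2 * n) + 2 * (sqrt n / 2) * (K * n) / (sqrt n / h) = s * n"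
        using sn by (simp add: s_def)
      also have "\<dots> \<le> s * card R" using nN R s by (intro mult_left_mono) auto
      finally have le: "2 * (K * h / 2 * n) + 2 * (sqrt n / 2) * (K * n) / (sqrt n / h) \<le> s * card R" .
      have "\<P>(A in PR R n. l1 R n A x \<le> 2 * (K * h / 2 * n) + 2 * (sqrt n / 2) * (K * n) / (sqrt n / h))
        \<le> \<P>(A in PR R n. l1 R n A x \<le> s * card R)"
        using le measurable_l1[of R R n x] by (intro P.finite_measure_mono) auto
      also have "\<dots> \<le> (C * s) ^ card R"
      proof -
        have "anticoncentrated C n s x"
        proof (rule ball[OF _ s(1)])
          show "lcd_ge n \<rho> \<mu> (sqrt (\<delta> * n) / 2) x" using x c0 n by (intro spread_lcd_ge) auto
          show "\<mu> * sqrt n \<le> s * (sqrt (\<delta> * n) / 2)" by (simp add: \<mu>_def real_sqrt_mult)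
          show "exp (- c * \<mu>\<^sup>2 * n) \<le> s" using n by (simp add: e_def)
        qed (use \<mu> c0 in auto)
        then show ?thesis unfolding anticoncentrated_def using R(1) by blast
      qed
      finally show "\<P>(A in PR R n. l1 R n A x \<le> 2 * (K * h / 2 * n) + 2 * (sqrt n / 2) * (K * n) / (sqrt n / h)) \<le> b ^ N"
        using R s by simp
    qed (use K h b in auto)
    have "real (card F) \<le> exp (h * (2 / h * n)) * (1 + 2 / h) ^ n"
      unfolding F_def by (rule card_int_points(2)[OF h(1)])
    also have "exp (h * (2 / h * n)) = exp 2 ^ n" using h by (simp add: exp_of_nat2_mult)
    also have "(1 + 2 / h) ^ n \<le> (3 / h) ^ n" using h by (intro power_mono) (auto simp: field_simps)
    finally have cF: "real (card F) \<le> (3 * exp 2 / h) ^ n" by (simp add: power_mult_distrib power_divide mult_ac)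
    have bN: "b ^ N \<le> (b * b powr d) ^ n"
    proof -
      have "b ^ N = b powr N" using b by (simp add: powr_realpow)
      also have "\<dots> \<le> b powr (n * (1 + d))" using N b by (intro powr_mono') auto
      also have "\<dots> = (b powr (1 + d)) ^ n" using b by (simp add: powr_powr powr_realpow[symmetric] mult.commute)
      finally show ?thesis using b by (simp add: powr_add)
    qed
    have "card F * b ^ N \<le> (3 * exp 2 / h) ^ n * (b * b powr d) ^ n" using cF bN b by (intro mult_mono) auto
    also have "\<dots> = (3 * exp 2 / h * (b * b powr d)) ^ n" by (simp only: power_mult_distrib)
    also have "3 * exp 2 / h * (b * b powr d) = L * b powr d" using b C K by (simp add: h_def L_def)
    also have "(L * b powr d) ^ n \<le> exp (- 1) ^ n" using bd L b by (intro power_mono) auto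
    also have "\<dots> = exp (- real n)" by (simp add: exp_of_nat_mult[symmetric])
    finally have cFb: "card F * b ^ N \<le> exp (- real n)" .
    also have "\<dots> \<le> exp (- \<zeta> * n)" using c0 mult_right_mono[of \<zeta> 1 "real n"] by simp
    finally have "2 * exp (- \<zeta> * n) + card F * b ^ N \<le> 3 * exp (- \<zeta> * n)" by simp
    also have "\<dots> \<le> exp (- \<zeta> / 2 * n)" using n by blast
    also have "\<dots> = q ^ n" unfolding q_def by (rule exp_of_nat2_mult)
    finally have "typically R n (q ^ n) (\<lambda>A. \<forall>x. sph n x \<longrightarrow> c1 * n < l1 R n A x)"
    proof (rule typically_mono[OF typically_conj[OF sprd[OF nR(1) R(1) nR(2,3)] net]], intro allI impI)
      fix A x
      assume A: "(op_bounded R n (K * n) A \<and> (\<forall>x. sph n x \<and> \<not> spread n \<delta> \<rho> x \<longrightarrow> c0 * n < l1 R n A x)) \<and>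
          (op_bounded R n (K * n) A \<longrightarrow> (\<forall>x\<in>X. K * h / 2 * n < l1 R n A x))" and x: "sph n x"
      have "c1 * n \<le> c0 * n" "c1 * n \<le> K * h / 2 * n" by (intro mult_right_mono; simp add: c1_def)+
      moreover have "c0 * n < l1 R n A x \<or> K * h / 2 * n < l1 R n A x" using A x by (auto simp: X_def)
      ultimately show "c1 * n < l1 R n A x" by linarith
    qed
    then show "typically {..<N} n (q ^ n) (\<lambda>A. \<forall>x. sph n x \<longrightarrow> c1 * n < l1 {..<N} n A x)"
      unfolding R_def .
  qed
qed

end

section \<open>Measurability and conditioning on a set of rows\<close>

text \<open>Lists of rationals form a countable type. Every list gives a vector whatever its length,
  so the countable quantifiers carry no side condition.\<close>

definition rvec :: "rat list \<Rightarrow> nat \<Rightarrow> real" where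
  "rvec l j = of_rat (l ! j)"

lemma rvec_dense: "\<exists>l :: nat \<Rightarrow> rat list. \<forall>j<n. (\<lambda>k. rvec (l k) j) \<longlonglongrightarrow> x j"
proof -
  have "\<exists>q :: rat. x j < of_rat q \<and> of_rat q < x j + 1 / real (Suc k)" for j k
    by (rule of_rat_dense) simp
  then obtain q :: "nat \<Rightarrow> nat \<Rightarrow> rat" where q: "\<And>j k. x j < of_rat (q j k)" "\<And>j k. of_rat (q j k) < x j + 1 / real (Suc k)"
    by metis
  have "(\<lambda>k. rvec (map (\<lambda>j. q j k) [0..<n]) j) \<longlonglongrightarrow> x j" if "j < n" for j
  proof -
    have lim: "(\<lambda>k. of_rat (q j k) :: real) \<longlonglongrightarrow> x j"
    proof (rule tendsto_sandwich)
      show "(\<lambda>k. x j) \<longlonglongrightarrow> x j" by simp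
      have "(\<lambda>k. x j + 1 / real (Suc k)) \<longlonglongrightarrow> x j + 0"
        by (intro tendsto_add tendsto_const LIMSEQ_Suc lim_1_over_n)
      then show "(\<lambda>k. x j + 1 / real (Suc k)) \<longlonglongrightarrow> x j" by simp
      show "\<forall>\<^sub>F k in sequentially. x j \<le> of_rat (q j k)" using q(1) by (intro always_eventually) (auto intro: less_imp_le)
      show "\<forall>\<^sub>F k in sequentially. of_rat (q j k) \<le> x j + 1 / real (Suc k)" using q(2) by (intro always_eventually) (auto intro: less_imp_le)
    qed
    have "(\<lambda>k. rvec (map (\<lambda>j. q j k) [0..<n]) j) = (\<lambda>k. of_rat (q j k))"
      using that by (auto simp: rvec_def)
    then show ?thesis using lim by simp
  qed
  then show ?thesis by (intro exI[of _ "\<lambda>k. map (\<lambda>j. q j k) [0..<n]"]) auto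
qed

lemma tendsto_l1:
  assumes "\<And>j. j < n \<Longrightarrow> (\<lambda>k. y k j) \<longlonglongrightarrow> x j"
  shows "(\<lambda>k. l1 R n A (y k)) \<longlonglongrightarrow> l1 R n A x"
  unfolding l1_def mv_def using assms by (intro tendsto_intros) auto

lemma tendsto_L2:
  assumes "\<And>j. j < n \<Longrightarrow> (\<lambda>k. y k j) \<longlonglongrightarrow> x j"
  shows "(\<lambda>k. L2_set (y k) {..<n}) \<longlonglongrightarrow> L2_set x {..<n}"
  unfolding L2_set_def using assms by (intro tendsto_intros) auto

lemma sph_iff_L2: "sph n x \<longleftrightarrow> L2_set x {..<n} = 1"
  by (simp add: sph_def L2_set_def)

lemma L2_pos_normalize:
  assumes "L2_set x {..<n} > 0"
  shows "sph n (\<lambda>j. inverse (L2_set x {..<n}) * x j)"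
proof (rule sph_normalize)
  show "\<exists>j<n. x j \<noteq> 0" using assms by (rule contrapos_pp) (simp add: L2_set_def)
qed

text \<open>Bolzano-Weierstrass one coordinate at a time: compactness in the form suited to vectors
  encoded as functions on all naturals.\<close>

lemma coordinatewise_compact:
  fixes X :: "nat \<Rightarrow> nat \<Rightarrow> real"
  assumes "\<And>k j. j < n \<Longrightarrow> \<bar>X k j\<bar> \<le> 1"
  shows "\<exists>r x. strict_mono r \<and> (\<forall>j<n. (\<lambda>k. X (r k) j) \<longlonglongrightarrow> x j)"
  using assms
proof (induction n)
  case 0
  show ?case by (intro exI[of _ id]) (auto simp: strict_mono_def)
next
  case (Suc n)
  then obtain r x where r: "strict_mono r" "\<And>j. j < n \<Longrightarrow> (\<lambda>k. X (r k) j) \<longlonglongrightarrow> x j" by fastforce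
  have "bounded (range (\<lambda>k. X (r k) n))"
    using Suc.prems by (intro boundedI[of _ 1]) auto
  then obtain l s where s: "strict_mono s" "((\<lambda>k. X (r k) n) \<circ> s) \<longlonglongrightarrow> l"
    using bounded_imp_convergent_subsequence by blast
  show ?case
  proof (intro exI[of _ "r \<circ> s"] exI[of _ "x(n := l)"] conjI allI impI)
    show "strict_mono (r \<circ> s)" using r(1) s(1) by (simp add: strict_mono_def)
    fix j assume "j < Suc n"
    then consider "j < n" | "j = n" by linarith
    then show "(\<lambda>k. X ((r \<circ> s) k) j) \<longlonglongrightarrow> (x(n := l)) j"
    proof cases
      case 1
      then show ?thesis using LIMSEQ_subseq_LIMSEQ[OF r(2)[OF 1] s(1)] by (simp add: o_def)
    next
      case 2
      then show ?thesis using s(2) by (simp add: o_def)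
    qed
  qed
qed

lemma sph_abs_le: "sph n x \<Longrightarrow> j < n \<Longrightarrow> \<bar>x j\<bar> \<le> 1"
  using member_le_sum[of j "{..<n}" "\<lambda>j. (x j)\<^sup>2"] by (simp add: sph_def abs_square_le_1)

context real_law
begin

text \<open>The homogeneous form, with \<tau> multiplied by the Euclidean norm, is an open condition
  on \<open>x\<close> and can be tested on rational vectors, without asking for rational points of
  the sphere.\<close>

lemma measurable_ex_small:
  assumes \<tau>: "\<tau> > 0" and R: "R' \<subseteq> R"
  shows "{A \<in> space (PR R n). \<exists>x. sph n x \<and> l1 R' n A x < \<tau>} \<in> sets (PR R n)"
proof -
  have "(\<exists>x. sph n x \<and> l1 R' n A x < \<tau>) \<longleftrightarrow> (\<exists>l. l1 R' n A (rvec l) < \<tau> * L2_set (rvec l) {..<n})" for A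
  proof
    assume "\<exists>x. sph n x \<and> l1 R' n A x < \<tau>"
    then obtain x where x: "sph n x" "l1 R' n A x < \<tau>" by auto
    obtain l where l: "\<And>j. j < n \<Longrightarrow> (\<lambda>k. rvec (l k) j) \<longlonglongrightarrow> x j" using rvec_dense[of n x] by auto
    have "(\<lambda>k. \<tau> * L2_set (rvec (l k)) {..<n} - l1 R' n A (rvec (l k))) \<longlonglongrightarrow> \<tau> * L2_set x {..<n} - l1 R' n A x"
      by (intro tendsto_intros tendsto_L2 tendsto_l1 l)
    moreover have "\<tau> * L2_set x {..<n} - l1 R' n A x > 0" using x by (simp add: sph_iff_L2)
    ultimately have "\<forall>\<^sub>F k in sequentially. \<tau> * L2_set (rvec (l k)) {..<n} - l1 R' n A (rvec (l k)) > 0"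
      by (rule order_tendstoD)
    then obtain k where "\<tau> * L2_set (rvec (l k)) {..<n} - l1 R' n A (rvec (l k)) > 0"
      by (auto simp: eventually_sequentially)
    then show "\<exists>l. l1 R' n A (rvec l) < \<tau> * L2_set (rvec l) {..<n}" by (intro exI[of _ "l k"]) simp
  next
    assume "\<exists>l. l1 R' n A (rvec l) < \<tau> * L2_set (rvec l) {..<n}"
    then obtain l where l: "l1 R' n A (rvec l) < \<tau> * L2_set (rvec l) {..<n}" by auto
    then have "0 < \<tau> * L2_set (rvec l) {..<n}" using l1_nonneg[of R' n A "rvec l"] by linarith
    then have p: "L2_set (rvec l) {..<n} > 0" using \<tau> by (simp add: zero_less_mult_iff)
    let ?x = "\<lambda>j. inverse (L2_set (rvec l) {..<n}) * rvec l j"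
    have "l1 R' n A ?x = inverse (L2_set (rvec l) {..<n}) * l1 R' n A (rvec l)"
      using p by (subst l1_scale) simp
    also have "\<dots> < \<tau>" using p l by (simp add: field_simps)
    finally show "\<exists>x. sph n x \<and> l1 R' n A x < \<tau>" using L2_pos_normalize[OF p] by (intro exI[of _ ?x]) auto
  qed
  moreover have "{A \<in> space (PR R n). \<exists>l. l1 R' n A (rvec l) < \<tau> * L2_set (rvec l) {..<n}} \<in> sets (PR R n)"
  proof (rule sets.sets_Collect_countable_Ex)
    fix l
    show "{A \<in> space (PR R n). l1 R' n A (rvec l) < \<tau> * L2_set (rvec l) {..<n}} \<in> sets (PR R n)"
      using measurable_l1[OF R, of n "rvec l"] by measurable
  qed
  ultimately show ?thesis by simp
qed

text \<open>The complement asks for a unit kernel vector with l1 image at least \<tau>, a closed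
  condition. By compactness it is equivalent to the existence of rational approximate solutions of
  every accuracy \<open>1 / Suc k\<close>, a countable combination.\<close>

lemma measurable_kernel_small:
  assumes I: "I \<subseteq> R" and finI: "finite I"
  shows "{A \<in> space (PR R n). \<forall>x. sph n x \<longrightarrow> (\<forall>i\<in>I. mv n A x i = 0) \<longrightarrow> l1 R n A x < \<tau>} \<in> sets (PR R n)"
proof -
  define S where "S A k l \<longleftrightarrow> 0 < L2_set (rvec l) {..<n} \<and>
     l1 I n A (rvec l) \<le> 1 / real (Suc k) * L2_set (rvec l) {..<n} \<and>
     (\<tau> - 1 / real (Suc k)) * L2_set (rvec l) {..<n} \<le> l1 R n A (rvec l)" for A k l
  have "(\<exists>x. sph n x \<and> (\<forall>i\<in>I. mv n A x i = 0) \<and> \<tau> \<le> l1 R n A x) \<longleftrightarrow> (\<forall>k. \<exists>l. S A k l)" for A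
  proof
    assume "\<exists>x. sph n x \<and> (\<forall>i\<in>I. mv n A x i = 0) \<and> \<tau> \<le> l1 R n A x"
    then obtain x where x: "sph n x" "l1 I n A x = 0" "\<tau> \<le> l1 R n A x" by (auto simp: l1_def)
    obtain l where l: "\<And>j. j < n \<Longrightarrow> (\<lambda>k. rvec (l k) j) \<longlonglongrightarrow> x j" using rvec_dense[of n x] by auto
    note L = tendsto_L2[of n "\<lambda>k. rvec (l k)" x, OF l]
    show "\<forall>k. \<exists>l. S A k l"
    proof
      fix k
      have "(\<lambda>i. 1 / real (Suc k) * L2_set (rvec (l i)) {..<n} - l1 I n A (rvec (l i))) \<longlonglongrightarrow> 1 / real (Suc k) * L2_set x {..<n} - l1 I n A x"
        by (intro tendsto_intros L tendsto_l1 l)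
      moreover have "1 / real (Suc k) * L2_set x {..<n} - l1 I n A x > 0" using x by (simp add: sph_iff_L2)
      ultimately have 1: "\<forall>\<^sub>F i in sequentially. 1 / real (Suc k) * L2_set (rvec (l i)) {..<n} - l1 I n A (rvec (l i)) > 0"
        by (rule order_tendstoD)
      have "(\<lambda>i. l1 R n A (rvec (l i)) - (\<tau> - 1 / real (Suc k)) * L2_set (rvec (l i)) {..<n}) \<longlonglongrightarrow> l1 R n A x - (\<tau> - 1 / real (Suc k)) * L2_set x {..<n}"
        by (intro tendsto_intros L tendsto_l1 l)
      moreover have "l1 R n A x - (\<tau> - 1 / real (Suc k)) * L2_set x {..<n} > 0"
      proof -
        have "0 < 1 / real (Suc k)" by simp
        then have "0 < l1 R n A x - (\<tau> - 1 / real (Suc k))" using x by linarith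
        then show ?thesis using x by (simp only: sph_iff_L2 mult_1_right)
      qed
      ultimately have 2: "\<forall>\<^sub>F i in sequentially. l1 R n A (rvec (l i)) - (\<tau> - 1 / real (Suc k)) * L2_set (rvec (l i)) {..<n} > 0"
        by (rule order_tendstoD)
      have "L2_set x {..<n} > 0" using x by (simp add: sph_iff_L2)
      with L have 3: "\<forall>\<^sub>F i in sequentially. L2_set (rvec (l i)) {..<n} > 0" by (rule order_tendstoD)
      from 1 2 3 have "\<forall>\<^sub>F i in sequentially. S A k (l i)"
        unfolding S_def by eventually_elim linarith
      then show "\<exists>l. S A k l" by (auto simp: eventually_sequentially)
    qed
  next
    assume "\<forall>k. \<exists>l. S A k l"
    then obtain l where l: "\<And>k. S A k (l k)" by metis
    define X where "X k j = inverse (L2_set (rvec (l k)) {..<n}) * rvec (l k) j" for k j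
    have p: "0 < L2_set (rvec (l k)) {..<n}" for k using l[of k] by (simp add: S_def)
    have X: "sph n (X k)" for k unfolding X_def by (rule L2_pos_normalize[OF p])
    have XI: "l1 I n A (X k) \<le> 1 / real (Suc k)" for k
    proof -
      have "l1 I n A (X k) = inverse (L2_set (rvec (l k)) {..<n}) * l1 I n A (rvec (l k))"
        unfolding X_def using p[of k] by (subst l1_scale) simp
      also have "\<dots> \<le> inverse (L2_set (rvec (l k)) {..<n}) * (1 / real (Suc k) * L2_set (rvec (l k)) {..<n})"
        using l[of k] p[of k] by (intro mult_left_mono) (auto simp: S_def)
      also have "\<dots> = 1 / real (Suc k)" using p[of k] by simp
      finally show ?thesis .
    qed
    have XR: "\<tau> - 1 / real (Suc k) \<le> l1 R n A (X k)" for k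
    proof -
      have "\<tau> - 1 / real (Suc k) = inverse (L2_set (rvec (l k)) {..<n}) * ((\<tau> - 1 / real (Suc k)) * L2_set (rvec (l k)) {..<n})"
        using p[of k] by simp
      also have "\<dots> \<le> inverse (L2_set (rvec (l k)) {..<n}) * l1 R n A (rvec (l k))"
        using l[of k] p[of k] by (intro mult_left_mono) (auto simp: S_def)
      also have "\<dots> = l1 R n A (X k)"
        unfolding X_def using p[of k] by (subst l1_scale) simp
      finally show ?thesis .
    qed
    obtain r x where r: "strict_mono r" and lim: "\<And>j. j < n \<Longrightarrow> (\<lambda>k. X (r k) j) \<longlonglongrightarrow> x j"
      using coordinatewise_compact[of n X] X sph_abs_le by blast
    have small: "(\<lambda>k. 1 / real (Suc (r k))) \<longlonglongrightarrow> 0"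
      using LIMSEQ_subseq_LIMSEQ[OF LIMSEQ_Suc[OF lim_1_over_n] r] by (simp add: o_def)
    have "(\<lambda>k. L2_set (X (r k)) {..<n}) \<longlonglongrightarrow> L2_set x {..<n}" by (intro tendsto_L2 lim)
    then have "L2_set x {..<n} = 1" using X by (simp add: sph_iff_L2 LIMSEQ_const_iff)
    then have "sph n x" by (simp add: sph_iff_L2)
    moreover have "\<forall>i\<in>I. mv n A x i = 0"
    proof -
      have "l1 I n A x \<le> 0"
        by (rule LIMSEQ_le[OF tendsto_l1[OF lim] small]) (use XI in auto)
      then have "l1 I n A x = 0" using l1_nonneg[of I n A x] by linarith
      then show ?thesis using finI by (simp add: l1_def sum_nonneg_eq_0_iff)
    qed
    moreover have "\<tau> \<le> l1 R n A x"
    proof -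
      have "(\<lambda>k. \<tau> - 1 / real (Suc (r k))) \<longlonglongrightarrow> \<tau> - 0" by (intro tendsto_intros small)
      then have "\<tau> - 0 \<le> l1 R n A x"
        by (rule LIMSEQ_le[OF _ tendsto_l1[OF lim]]) (use XR in auto)
      then show ?thesis by simp
    qed
    ultimately show "\<exists>x. sph n x \<and> (\<forall>i\<in>I. mv n A x i = 0) \<and> \<tau> \<le> l1 R n A x" by blast
  qed
  then have eq: "(\<forall>x. sph n x \<longrightarrow> (\<forall>i\<in>I. mv n A x i = 0) \<longrightarrow> l1 R n A x < \<tau>) \<longleftrightarrow> \<not> (\<forall>k. \<exists>l. S A k l)" for A
    by (meson not_less)
  have "{A \<in> space (PR R n). \<forall>k. \<exists>l. S A k l} \<in> sets (PR R n)"
  proof (intro sets.sets_Collect_countable_All sets.sets_Collect_countable_Ex)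
    fix k l
    show "{A \<in> space (PR R n). S A k l} \<in> sets (PR R n)"
      unfolding S_def using measurable_l1[OF I, of n "rvec l"] measurable_l1[of R R n "rvec l"] by measurable
  qed
  then show ?thesis unfolding eq by (rule sets.sets_Collect_neg)
qed

text \<open>Conditioning on the rows in \<open>I\<close> by Fubini. As the event speaks of all unit
  kernel vectors, for each fixed choice of these rows it implies the event for one kernel vector and
  the independent rows outside \<open>I\<close>.\<close>

lemma kernel_small_prob:
  assumes I: "I \<subseteq> {..<N}" "card I < n" and \<beta>: "0 \<le> \<beta>"
    and ball: "typically I n q (\<lambda>A. \<forall>x. sph n x \<and> (\<forall>i\<in>I. mv n A x i = 0) \<longrightarrow>
      \<P>(B in PR ({..<N} - I) n. l1 ({..<N} - I) n B x \<le> \<tau>) \<le> \<beta>)"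
  shows "\<P>(A in PR {..<N} n. \<forall>x. sph n x \<longrightarrow> (\<forall>i\<in>I. mv n A x i = 0) \<longrightarrow> l1 {..<N} n A x < \<tau>) \<le> q + \<beta>"
proof -
  obtain Bad where Bad: "Bad \<in> sets (PR I n)" "measure (PR I n) Bad \<le> q"
    "\<And>A x. A \<in> space (PR I n) - Bad \<Longrightarrow> sph n x \<Longrightarrow> (\<forall>i\<in>I. mv n A x i = 0) \<Longrightarrow>
      \<P>(B in PR ({..<N} - I) n. l1 ({..<N} - I) n B x \<le> \<tau>) \<le> \<beta>"
    using ball unfolding typically_def by blast
  interpret pp: product_prob_space "\<lambda>_. M" "UNIV :: (nat \<times> nat) set" by (rule product_P)
  define J where "J = {..<N} - I"
  interpret PI: prob_space "PR I n" by (rule prob_space_P)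
  interpret PJ: prob_space "PR J n" by (rule prob_space_P)
  interpret PN: prob_space "PR {..<N} n" by (rule prob_space_P)
  have fin: "finite I" "finite J" using I finite_subset by (auto simp: J_def)
  have un: "{..<N} \<times> {..<n} = (I \<times> {..<n}) \<union> (J \<times> {..<n})" using I by (auto simp: J_def)
  have disj: "(I \<times> {..<n}) \<inter> (J \<times> {..<n}) = {}" by (auto simp: J_def)
  define G where "G = {A \<in> space (PR {..<N} n). \<forall>x. sph n x \<longrightarrow> (\<forall>i\<in>I. mv n A x i = 0) \<longrightarrow> l1 {..<N} n A x < \<tau>}"
  have G: "G \<in> sets (PR {..<N} n)" unfolding G_def by (rule measurable_kernel_small[OF I(1) fin(1)])
  have fold: "(\<integral>\<^sup>+A. indicator G A \<partial>PR {..<N} n) =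
    (\<integral>\<^sup>+A. \<integral>\<^sup>+B. indicator G (merge (I \<times> {..<n}) (J \<times> {..<n}) (A, B)) \<partial>PR J n \<partial>PR I n)"
    unfolding un by (rule pp.product_nn_integral_fold[OF disj]) (use fin G un in auto)
  have "ennreal (measure (PR {..<N} n) G) = (\<integral>\<^sup>+A. indicator G A \<partial>PR {..<N} n)"
    by (simp only: nn_integral_indicator[OF G] PN.emeasure_eq_measure)
  also have "\<dots> \<le> (\<integral>\<^sup>+A. indicator Bad A + ennreal \<beta> \<partial>PR I n)"
    unfolding fold
  proof (rule nn_integral_mono)
    fix A assume A: "A \<in> space (PR I n)"
    show "(\<integral>\<^sup>+B. indicator G (merge (I \<times> {..<n}) (J \<times> {..<n}) (A, B)) \<partial>PR J n) \<le> indicator Bad A + ennreal \<beta>"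
    proof (cases "A \<in> Bad")
      case True
      have "(\<integral>\<^sup>+B. indicator G (merge (I \<times> {..<n}) (J \<times> {..<n}) (A, B)) \<partial>PR J n) \<le> (\<integral>\<^sup>+B. 1 \<partial>PR J n)"
        by (intro nn_integral_mono) (auto simp: indicator_def)
      also have "\<dots> = 1" using PJ.emeasure_space_1 by simp
      also have "1 \<le> indicator Bad A + ennreal \<beta>" using True by simp
      finally show ?thesis .
    next
      case False
      obtain x where x: "sph n x" "\<forall>i\<in>I. mv n A x i = 0" using kernel_sph[OF fin(1) I(2)] by blast
      define S where "S = {B \<in> space (PR J n). l1 J n B x \<le> \<tau>}"
      have S: "S \<in> sets (PR J n)" unfolding S_def using measurable_l1[of J J n x] by measurable
      have "(\<integral>\<^sup>+B. indicator G (merge (I \<times> {..<n}) (J \<times> {..<n}) (A, B)) \<partial>PR J n) \<le> (\<integral>\<^sup>+B. indicator S B \<partial>PR J n)"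
      proof (rule nn_integral_mono)
        fix B assume B: "B \<in> space (PR J n)"
        let ?m = "merge (I \<times> {..<n}) (J \<times> {..<n}) (A, B)"
        have "B \<in> S" if m: "?m \<in> G"
        proof -
          have mI: "mv n ?m x i = mv n A x i" if "i \<in> I" for i
            using that by (auto simp: mv_def merge_def intro!: sum.cong)
          have mJ: "mv n ?m x i = mv n B x i" if "i \<in> J" for i
            using that by (auto simp: mv_def merge_def J_def intro!: sum.cong)
          have "l1 {..<N} n ?m x < \<tau>" using m x mI by (auto simp: G_def)
          moreover have "l1 J n B x = l1 J n ?m x" by (simp add: l1_def mJ)
          moreover have "l1 J n ?m x \<le> l1 {..<N} n ?m x"
            unfolding l1_def by (intro sum_mono2) (auto simp: J_def)
          ultimately show ?thesis using B by (simp add: S_def)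
        qed
        then show "indicator G ?m \<le> (indicator S B :: ennreal)" by (auto simp: indicator_def)
      qed
      also have "\<dots> = ennreal (measure (PR J n) S)"
        by (simp only: nn_integral_indicator[OF S] PJ.emeasure_eq_measure)
      also have "\<dots> \<le> ennreal \<beta>"
        using Bad(3)[of A x] A False x unfolding J_def[symmetric] S_def by (intro ennreal_leI) auto
      finally show ?thesis by (rule order_trans) simp
    qed
  qed
  also have "\<dots> = emeasure (PR I n) Bad + ennreal \<beta>"
    using Bad(1) by (subst nn_integral_add) (auto simp: PI.emeasure_space_1)
  also have "\<dots> = ennreal (measure (PR I n) Bad + \<beta>)"
    using \<beta> by (simp add: PI.emeasure_eq_measure)
  finally have "measure (PR {..<N} n) G \<le> measure (PR I n) Bad + \<beta>"
    using \<beta> by (subst (asm) ennreal_le_iff) auto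
  then show ?thesis using Bad(2) unfolding G_def by linarith
qed

text \<open>Otherwise each point of \<open>S\<close> has a null ball around it; by Lindelof
  countably many of these cover \<open>S\<close>, which would then be null.\<close>

lemma support_point:
  assumes S: "S \<in> sets borel" "\<not> (AE x in M. x \<notin> S)"
  obtains a where "a \<in> S" "\<And>\<eta>. \<eta> > 0 \<Longrightarrow> 0 < measure M (ball a \<eta>)"
proof -
  have "\<exists>a\<in>S. \<forall>\<eta>>0. 0 < measure M (ball a \<eta>)"
  proof (rule ccontr)
    assume "\<not> ?thesis"
    then have "\<forall>a\<in>S. \<exists>\<eta>>0. measure M (ball a \<eta>) = 0"
      by (meson measure_nonneg order.antisym not_less)
    then obtain \<eta> where \<eta>: "\<And>a. a \<in> S \<Longrightarrow> \<eta> a > 0" "\<And>a. a \<in> S \<Longrightarrow> measure M (ball a (\<eta> a)) = 0"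
      by metis
    obtain F where F: "F \<subseteq> (\<lambda>a. ball a (\<eta> a)) ` S" "countable F" "\<Union>F = \<Union>((\<lambda>a. ball a (\<eta> a)) ` S)"
      using Lindelof[of "(\<lambda>a. ball a (\<eta> a)) ` S"] by auto
    have null: "T \<in> null_sets M" if "T \<in> F" for T
    proof -
      have "T \<in> (\<lambda>a. ball a (\<eta> a)) ` S" using that F(1) by blast
      then obtain a where a: "a \<in> S" "T = ball a (\<eta> a)" by blast
      have "T \<in> sets M" using a by (simp add: sets_M)
      then show ?thesis using \<eta>(2)[OF a(1)] a(2) by (intro null_setsI) (auto simp: emeasure_eq_measure)
    qed
    have "\<Union>F \<in> null_sets M" using null_sets_UN'[OF F(2), of "\<lambda>T. T" M] null by simp
    then have "AE x in M. x \<notin> \<Union>F" by (rule AE_not_in)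
    then have "AE x in M. x \<notin> S"
    proof (rule AE_mp, intro AE_I2 impI)
      fix x assume "x \<notin> \<Union>F"
      then show "x \<notin> S" unfolding F(3) using \<eta>(1) by force
    qed
    then show False using S(2) by simp
  qed
  then show ?thesis using that by blast
qed

end

text \<open>Subtracting consecutive rows shows that the matrix with \<open>a\<close> on and below the diagonal and
  \<open>b\<close> above it is injective as soon as \<open>a\<close> is nonzero and different from \<open>b\<close>.\<close>

lemma staircase_bound:
  fixes a b :: real
  assumes a: "a \<noteq> 0" "a \<noteq> b" and n: "1 \<le> n" "n \<le> N" and x: "sph n x"
  defines "c \<equiv> 1 / ((real n + 1) * (2 / \<bar>a - b\<bar> + 1 / \<bar>a\<bar> + \<bar>b\<bar> * n * 2 / \<bar>a - b\<bar> / \<bar>a\<bar>))"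
  shows "c \<le> l1 {..<N} n (\<lambda>(i, j). if j \<le> i then a else b) x"
proof -
  define Z where "Z = (\<lambda>(i :: nat, j :: nat). if j \<le> i then a else b)"
  define L where "L = l1 {..<N} n Z x"
  define u where "u = 2 / \<bar>a - b\<bar>"
  define v where "v = 1 / \<bar>a\<bar> + \<bar>b\<bar> * n * 2 / \<bar>a - b\<bar> / \<bar>a\<bar>"
  have u: "u > 0" using a by (simp add: u_def)
  have v: "v > 0" using a by (simp add: v_def add_pos_nonneg)
  have L0: "L \<ge> 0" by (simp add: L_def l1_nonneg)
  have le: "\<bar>mv n Z x i\<bar> \<le> L" if "i < N" for i
    unfolding L_def l1_def using that by (intro member_le_sum) auto
  have xS: "\<bar>x (Suc i)\<bar> \<le> u * L" if i: "Suc i < n" for i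
  proof -
    have "mv n Z x (Suc i) - mv n Z x i = (\<Sum>j<n. (Z (Suc i, j) - Z (i, j)) * x j)"
      by (simp add: mv_def sum_subtractf left_diff_distrib)
    also have "\<dots> = (\<Sum>j\<in>{Suc i}. (Z (Suc i, j) - Z (i, j)) * x j)"
      using i by (intro sum.mono_neutral_right) (auto simp: Z_def)
    finally have "(a - b) * x (Suc i) = mv n Z x (Suc i) - mv n Z x i" by (simp add: Z_def)
    then have "\<bar>(a - b) * x (Suc i)\<bar> \<le> 2 * L"
      using le[of i] le[of "Suc i"] i n by linarith
    then have "\<bar>a - b\<bar> * \<bar>x (Suc i)\<bar> \<le> 2 * L" by (simp only: abs_mult)
    then show ?thesis using a by (simp add: u_def field_simps)
  qed
  \<comment> \<open>Row 0 expresses \<open>x 0\<close> through the other coordinates, which are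
    already bounded by the differences of consecutive rows.\<close>
  have x0: "\<bar>x 0\<bar> \<le> v * L"
  proof -
    have sp: "{..<n} = insert 0 {1..<n}" using n by auto
    have "mv n Z x 0 = a * x 0 + (\<Sum>j\<in>{1..<n}. b * x j)"
      unfolding mv_def sp by (subst sum.insert) (auto simp: Z_def)
    then have "a * x 0 = mv n Z x 0 - (\<Sum>j\<in>{1..<n}. b * x j)" by simp
    moreover have "\<bar>\<Sum>j\<in>{1..<n}. b * x j\<bar> \<le> \<bar>b\<bar> * n * (u * L)"
    proof -
      have "\<bar>\<Sum>j\<in>{1..<n}. b * x j\<bar> \<le> (\<Sum>j\<in>{1..<n}. \<bar>b * x j\<bar>)" by (rule sum_abs)
      also have "\<dots> \<le> (\<Sum>j\<in>{1..<n}. \<bar>b\<bar> * (u * L))"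
      proof (rule sum_mono)
        fix j assume "j \<in> {1..<n}"
        then have "\<bar>x j\<bar> \<le> u * L" using xS[of "j - 1"] by simp
        then show "\<bar>b * x j\<bar> \<le> \<bar>b\<bar> * (u * L)" unfolding abs_mult by (intro mult_left_mono) auto
      qed
      also have "\<dots> \<le> n * (\<bar>b\<bar> * (u * L))" using u L0 by (auto intro!: mult_right_mono)
      finally show ?thesis by (simp add: mult_ac)
    qed
    moreover have "\<bar>mv n Z x 0\<bar> \<le> L" using le[of 0] n by simp
    ultimately have "\<bar>a * x 0\<bar> \<le> L + \<bar>b\<bar> * n * (u * L)" by linarith
    then have "\<bar>a\<bar> * \<bar>x 0\<bar> \<le> L + \<bar>b\<bar> * n * (u * L)" by (simp only: abs_mult)
    then have "\<bar>x 0\<bar> \<le> (L + \<bar>b\<bar> * n * (u * L)) / \<bar>a\<bar>" using a by (simp add: field_simps)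
    also have "\<dots> = v * L" by (simp add: v_def u_def add_divide_distrib ring_distribs)
    finally show ?thesis .
  qed
  have all: "\<bar>x j\<bar> \<le> (u + v) * L" if "j < n" for j
  proof -
    have "0 \<le> u * L" "0 \<le> v * L" using u v L0 by auto
    then show ?thesis using xS[of "j - 1"] x0 that by (cases j) (auto simp: ring_distribs)
  qed
  have "1 = L2_set x {..<n}" using x by (simp add: sph_iff_L2)
  also have "\<dots> \<le> (\<Sum>j<n. \<bar>x j\<bar>)" by (rule L2_set_le_sum_abs)
  also have "\<dots> \<le> (\<Sum>j<n. (u + v) * L)" using all by (intro sum_mono) auto
  also have "\<dots> \<le> (real n + 1) * ((u + v) * L)" using u v L0 by (auto intro!: mult_right_mono)
  finally have "1 \<le> ((real n + 1) * (u + v)) * L" by (simp add: mult_ac)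
  moreover have "(real n + 1) * (u + v) > 0" using u v by simp
  ultimately have "1 / ((real n + 1) * (u + v)) \<le> L" by (simp add: field_simps)
  moreover have "c = 1 / ((real n + 1) * (u + v))" by (simp add: c_def u_def v_def add.assoc)
  ultimately show ?thesis by (simp add: L_def Z_def)
qed

context subgaussian_law
begin

text \<open>For a fixed size one injective matrix with entries in the support suffices. A nonzero
  support point and a second one different from it form a staircase matrix; the matrices close to it
  have positive probability and keep half of its lower bound.\<close>

lemma fixed_size_bound:
  assumes n: "1 \<le> n" "n \<le> N"
  obtains t c :: real where "t > 0" "0 < c" "c < 1"
    "\<And>\<tau>. \<tau> \<le> t \<Longrightarrow> \<tau> > 0 \<Longrightarrow> \<P>(A in PR {..<N} n. \<exists>x. sph n x \<and> l1 {..<N} n A x < \<tau>) \<le> c"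
proof -
  interpret PN: prob_space "PR {..<N} n" by (rule prob_space_P)
  interpret pp: product_prob_space "\<lambda>_. M" "UNIV :: (nat \<times> nat) set" by (rule product_P)
  obtain a where a: "a \<in> - {0}" "\<And>\<eta>. \<eta> > 0 \<Longrightarrow> 0 < measure M (ball a \<eta>)"
    by (rule support_point[of "- {0}"]) (use not_AE_const[of 0] in auto)
  obtain b where b: "b \<in> - {a}" "\<And>\<eta>. \<eta> > 0 \<Longrightarrow> 0 < measure M (ball b \<eta>)"
    by (rule support_point[of "- {a}"]) (use not_AE_const[of a] in auto)
  have ab: "a \<noteq> 0" "a \<noteq> b" using a b by auto
  define Z where "Z = (\<lambda>(i :: nat, j :: nat). if j \<le> i then a else b)"
  define t0 where "t0 = 1 / ((real n + 1) * (2 / \<bar>a - b\<bar> + 1 / \<bar>a\<bar> + \<bar>b\<bar> * n * 2 / \<bar>a - b\<bar> / \<bar>a\<bar>))"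
  have t0: "t0 > 0" using ab n unfolding t0_def
    by (intro divide_pos_pos mult_pos_pos add_pos_nonneg) auto
  \<comment> \<open>An error \<eta> per entry changes the l1 norm of the image of a unit vector by
    at most \<open>N * n * \<eta> = t0 / 2\<close>.\<close>
  define \<eta> where "\<eta> = t0 / (2 * (real N * real n))"
  have \<eta>: "\<eta> > 0" using t0 n by (simp add: \<eta>_def)
  define S where "S = (\<Pi>\<^sub>E k\<in>{..<N} \<times> {..<n}. ball (Z k) \<eta>)"
  have S: "S \<in> sets (PR {..<N} n)" unfolding S_def
    by (intro sets_PiM_I_finite) (auto simp: sets_M)
  have "emeasure (PR {..<N} n) S = (\<Prod>k\<in>{..<N} \<times> {..<n}. emeasure M (ball (Z k) \<eta>))"
    unfolding S_def by (rule pp.emeasure_PiM) (auto simp: sets_M)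
  also have "\<dots> = ennreal (\<Prod>k\<in>{..<N} \<times> {..<n}. measure M (ball (Z k) \<eta>))"
    by (simp add: emeasure_eq_measure prod_ennreal)
  finally have mS: "measure (PR {..<N} n) S = (\<Prod>k\<in>{..<N} \<times> {..<n}. measure M (ball (Z k) \<eta>))"
    by (simp add: PN.emeasure_eq_measure prod_nonneg)
  also have "\<dots> > 0" using a(2)[OF \<eta>] b(2)[OF \<eta>] by (intro prod_pos) (auto simp: Z_def)
  finally have S0: "0 < measure (PR {..<N} n) S" .
  have sub: "{A \<in> space (PR {..<N} n). \<exists>x. sph n x \<and> l1 {..<N} n A x < \<tau>} \<subseteq> space (PR {..<N} n) - S"
    if \<tau>: "\<tau> \<le> t0 / 2" for \<tau>
  proof
    fix A assume "A \<in> {A \<in> space (PR {..<N} n). \<exists>x. sph n x \<and> l1 {..<N} n A x < \<tau>}"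
    then obtain x where A: "A \<in> space (PR {..<N} n)" and x: "sph n x" "l1 {..<N} n A x < \<tau>" by auto
    have "A \<notin> S"
    proof
      assume "A \<in> S"
      then have near: "\<bar>Z (i, j) - A (i, j)\<bar> \<le> \<eta>" if "i < N" "j < n" for i j
        using that by (auto simp: S_def PiE_iff dist_real_def intro: less_imp_le)
      have "t0 \<le> l1 {..<N} n Z x" unfolding t0_def Z_def by (rule staircase_bound[OF ab n x(1)])
      also have "\<dots> \<le> (\<Sum>i<N. \<bar>mv n A x i\<bar> + real n * \<eta>)"
        unfolding l1_def
      proof (rule sum_mono)
        fix i assume i: "i \<in> {..<N}"
        have "mv n Z x i = mv n A x i + (\<Sum>j<n. (Z (i, j) - A (i, j)) * x j)"
          by (simp add: mv_def left_diff_distrib sum_subtractf)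
        moreover have "\<bar>\<Sum>j<n. (Z (i, j) - A (i, j)) * x j\<bar> \<le> (\<Sum>j<n. \<eta> * 1)"
        proof (rule order_trans[OF sum_abs], rule sum_mono)
          fix j assume "j \<in> {..<n}"
          then show "\<bar>(Z (i, j) - A (i, j)) * x j\<bar> \<le> \<eta> * 1"
            unfolding abs_mult using near[of i j] i sph_abs_le[OF x(1), of j] by (intro mult_mono) auto
        qed
        ultimately show "\<bar>mv n Z x i\<bar> \<le> \<bar>mv n A x i\<bar> + real n * \<eta>" by (simp add: mult.commute)
      qed
      also have "\<dots> = l1 {..<N} n A x + real N * (real n * \<eta>)" by (simp add: l1_def sum.distrib)
      also have "real N * (real n * \<eta>) = t0 / 2" using n by (simp add: \<eta>_def)
      finally show False using x \<tau> by simp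
    qed
    then show "A \<in> space (PR {..<N} n) - S" using A by simp
  qed
  \<comment> \<open>The maximum with 1/2 guarantees \<open>c > 0\<close>.\<close>
  define c where "c = max (1 / 2) (1 - measure (PR {..<N} n) S)"
  have c: "0 < c" "c < 1" using S0 by (auto simp: c_def)
  show ?thesis
  proof (rule that[of "t0 / 2" c])
    fix \<tau> :: real assume \<tau>: "\<tau> \<le> t0 / 2" "\<tau> > 0"
    have "\<P>(A in PR {..<N} n. \<exists>x. sph n x \<and> l1 {..<N} n A x < \<tau>)
      \<le> measure (PR {..<N} n) (space (PR {..<N} n) - S)"
      using sub[OF \<tau>(1)] S by (intro PN.finite_measure_mono) auto
    also have "\<dots> = 1 - measure (PR {..<N} n) S" using S by (rule PN.prob_compl)
    finally show "\<P>(A in PR {..<N} n. \<exists>x. sph n x \<and> l1 {..<N} n A x < \<tau>) \<le> c"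
      by (simp add: c_def)
  qed (use t0 c in auto)
qed

end

section \<open>The union bound over sets of rows\<close>

lemma power_div_fact_le_exp: "x ^ n / fact n \<le> exp x" if "0 \<le> x" for x :: real
proof -
  have s: "(\<lambda>n. x ^ n /\<^sub>R fact n) sums exp x" by (rule exp_converges)
  have "(\<Sum>k\<in>{n}. x ^ k /\<^sub>R fact k) \<le> (\<Sum>k. x ^ k /\<^sub>R fact k)"
    using that sums_summable[OF s] by (intro sum_le_suminf) auto
  then show ?thesis using sums_unique[OF s] by (simp add: divide_inverse mult.commute)
qed

lemma choose_le_exp:
  assumes "1 \<le> m"
  shows "real (N choose m) \<le> (exp 1 * real N / real m) ^ m"
proof -
  have "real ((N choose m) * fact m) \<le> real (N ^ m)"
    by (rule of_nat_mono) (rule binomial_fact_pow)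
  then have 1: "real (N choose m) * fact m \<le> real N ^ m" by simp
  have "real m ^ m / fact m \<le> exp (real m)" by (rule power_div_fact_le_exp) simp
  then have "real m ^ m \<le> exp (real m) * fact m" by (simp add: field_simps)
  also have "exp (real m) = exp 1 ^ m" by (simp add: exp_of_nat_mult[symmetric])
  finally have "real (N choose m) * real m ^ m \<le> real (N choose m) * (exp 1 ^ m * fact m)"
    by (intro mult_left_mono) auto
  also have "\<dots> = exp 1 ^ m * (real (N choose m) * fact m)" by simp
  also have "\<dots> \<le> exp 1 ^ m * real N ^ m" using 1 by (intro mult_left_mono) auto
  finally show ?thesis using assms by (simp add: power_divide power_mult_distrib field_simps)
qed

text \<open>A single term of the binomial expansion. With a small fixed \<open>x\<close> it bounds
  the coefficient by \<open>exp\<close> of a small multiple of \<open>n\<close> when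
  \<open>m\<close> is a small part of \<open>n\<close>, where \<open>choose_le_exp\<close> would not
  give a rate directly.\<close>

lemma choose_mult_power_le:
  fixes x :: real
  assumes "0 \<le> x" "m \<le> N"
  shows "real (N choose m) * x ^ m \<le> (1 + x) ^ N"
proof -
  have "real (N choose m) * x ^ m * 1 ^ (N - m) \<le> (\<Sum>k\<le>N. real (N choose k) * x ^ k * 1 ^ (N - k))"
    using assms by (intro member_le_sum[where f = "\<lambda>k. real (N choose k) * x ^ k * 1 ^ (N - k)"]) auto
  also have "\<dots> = (x + 1) ^ N" by (rule binomial_ring[symmetric])
  finally show ?thesis by (simp add: add.commute)
qed

context subgaussian_law
begin

definition small_event :: "nat \<Rightarrow> nat \<Rightarrow> real \<Rightarrow> (nat \<times> nat \<Rightarrow> real) set" where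
  "small_event N n \<tau> = {A \<in> space (PR {..<N} n). \<exists>x. sph n x \<and> l1 {..<N} n A x < \<tau>}"

lemma sets_small_event: "\<tau> > 0 \<Longrightarrow> small_event N n \<tau> \<in> sets (PR {..<N} n)"
  unfolding small_event_def by (rule measurable_ex_small) auto

text \<open>The target estimate for a single size, with \<epsilon> quantified inside: constants
  found for different ranges of sizes can then be merged by \<open>bounded_by_mono\<close>.\<close>

definition bounded_by :: "real \<Rightarrow> real \<Rightarrow> nat \<Rightarrow> nat \<Rightarrow> bool" where
  "bounded_by C c n N \<longleftrightarrow> (\<forall>\<epsilon>>0. measure (PR {..<N} n) (small_event N n (\<epsilon> * real (N - n + 1)))
      \<le> (C * real N / real (N - n + 1) * \<epsilon>) ^ (N - n + 1) + c ^ n)"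

lemma bounded_by_mono:
  assumes "bounded_by C c n N" "0 < C" "C \<le> C'" "0 < c" "c \<le> c'"
  shows "bounded_by C' c' n N"
  unfolding bounded_by_def
proof (intro allI impI)
  fix \<epsilon> :: real assume \<epsilon>: "\<epsilon> > 0"
  have "(C * real N / real (N - n + 1) * \<epsilon>) ^ (N - n + 1) \<le> (C' * real N / real (N - n + 1) * \<epsilon>) ^ (N - n + 1)"
    using assms \<epsilon> by (intro power_mono mult_right_mono divide_right_mono) auto
  moreover have "c ^ n \<le> c' ^ n" using assms by (intro power_mono) auto
  ultimately show "measure (PR {..<N} n) (small_event N n (\<epsilon> * real (N - n + 1)))
      \<le> (C' * real N / real (N - n + 1) * \<epsilon>) ^ (N - n + 1) + c' ^ n"
    using assms(1) \<epsilon> unfolding bounded_by_def by fastforce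
qed

text \<open>The extremal argument covers the event by one kernel event for each set of
  \<open>n - 1\<close> rows. A larger \<tau>' is allowed because the small ball estimate does not
  reach arbitrarily small scales.\<close>

lemma small_event_union_bound:
  assumes n: "1 \<le> n" "n \<le> N" and \<beta>: "0 \<le> \<beta>" and q: "0 \<le> q" and \<tau>: "\<tau> \<le> \<tau>'"
    and ker: "\<And>I. I \<subseteq> {..<N} \<Longrightarrow> card I = n - 1 \<Longrightarrow> typically I n q (\<lambda>A. \<forall>x. sph n x \<and> (\<forall>i\<in>I. mv n A x i = 0) \<longrightarrow>
        \<P>(B in PR ({..<N} - I) n. l1 ({..<N} - I) n B x \<le> \<tau>') \<le> \<beta>)"
  shows "measure (PR {..<N} n) (small_event N n \<tau>) \<le> real (N choose (N - n + 1)) * (q + \<beta>)"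
proof -
  interpret PN: prob_space "PR {..<N} n" by (rule prob_space_P)
  define \<I> where "\<I> = {I. I \<subseteq> {..<N} \<and> card I = n - 1}"
  define G where "G I = {A \<in> space (PR {..<N} n). \<forall>x. sph n x \<longrightarrow> (\<forall>i\<in>I. mv n A x i = 0) \<longrightarrow> l1 {..<N} n A x < \<tau>'}" for I
  have fin: "finite \<I>" by (simp add: \<I>_def)
  have fI: "finite I" if "I \<in> \<I>" for I using that finite_subset by (auto simp: \<I>_def)
  have G: "G I \<in> sets (PR {..<N} n)" if "I \<in> \<I>" for I
    using that fI[OF that] unfolding G_def by (intro measurable_kernel_small) (simp_all add: \<I>_def)
  have "small_event N n \<tau> \<subseteq> (\<Union>I\<in>\<I>. G I)"
  proof
    fix A assume "A \<in> small_event N n \<tau>"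
    then obtain x where A: "A \<in> space (PR {..<N} n)" and x: "sph n x" "l1 {..<N} n A x < \<tau>"
      by (auto simp: small_event_def)
    have "l1 {..<N} n A x < \<tau>'" using x \<tau> by linarith
    from extremal_rows[OF n(1) _ x(1) this] n
    obtain I where "I \<subseteq> {..<N}" "card I = n - 1" "\<forall>y. sph n y \<longrightarrow> (\<forall>i\<in>I. mv n A y i = 0) \<longrightarrow> l1 {..<N} n A y < \<tau>'"
      by auto
    then show "A \<in> (\<Union>I\<in>\<I>. G I)" using A by (auto simp: \<I>_def G_def)
  qed
  then have "measure (PR {..<N} n) (small_event N n \<tau>) \<le> measure (PR {..<N} n) (\<Union>I\<in>\<I>. G I)"
    using G fin by (intro PN.finite_measure_mono) auto
  also have "\<dots> \<le> (\<Sum>I\<in>\<I>. measure (PR {..<N} n) (G I))"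
    using G fin by (intro PN.finite_measure_subadditive_finite) auto
  also have "\<dots> \<le> (\<Sum>I\<in>\<I>. q + \<beta>)"
  proof (rule sum_mono)
    fix I assume "I \<in> \<I>"
    then have I: "I \<subseteq> {..<N}" "card I = n - 1" by (auto simp: \<I>_def)
    have "card I < n" using I n by simp
    then show "measure (PR {..<N} n) (G I) \<le> q + \<beta>"
      unfolding G_def by (rule kernel_small_prob[OF I(1) _ \<beta> ker[OF I]])
  qed
  also have "\<dots> = real (card \<I>) * (q + \<beta>)" by simp
  also have "card \<I> = N choose (n - 1)" unfolding \<I>_def by (subst n_subsets) auto
  also have "N choose (n - 1) = N choose (N - n + 1)"
    using n binomial_symmetric[of "n - 1" N] by (simp add: Suc_diff_le)
  finally show ?thesis .
qed

text \<open>The failure probability \<open>q ^ n\<close> of the kernel estimate gets multiplied by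
  the number of row sets, which is affordable for \<open>m \<le> d * n\<close> with small
  \<open>d\<close>.\<close>

lemma nearly_square_bound:
  obtains C c d :: real and n1 :: nat where "C > 0" "0 < c" "c < 1" "d > 0"
    "\<And>n N. \<lbrakk>n \<ge> n1; n \<le> N; N \<le> 2 * n; real (N - n + 1) \<le> d * real n\<rbrakk> \<Longrightarrow> bounded_by C c n N"
proof -
  obtain C r q :: real and n0 :: nat where C: "C > 0" and r: "0 < r" "r < 1" and q: "0 < q" "q < 1" and ker:
    "\<And>n R. \<lbrakk>n \<ge> n0; finite R; card R = n - 1\<rbrakk> \<Longrightarrow> typically R n (q ^ n)
      (\<lambda>A. \<forall>x. sph n x \<and> (\<forall>i\<in>R. mv n A x i = 0) \<longrightarrow> (\<forall>s. r ^ n \<le> s \<longrightarrow> anticoncentrated C n s x))"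
    by (rule kernel_small_ball) blast
  \<comment> \<open>\<open>q ^ n = exp (- 4 * \<xi> * n)\<close>. The binomial coefficient costs
    \<open>2 * \<xi> * n\<close> in the exponent, half for \<open>(1 + y) ^ N\<close> and half for
    \<open>y ^ m\<close>.\<close>
  define \<xi> where "\<xi> = - ln q / 4"
  have \<xi>: "\<xi> > 0" using q by (simp add: \<xi>_def ln_less_zero)
  have qe: "q = exp (- 4 * \<xi>)" using q by (simp add: \<xi>_def)
  define w where "w = - ln r"
  have w: "w > 0" using r by (simp add: w_def ln_less_zero)
  have re: "r = exp (- w)" using r by (simp add: w_def)
  define y where "y = min (1 / 2) (\<xi> / 2)"
  have y: "0 < y" "y < 1" "2 * y \<le> \<xi>" using \<xi> by (auto simp: y_def)
  have lny: "ln y < 0" using y by (simp add: ln_less_zero)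
  define d where "d = \<xi> / (1 - ln y)"
  have d: "d > 0" using \<xi> lny by (simp add: d_def)
  define \<eta> where "\<eta> = min (2 * \<xi>) (w / 2)"
  have \<eta>: "\<eta> > 0" using \<xi> w by (simp add: \<eta>_def)
  have 1: "eventually (\<lambda>n::nat. 2 * exp 1 * C * real n * exp (- w * real n) \<le> exp (- w / 2 * real n)) at_top"
    using C w by real_asymp
  have 2: "eventually (\<lambda>n::nat. 2 * exp (- \<eta> * real n) \<le> exp (- \<eta> / 2 * real n)) at_top" using \<eta> by real_asymp
  from 1 2 have "eventually (\<lambda>n::nat. 2 * exp 1 * C * real n * exp (- w * real n) \<le> exp (- w / 2 * real n) \<and>
      2 * exp (- \<eta> * real n) \<le> exp (- \<eta> / 2 * real n) \<and> n \<ge> 1 \<and> n \<ge> n0) at_top"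
    using eventually_ge_at_top[of 1] eventually_ge_at_top[of n0] by eventually_elim auto
  then obtain n1 where n1: "\<And>n. n \<ge> n1 \<Longrightarrow> 2 * exp 1 * C * real n * exp (- w * real n) \<le> exp (- w / 2 * real n) \<and>
      2 * exp (- \<eta> * real n) \<le> exp (- \<eta> / 2 * real n) \<and> n \<ge> 1 \<and> n \<ge> n0"
    by (auto simp: eventually_at_top_linorder)
  show ?thesis
  proof (rule that[of "exp 1 * C" "exp (- \<eta> / 2)" d n1])
    fix n N assume "n \<ge> n1" and N: "n \<le> N" "N \<le> 2 * n" and md: "real (N - n + 1) \<le> d * real n"
    note n = n1[OF \<open>n \<ge> n1\<close>]
    define m where "m = N - n + 1"
    have m: "1 \<le> m" "m \<le> N" using n N by (auto simp: m_def)
    show "bounded_by (exp 1 * C) (exp (- \<eta> / 2)) n N"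
      unfolding bounded_by_def m_def[symmetric]
    proof (intro allI impI)
      fix \<epsilon> :: real assume \<epsilon>: "\<epsilon> > 0"
      \<comment> \<open>For \<epsilon> below \<open>r ^ n\<close> the small ball estimate is applied
        at scale \<open>r ^ n\<close>; the resulting term does not involve \<epsilon> and goes into
        \<open>c ^ n\<close>.\<close>
      define s where "s = max \<epsilon> (r ^ n)"
      have s: "s > 0" using \<epsilon> by (simp add: s_def)
      have "measure (PR {..<N} n) (small_event N n (\<epsilon> * real m)) \<le> real (N choose (N - n + 1)) * (q ^ n + (C * s) ^ m)"
      proof (rule small_event_union_bound[where \<tau>' = "s * real m"])
        show "\<epsilon> * real m \<le> s * real m" by (intro mult_right_mono) (auto simp: s_def)
        fix I assume I: "I \<subseteq> {..<N}" "card I = n - 1"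
        have "finite I" using I finite_subset by auto
        have J: "card ({..<N} - I) = m" using I n N by (subst card_Diff_subset) (auto simp: m_def \<open>finite I\<close>)
        have "n \<ge> n0" "finite ({..<N} - I)" "r ^ n \<le> s" using n by (auto simp: s_def)
        show "typically I n (q ^ n) (\<lambda>A. \<forall>x. sph n x \<and> (\<forall>i\<in>I. mv n A x i = 0) \<longrightarrow>
            \<P>(B in PR ({..<N} - I) n. l1 ({..<N} - I) n B x \<le> s * real m) \<le> (C * s) ^ m)"
        proof (rule typically_mono[OF ker[OF \<open>n \<ge> n0\<close> \<open>finite I\<close> I(2)] order_refl], intro allI impI)
          fix A x
          assume "\<forall>x. sph n x \<and> (\<forall>i\<in>I. mv n A x i = 0) \<longrightarrow> (\<forall>s. r ^ n \<le> s \<longrightarrow> anticoncentrated C n s x)"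
            and "sph n x \<and> (\<forall>i\<in>I. mv n A x i = 0)"
          then have "anticoncentrated C n s x" using \<open>r ^ n \<le> s\<close> by blast
          from this[unfolded anticoncentrated_def, rule_format, OF \<open>finite ({..<N} - I)\<close>]
          show "\<P>(B in PR ({..<N} - I) n. l1 ({..<N} - I) n B x \<le> s * real m) \<le> (C * s) ^ m" unfolding J .
        qed
      qed (use n N C s q in auto)
      also have "\<dots> = real (N choose m) * q ^ n + real (N choose m) * (C * s) ^ m"
        by (simp add: m_def ring_distribs)
      also have "real (N choose m) * q ^ n \<le> exp (- 2 * \<xi> * n)"
      proof -
        have "real (N choose m) * y ^ m \<le> (1 + y) ^ N" using y m by (intro choose_mult_power_le) auto
        also have "\<dots> \<le> (1 + y) ^ (2 * n)" using y N by (intro power_increasing) auto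
        also have "\<dots> \<le> exp y ^ (2 * n)" using y by (intro power_mono) auto
        also have "\<dots> = exp (2 * y * n)" by (simp add: exp_of_nat2_mult[symmetric] mult_ac)
        also have "\<dots> \<le> exp (\<xi> * n)"
        proof -
          have "2 * y * n \<le> \<xi> * n" using y by (intro mult_right_mono) auto
          then show ?thesis by simp
        qed
        finally have 1: "real (N choose m) * y ^ m \<le> exp (\<xi> * n)" .
        have 2: "exp (- \<xi> * n) \<le> y ^ m"
        proof -
          have "- ln y * m \<le> - ln y * (d * n)" using md lny by (intro mult_left_mono) (auto simp: m_def)
          also have "\<dots> \<le> \<xi> * n"
          proof -
            have "- ln y * d \<le> \<xi>" using \<xi> lny by (simp add: d_def field_simps)
            then have "- ln y * d * n \<le> \<xi> * n" by (intro mult_right_mono) auto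
            then show ?thesis by (simp add: mult.assoc)
          qed
          finally have "- \<xi> * n \<le> ln y * m" by simp
          then have "exp (- \<xi> * n) \<le> exp (ln y * m)" by (simp only: exp_le_cancel_iff)
          also have "\<dots> = y ^ m" using y by (simp add: exp_of_nat2_mult)
          finally show ?thesis .
        qed
        have "real (N choose m) * exp (- \<xi> * n) \<le> real (N choose m) * y ^ m" using 2 by (intro mult_left_mono) auto
        then have "real (N choose m) * exp (- \<xi> * n) \<le> exp (\<xi> * n)" using 1 by linarith
        then have "real (N choose m) * exp (- \<xi> * n) * exp (- 3 * \<xi> * n) \<le> exp (\<xi> * n) * exp (- 3 * \<xi> * n)"
          by (intro mult_right_mono) auto
        moreover have "q ^ n = exp (- \<xi> * n) * exp (- 3 * \<xi> * n)"
          unfolding qe by (simp add: exp_of_nat2_mult[symmetric] mult_exp_exp)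
        moreover have "exp (\<xi> * n) * exp (- 3 * \<xi> * n) = exp (- 2 * \<xi> * n)" by (simp add: mult_exp_exp)
        ultimately show ?thesis by (simp only: mult.assoc)
      qed
      also have "real (N choose m) * (C * s) ^ m \<le> (exp 1 * C * real N / real m * \<epsilon>) ^ m + exp (- w / 2 * n)"
      proof -
        define a where "a = exp 1 * C * real N / real m"
        have a: "a \<ge> 0" using C by (simp add: a_def)
        have "real (N choose m) * (C * s) ^ m \<le> (exp 1 * real N / real m) ^ m * (C * s) ^ m"
          using C s m by (intro mult_right_mono choose_le_exp) auto
        also have "\<dots> = (a * s) ^ m" unfolding power_mult_distrib[symmetric] by (simp add: a_def mult_ac)
        also have "\<dots> \<le> (a * \<epsilon>) ^ m + (a * r ^ n) ^ m"
          using a \<epsilon> r by (cases "\<epsilon> \<ge> r ^ n") (auto simp: s_def max_def)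
        also have "(a * r ^ n) ^ m \<le> exp (- w / 2 * n)"
        proof -
          have "a = exp 1 * C * (real N / real m)" by (simp add: a_def)
          also have "\<dots> \<le> exp 1 * C * (2 * real n)"
          proof (intro mult_left_mono)
            have "real N / real m \<le> real N / 1" using m by (intro divide_left_mono) auto
            then show "real N / real m \<le> 2 * real n" using N by linarith
          qed (use C in auto)
          finally have "a * r ^ n \<le> exp 1 * C * (2 * real n) * r ^ n" using r by (intro mult_right_mono) auto
          also have "r ^ n = exp (- w * n)" unfolding re by (simp only: exp_of_nat2_mult)
          also have "exp 1 * C * (2 * real n) * exp (- w * n) \<le> exp (- w / 2 * n)" using n by (simp add: mult_ac)
          finally have le: "a * r ^ n \<le> exp (- w / 2 * n)" unfolding re by (simp only: exp_of_nat2_mult)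
          have e1: "exp (- w / 2 * n) \<le> 1" using w by simp
          have "(a * r ^ n) ^ m \<le> exp (- w / 2 * n) ^ m"
            using le a r by (intro power_mono) auto
          \<comment> \<open>As \<open>m \<ge> 1\<close> and the base is at most 1, a single factor
            already gives the exponential bound.\<close>
          also have "\<dots> \<le> exp (- w / 2 * n) ^ 1" using e1 m by (intro power_decreasing) auto
          finally show ?thesis by simp
        qed
        finally show ?thesis by (simp add: a_def)
      qed
      also have "exp (- 2 * \<xi> * n) + ((exp 1 * C * real N / real m * \<epsilon>) ^ m + exp (- w / 2 * n))
        \<le> (exp 1 * C * real N / real m * \<epsilon>) ^ m + exp (- \<eta> / 2) ^ n"
      proof -
        have "\<eta> * n \<le> 2 * \<xi> * n" "\<eta> * n \<le> w / 2 * n" by (intro mult_right_mono; simp add: \<eta>_def)+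
        then have "exp (- 2 * \<xi> * n) \<le> exp (- \<eta> * n)" "exp (- w / 2 * n) \<le> exp (- \<eta> * n)" by auto
        moreover have "2 * exp (- \<eta> * real n) \<le> exp (- \<eta> / 2 * real n)" using n by blast
        moreover have "exp (- \<eta> / 2) ^ n = exp (- \<eta> / 2 * real n)" by (rule exp_of_nat2_mult[symmetric])
        ultimately show ?thesis by linarith
      qed
      finally show "measure (PR {..<N} n) (small_event N n (\<epsilon> * real m)) \<le> (exp 1 * C * real N / real m * \<epsilon>) ^ m + exp (- \<eta> / 2) ^ n"
        by simp
    qed
  qed (use C \<eta> d in auto)
qed

lemma tall_bound:
  assumes d: "d > 0"
  obtains C c :: real and n1 :: nat where "C > 0" "0 < c" "c < 1"
    "\<And>n N. \<lbrakk>n \<ge> n1; n \<le> N; N \<le> 2 * n; d * real n < real (N - n + 1)\<rbrakk> \<Longrightarrow> bounded_by C c n N"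
proof -
  obtain c q :: real and n0 :: nat where c: "c > 0" and q: "0 < q" "q < 1" and tall:
    "\<And>n N. \<lbrakk>n \<ge> n0; real n * (1 + d / 2) \<le> real N; N \<le> 2 * n\<rbrakk> \<Longrightarrow>
      typically {..<N} n (q ^ n) (\<lambda>A. \<forall>x. sph n x \<longrightarrow> c * n < l1 {..<N} n A x)"
    by (rule tall_matrix_event[of "d / 2"]) (use d in simp, blast)
  \<comment> \<open>Since \<open>N = n + m - 1\<close>, the off-by-one is compensated by
    \<open>d / 2 * n \<ge> 1\<close>, at the cost of half of \<open>d\<close>.\<close>
  define n1 where "n1 = max (max n0 1) (nat \<lceil>2 / d\<rceil>)"
  show ?thesis
  proof (rule that[of "2 / c" q n1])
    fix n N assume "n \<ge> n1" and N: "n \<le> N" "N \<le> 2 * n" and md: "d * real n < real (N - n + 1)"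
    have "n \<ge> n0" "n \<ge> 1" using \<open>n \<ge> n1\<close> by (auto simp: n1_def)
    have "2 / d \<le> real n" using \<open>n \<ge> n1\<close> by (simp add: n1_def)
    then have "2 \<le> d * n" using d by (simp add: field_simps)
    interpret PN: prob_space "PR {..<N} n" by (rule prob_space_P)
    define m where "m = N - n + 1"
    have m: "1 \<le> m" "m \<le> N" "m \<le> 2 * n" using \<open>n \<ge> 1\<close> N by (auto simp: m_def)
    have "real N = real n + real m - 1" using N by (simp add: m_def of_nat_diff)
    then have "real n * (1 + d / 2) \<le> real N" using md \<open>2 \<le> d * n\<close> by (simp add: m_def algebra_simps)
    then obtain Bad where Bad: "Bad \<in> sets (PR {..<N} n)" "measure (PR {..<N} n) Bad \<le> q ^ n"
      "\<And>A x. A \<in> space (PR {..<N} n) - Bad \<Longrightarrow> sph n x \<Longrightarrow> c * n < l1 {..<N} n A x"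
      using tall[OF \<open>n \<ge> n0\<close> _ N(2)] unfolding typically_def by blast
    show "bounded_by (2 / c) q n N"
      unfolding bounded_by_def m_def[symmetric]
    proof (intro allI impI)
      fix \<epsilon> :: real assume \<epsilon>: "\<epsilon> > 0"
      have nn: "0 \<le> (2 / c * real N / real m * \<epsilon>) ^ m" using c \<epsilon> by (intro zero_le_power) auto
      show "measure (PR {..<N} n) (small_event N n (\<epsilon> * real m)) \<le> (2 / c * real N / real m * \<epsilon>) ^ m + q ^ n"
      proof (cases "\<epsilon> * real m \<le> c * n")
        case True
        have "small_event N n (\<epsilon> * real m) \<subseteq> Bad"
        proof
          fix A assume "A \<in> small_event N n (\<epsilon> * real m)"
          then obtain x where "A \<in> space (PR {..<N} n)" "sph n x" "l1 {..<N} n A x < \<epsilon> * real m"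
            by (auto simp: small_event_def)
          then show "A \<in> Bad" using Bad(3)[of A x] True by force
        qed
        then have "measure (PR {..<N} n) (small_event N n (\<epsilon> * real m)) \<le> measure (PR {..<N} n) Bad"
          using Bad(1) by (rule PN.finite_measure_mono)
        then show ?thesis using Bad(2) nn by linarith
      next
        case False
        \<comment> \<open>For such large \<epsilon> the claim is trivial: \<open>m \<le> N\<close>
          and \<open>m \<le> 2 * n\<close> make the base of the first term at least 1.\<close>
        have "m * m \<le> N * (2 * n)" using m by (intro mult_mono) auto
        then have "real (m * m) \<le> real (N * (2 * n))" by (simp only: of_nat_le_iff)
        then have mm: "real m * real m \<le> 2 / c * real N * (c * real n)" using c by simp
        also have "\<dots> \<le> 2 / c * real N * (\<epsilon> * real m)" using False c by (intro mult_left_mono) auto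
        finally have "real m * real m \<le> (2 / c * real N * \<epsilon>) * real m" by (simp only: mult.assoc)
        then have "real m \<le> 2 / c * real N * \<epsilon>" by (rule mult_right_le_imp_le) (use m in simp)
        then have "1 \<le> (2 / c * real N * \<epsilon>) / real m" using m by (intro le_divide_eq_1_pos[THEN iffD2]) auto
        then have "1 \<le> 2 / c * real N / real m * \<epsilon>" by simp
        then have "1 \<le> (2 / c * real N / real m * \<epsilon>) ^ m" by (rule one_le_power)
        then show ?thesis using PN.prob_le_1[of "small_event N n (\<epsilon> * real m)"] zero_le_power[of q n] q by linarith
      qed
    qed
  qed (use c q in auto)
qed

lemma fixed_size_bounded_by:
  assumes n: "1 \<le> n" "n \<le> N"
  shows "\<exists>C c. 0 < C \<and> 0 < c \<and> c < 1 \<and> bounded_by C c n N"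
proof -
  obtain t c :: real where t: "t > 0" and c: "0 < c" "c < 1" and le:
    "\<And>\<tau>. \<tau> \<le> t \<Longrightarrow> \<tau> > 0 \<Longrightarrow> measure (PR {..<N} n) (small_event N n \<tau>) \<le> c"
    unfolding small_event_def by (rule fixed_size_bound[OF n]) blast
  interpret PN: prob_space "PR {..<N} n" by (rule prob_space_P)
  define m where "m = N - n + 1"
  have m: "1 \<le> m" by (simp add: m_def)
  have N: "N \<ge> 1" using n by simp
  \<comment> \<open>Then \<open>C * N / m * \<epsilon> = \<epsilon> * m / t\<close>, so the first
    term is at least 1 as soon as \<open>\<epsilon> * m\<close> exceeds \<open>t\<close>.\<close>
  define C where "C = real m * real m / (real N * t)"
  have C: "C > 0" using m N t by (simp add: C_def)
  \<comment> \<open>The root turns the fixed bound \<open>c < 1\<close> into the required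
    \<open>n\<close>-th power.\<close>
  have rc: "root n c ^ n = c" "0 < root n c" "root n c < 1"
    using c n by (auto simp: real_root_pow_pos2)
  have "bounded_by C (root n c) n N" unfolding bounded_by_def m_def[symmetric]
  proof (intro allI impI)
    fix \<epsilon> :: real assume \<epsilon>: "\<epsilon> > 0"
    have nn: "0 \<le> (C * real N / real m * \<epsilon>) ^ m" using C \<epsilon> by (intro zero_le_power) auto
    show "measure (PR {..<N} n) (small_event N n (\<epsilon> * real m)) \<le> (C * real N / real m * \<epsilon>) ^ m + root n c ^ n"
    proof (cases "\<epsilon> * real m \<le> t")
      case True
      have "0 < \<epsilon> * real m" using \<epsilon> m by simp
      then show ?thesis using le[OF True] nn rc by simp
    next
      case False
      have "C * real N / real m * \<epsilon> = \<epsilon> * real m / t" using N m t by (simp add: C_def field_simps)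
      also have "1 \<le> \<epsilon> * real m / t" using False t by simp
      finally have "1 \<le> C * real N / real m * \<epsilon>" .
      then have "1 \<le> (C * real N / real m * \<epsilon>) ^ m" by (rule one_le_power)
      then show ?thesis using PN.prob_le_1[of "small_event N n (\<epsilon> * real m)"] rc c by linarith
    qed
  qed
  then show ?thesis using C rc by blast
qed

lemma finitely_many_bounded_by:
  assumes "finite S" "\<And>n N. (n, N) \<in> S \<Longrightarrow> 1 \<le> n \<and> n \<le> N"
  shows "\<exists>C c. 0 < C \<and> 0 < c \<and> c < 1 \<and> (\<forall>(n, N)\<in>S. bounded_by C c n N)"
  using assms
proof (induction S rule: finite_induct)
  case empty
  show ?case by (intro exI[of _ 1] exI[of _ "1 / 2"]) auto
next
  case (insert p S)
  obtain C c where 1: "0 < C" "0 < c" "c < 1" "\<forall>(n, N)\<in>S. bounded_by C c n N"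
    using insert.IH insert.prems by auto
  obtain n N where p: "p = (n, N)" by (cases p)
  then obtain C' c' where 2: "0 < C'" "0 < c'" "c' < 1" "bounded_by C' c' n N"
    using fixed_size_bounded_by[of n N] insert.prems by blast
  have "bounded_by (max C C') (max c c') k K" if "(k, K) \<in> insert p S" for k K
  proof (cases "(k, K) \<in> S")
    case True
    then have "bounded_by C c k K" using 1 by auto
    then show ?thesis by (rule bounded_by_mono) (use 1 in auto)
  next
    case False
    then have "bounded_by C' c' k K" using that 2 p by auto
    then show ?thesis by (rule bounded_by_mono) (use 2 in auto)
  qed
  then show ?case
    using 1 2 by (intro exI[of _ "max C C'"] exI[of _ "max c c'"]) auto
qed

text \<open>The two regimes cover all large \<open>n\<close>. Because of
  \<open>N \<le> 2 * n\<close> only finitely many further sizes remain, and they enter through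
  maxima of constants.\<close>

lemma l1_small_ball_sphere:
  "\<exists>C>0. \<exists>c. 0 < c \<and> c < 1 \<and> (\<forall>n N. n \<le> N \<longrightarrow> N \<le> 2 * n \<longrightarrow> bounded_by C c n N)"
proof -
  obtain C1 c1 d :: real and n1 :: nat where 1: "C1 > 0" "0 < c1" "c1 < 1" "d > 0"
    "\<And>n N. \<lbrakk>n \<ge> n1; n \<le> N; N \<le> 2 * n; real (N - n + 1) \<le> d * real n\<rbrakk> \<Longrightarrow> bounded_by C1 c1 n N"
    by (rule nearly_square_bound) blast
  obtain C2 c2 :: real and n2 :: nat where 2: "C2 > 0" "0 < c2" "c2 < 1"
    "\<And>n N. \<lbrakk>n \<ge> n2; n \<le> N; N \<le> 2 * n; d * real n < real (N - n + 1)\<rbrakk> \<Longrightarrow> bounded_by C2 c2 n N"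
    by (rule tall_bound[OF 1(4)]) blast
  define S where "S = {(n, N). 1 \<le> n \<and> n \<le> N \<and> N \<le> 2 * n \<and> n < max n1 n2}"
  have "finite S"
  proof (rule finite_subset)
    show "S \<subseteq> {..max n1 n2} \<times> {..2 * max n1 n2}" by (auto simp: S_def)
  qed simp
  then have "\<exists>C c. 0 < C \<and> 0 < c \<and> c < 1 \<and> (\<forall>(n, N)\<in>S. bounded_by C c n N)"
    by (rule finitely_many_bounded_by) (auto simp: S_def)
  then obtain C3 c3 where 3: "C3 > 0" "0 < c3" "c3 < 1" "\<forall>(n, N)\<in>S. bounded_by C3 c3 n N"
    by blast
  define C where "C = max C1 (max C2 C3)"
  define c where "c = max c1 (max c2 c3)"
  have "bounded_by C c n N" if N: "n \<le> N" "N \<le> 2 * n" for n N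
  proof -
    consider "n = 0" | "(n, N) \<in> S" | "n \<ge> n1" "real (N - n + 1) \<le> d * real n" | "n \<ge> n2" "d * real n < real (N - n + 1)"
      using N by (fastforce simp: S_def)
    then show ?thesis
    proof cases
      case 1
      \<comment> \<open>For \<open>n = 0\<close> the unit sphere is empty, as an empty sum of
        squares is not 1.\<close>
      then have "small_event N n \<tau> = {}" for \<tau> by (simp add: small_event_def sph_def)
      then show ?thesis using 1 N by (simp add: bounded_by_def)
    next
      case 2
      then have "bounded_by C3 c3 n N" using 3(4) by auto
      then show ?thesis by (rule bounded_by_mono) (use 3 in \<open>auto simp: C_def c_def\<close>)
    next
      case 3
      then have "bounded_by C1 c1 n N" using 1(5) N by auto
      then show ?thesis by (rule bounded_by_mono) (use 1 in \<open>auto simp: C_def c_def\<close>)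
    next
      case 4
      then have "bounded_by C2 c2 n N" using 2(4) N by auto
      then show ?thesis by (rule bounded_by_mono) (use 2 in \<open>auto simp: C_def c_def\<close>)
    qed
  qed
  moreover have "C > 0" "0 < c" "c < 1" using 1 2 3 by (auto simp: C_def c_def)
  ultimately show ?thesis by blast
qed

end

theorem theorem8p2:
  fixes M :: "real measure"
  assumes "prob_space M"
    and "sets M = sets borel"
    and "subgaussian_dist M"
    and "integrable M (\<lambda>x. x)" and "(\<integral>x. x \<partial>M) = 0"
    and "integrable M (\<lambda>x. x\<^sup>2)" and "(\<integral>x. x\<^sup>2 \<partial>M) = 1"
  shows "\<exists>C>0. \<exists>c. 0 < c \<and> c < 1 \<and>
    (\<forall>(n::nat) (N::nat) (\<epsilon>::real). n \<le> N \<longrightarrow> N \<le> 2 * n \<longrightarrow> \<epsilon> > 0 \<longrightarrow>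
      (let m = N - n + 1;
           P = PiM ({..<N} \<times> {..<n}) (\<lambda>_. M);
           E = {A \<in> space P. \<exists>x :: nat \<Rightarrow> real. (\<Sum>j<n. (x j)\<^sup>2) = 1 \<and>
                  (\<Sum>i<N. \<bar>\<Sum>j<n. A (i, j) * x j\<bar>) < \<epsilon> * real m}
       in E \<in> sets P \<and> measure P E \<le> (C * real N / real m * \<epsilon>) ^ m + c ^ n))"
proof -
  interpret subgaussian_law M
    using assms by (simp add: subgaussian_law_def subgaussian_law_axioms_def real_law_def real_law_axioms_def)
  obtain C c where C: "C > 0" "0 < c" "c < 1" "\<And>n N. n \<le> N \<Longrightarrow> N \<le> 2 * n \<Longrightarrow> bounded_by C c n N"
    using l1_small_ball_sphere by blast
  have E: "{A \<in> space (PR {..<N} n). \<exists>x :: nat \<Rightarrow> real. (\<Sum>j<n. (x j)\<^sup>2) = 1 \<and>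
      (\<Sum>i<N. \<bar>\<Sum>j<n. A (i, j) * x j\<bar>) < \<tau>} = small_event N n \<tau>" for n N \<tau>
    by (simp add: small_event_def sph_def l1_def mv_def)
  show ?thesis
  proof (rule exI[of _ C], intro conjI C(1), rule exI[of _ c], intro conjI C(2,3) allI impI)
    fix n N :: nat and \<epsilon> :: real assume nN: "n \<le> N" "N \<le> 2 * n" and \<epsilon>: "\<epsilon> > 0"
    have "small_event N n (\<epsilon> * real (N - n + 1)) \<in> sets (PR {..<N} n)"
      using \<epsilon> by (intro sets_small_event) simp
    moreover have "measure (PR {..<N} n) (small_event N n (\<epsilon> * real (N - n + 1)))
      \<le> (C * real N / real (N - n + 1) * \<epsilon>) ^ (N - n + 1) + c ^ n"
      using C(4)[OF nN] \<epsilon> by (simp only: bounded_by_def)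
    ultimately show "let m = N - n + 1;
           P = PiM ({..<N} \<times> {..<n}) (\<lambda>_. M);
           E = {A \<in> space P. \<exists>x :: nat \<Rightarrow> real. (\<Sum>j<n. (x j)\<^sup>2) = 1 \<and>
                  (\<Sum>i<N. \<bar>\<Sum>j<n. A (i, j) * x j\<bar>) < \<epsilon> * real m}
       in E \<in> sets P \<and> measure P E \<le> (C * real N / real m * \<epsilon>) ^ m + c ^ n"
      unfolding Let_def E by blast
  qed
qed

end
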